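(* Let $\mathcal{A}$ be a $\mathrm{GL}(n)$-alternating tableau of length $r\le\lfloor\frac{n+1}{2}\rfloor$ (of arbitrary shape). Then $\mathcal{P}(\mathrm{ev}\,\mathcal{A})$ is the reverse-complement of $\mathcal{P}(\mathcal{A})$, and $\mathcal{P}_P(\mathrm{ev}\,\mathcal{A})$ and $\mathcal{P}_Q(\mathrm{ev}\,\mathcal{A})$ are obtained by applying Schützenberger's evacuation to $\mathcal{P}_P(\mathcal{A})$ and $\mathcal{P}_Q(\mathcal{A})$ respectively: $$\big(\mathcal{P}_P(\mathrm{ev}\,\mathcal{A}),\mathcal{P}_Q(\mathrm{ev}\,\mathcal{A})\big)=\big(\mathrm{ev}\,\mathcal{P}_P(\mathcal{A}),\mathrm{ev}\,\mathcal{P}_Q(\mathcal{A})\big).$$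
   Context: **Alternating tableaux.** A staircase is a vector in $\mathbb{Z}^n$ with weakly decreasing entries; $\emptyset$ denotes the zero vector. A $\mathrm{GL}(n)$-alternating tableau of length $r$ and shape $\mu$ is a sequence of staircases $\mathcal{A}=(\emptyset=\mu^0,\mu^1,\dots,\mu^{2r}=\mu)$ such that for even $i$, $\mu^{i+1}$ is obtained from $\mu^i$ by adding $1$ to an entry, and for odd $i$, $\mu^{i+1}$ is obtained from $\mu^i$ by subtracting $1$ from an entry. The positive part $\rho_+$ of a staircase $\rho$ is the partition formed by its positive entries; the negative part $\rho_-$ is the partition formed by the absolute values of its negative entries (in weakly decreasing order). **Evacuation.** Alternating tableaux correspond to highest weight words in the $r$-th tensor power of the crystal of $V\otimes V^\ast$, $V$ the vector representation of $\mathrm{GL}(n)$, and evacuation $\mathrm{ev}$ is the action of the generator $s_{1,r}$ of the cactus group. Explicitly (this may be taken as the definition): for $v\in\mathbb{Z}^n$ let $\mathrm{dom}(v)$ be $v$ sorted into weakly decreasing order. Define an array by $T_{0,j}=\mu^j$ for $0\le j\le 2r$ and, for $0\le i<r$: $T_{2i+1,2i+2}=T_{2i,2i+1}$; $T_{2i+1,j}=\mathrm{dom}(T_{2i+1,j-1}+T_{2i,j}-T_{2i,j-1})$ for $2i+2<j\le 2r$; $T_{2i+2,2i+2}=\emptyset$; $T_{2i+2,j}=\mathrm{dom}(T_{2i+2,j-1}+T_{2i+1,j}-T_{2i+1,j-1})$ for $2i+2<j\le 2r$. Then the $i$-th staircase of $\mathrm{ev}\,\mathcal{A}$ is $T_{2r-i,2r}$,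 $0\le i\le 2r$. **Backward rule of growth diagrams.** Consider a square cell whose corners top-left, top-right, bottom-right are labelled with partitions $\kappa$, $\mu$, $\nu$, where $\mu$ equals or is obtained by adding one cell from each of $\kappa$, $\nu$. If $\kappa=\nu$ and $\mu=\kappa+e_1$ (a cell added to the first row), then the cell contains a cross and the bottom-left corner gets the label $\lambda=\kappa$. Otherwise the cell is empty and the bottom-left label is determined by $\lambda'=\mathrm{sort}(\kappa'+\nu'-\mu')$, where $'$ is conjugation of partitions and $\mathrm{sort}$ sorts into weakly decreasing order. In the version rotated by $180^\circ$, the bottom-left corner plays the role of $\mu$, the top-left and bottom-right corners those of $\nu,\kappa$, and the top-right corner that of $\lambda$. **The map $\mathcal{A}\mapsto(\mathcal{P}(\mathcal{A}),\mathcal{P}_P(\mathcal{A}),\mathcal{P}_Q(\mathcal{A}))$.** Consider an $r\times r$ square of cells with corners $(a,b)$, $0\le a,b\le r$; $a$ is the horizontal coordinate (increasing to the right), $b$ the vertical one (increasing downwards). The cell in column $i$ and row $j$ ($1\le i,j\le r$) has corners $(i-1,j-1),(i,j-1),(i-1,j),(i,j)$. Put $\mu^{2i}$ at corner $(i,i)$ for $0\le i\le r$ and $\mu^{2i+1}$ at corner $(i+1,i)$ for $0\le i<r$. Starting from the positive parts of these staircases, apply the backward rule successively to the cells in column $i$, row $j$ with $i\le j$, determining partitions at all corners $(a,b)$ with $a\le b$ and the crosses in these cells. Starting from the negative parts, apply the backward rule rotated by $180^\circ$ to the cells with $i>j$, determining partitions at all corners with $a\ge b$ and the crosses in these cells.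 $\mathcal{P}(\mathcal{A})$ maps $i$ to $j$ for every cross in column $i$ and row $j$; it is a bijection $R\to S$ between two subsets of $\{1,\dots,r\}$. $\mathcal{P}_P(\mathcal{A})$ is the partial standard Young tableau (distinct entries, strictly increasing along rows and columns) corresponding to the sequence of partitions (from positive parts) at $(0,r),(1,r),\dots,(r,r)$: the entry $i$ is in the cell by which the $i$-th partition differs from the $(i-1)$-st, if they differ. $\mathcal{P}_Q(\mathcal{A})$ is defined likewise from the sequence of partitions (from negative parts) at $(r,0),(r,1),\dots,(r,r)$. **Reverse-complement.** For a bijection $\pi:R\to S$ between subsets of $\{1,\dots,r\}$, the reverse-complement maps $r+1-i$ to $r+1-\pi(i)$ for $i\in R$. **Schützenberger evacuation** of a partial standard Young tableau $T$ with entries in $\{1,\dots,r\}$: rotate $T$ by $180^\circ$, replace each entry $x$ by $r+1-x$, and rectify the resulting skew tableau by jeu de taquin. *)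

theory Defs
  imports Main
begin

section \<open>Alternating tableaux\<close>

definition sort_desc :: "'a::linorder list \<Rightarrow> 'a list" where
  "sort_desc v = rev (sort v)"

definition staircase :: "nat \<Rightarrow> int list \<Rightarrow> bool" where
  "staircase n v \<longleftrightarrow> length v = n \<and> sorted_wrt (\<ge>) v"

abbreviation zero_vec :: "nat \<Rightarrow> int list" where
  "zero_vec n \<equiv> replicate n 0"

definition alternating_tableau :: "nat \<Rightarrow> nat \<Rightarrow> int list \<Rightarrow> int list list \<Rightarrow> bool" where
  "alternating_tableau n r \<mu> A \<longleftrightarrow>
     length A = 2 * r + 1 \<and> (\<forall>v \<in> set A. staircase n v) \<and>
     A ! 0 = zero_vec n \<and> A ! (2 * r) = \<mu> \<and>
     (\<forall>i < 2 * r. \<exists>k < n.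
        A ! Suc i = (A ! i)[k := (A ! i) ! k + (if even i then 1 else - 1)])"

text \<open>Partitions are weakly decreasing lists of positive numbers; cells of Young diagrams are pairs
  (row, column), numbered from 0, in English notation.\<close>

definition pos_part :: "int list \<Rightarrow> nat list" where
  "pos_part v = map nat (filter (\<lambda>x. 0 < x) v)"

definition neg_part :: "int list \<Rightarrow> nat list" where
  "neg_part v = rev (map (\<lambda>x. nat (- x)) (filter (\<lambda>x. x < 0) v))"


section \<open>Evacuation of alternating tableaux\<close>

text \<open>Row \<open>Suc k\<close> of the array starts at column \<open>k + 2\<close> if \<open>k\<close> is even and at column \<open>k + 1\<close> if \<open>k\<close>
  is odd. The entries to the left of that column are junk (they repeat the initial value of the row)
  and are never used.\<close>

fun evac_array :: "nat \<Rightarrow> int list list \<Rightarrow> nat \<Rightarrow> nat \<Rightarrow> int list" where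
  "evac_array n A 0 j = A ! j"
| "evac_array n A (Suc k) j =
     (if even k \<and> j \<le> k + 2 then evac_array n A k (k + 1)
      else if odd k \<and> j \<le> k + 1 then zero_vec n
      else sort_desc (map2 (-) (map2 (+) (evac_array n A (Suc k) (j - 1)) (evac_array n A k j))
                               (evac_array n A k (j - 1))))"

definition evac :: "nat \<Rightarrow> nat \<Rightarrow> int list list \<Rightarrow> int list list" where
  "evac n r A = map (\<lambda>i. evac_array n A (2 * r - i) (2 * r)) [0..<2 * r + 1]"


section \<open>Growth diagrams\<close>

text \<open>The length of column \<open>j\<close> (numbered from 0) of a partition.\<close>

definition col_length :: "nat list \<Rightarrow> nat \<Rightarrow> nat" where
  "col_length \<kappa> j = length (filter (\<lambda>x. j < x) \<kappa>)"

definition conj_part :: "nat list \<Rightarrow> nat list" where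
  "conj_part \<kappa> = map (col_length \<kappa>) [0..<Max (insert 0 (set \<kappa>))]"

fun add_first_row :: "nat list \<Rightarrow> nat list" where
  "add_first_row [] = [1]"
| "add_first_row (x # xs) = Suc x # xs"

definition has_cross :: "nat list \<Rightarrow> nat list \<Rightarrow> nat list \<Rightarrow> bool" where
  "has_cross \<kappa> \<mu> \<nu> \<longleftrightarrow> \<kappa> = \<nu> \<and> \<mu> = add_first_row \<kappa>"

text \<open>The arguments are the labels of the top-left, top-right and bottom-right corner. All columns
  of \<open>\<kappa>\<close> and \<open>\<nu>\<close> are among the first \<open>length (conj_part \<mu>)\<close> ones, because \<open>\<mu>\<close> contains both. The
  subtraction of natural numbers is not truncated: a negative difference requires
  that \<open>\<kappa>\<close> and \<open>\<nu>\<close> both arise from \<open>\<mu>\<close> by deleting a column of length 1, which is the case of a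
  cross. The final conjugation turns the conjugate of the new label into the label.\<close>

definition backward_rule :: "nat list \<Rightarrow> nat list \<Rightarrow> nat list \<Rightarrow> nat list" where
  "backward_rule \<kappa> \<mu> \<nu> =
     (if has_cross \<kappa> \<mu> \<nu> then \<kappa>
      else conj_part (sort_desc
             (map (\<lambda>j. col_length \<kappa> j + col_length \<nu> j - col_length \<mu> j)
                  [0..<length (conj_part \<mu>)])))"

text \<open>\<open>pos_label A a b\<close> is the label of the corner \<open>(a, b)\<close> obtained from positive parts, for
  \<open>a \<le> b + 1\<close>, and \<open>neg_label A a b\<close> is the one obtained from negative parts, for \<open>b \<le> a\<close>; the values
  at other corners are junk.\<close>

function pos_label :: "int list list \<Rightarrow> nat \<Rightarrow> nat \<Rightarrow> nat list" where
  "pos_label A a b =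
     (if b < a then pos_part (A ! (2 * b + 1))
      else if a = b then pos_part (A ! (2 * a))
      else backward_rule (pos_label A a (b - 1)) (pos_label A (a + 1) (b - 1)) (pos_label A (a + 1) b))"
  by pat_completeness auto
termination by (relation "measure (\<lambda>(A, a, b). b - a)") auto

function neg_label :: "int list list \<Rightarrow> nat \<Rightarrow> nat \<Rightarrow> nat list" where
  "neg_label A a b =
     (if a \<le> b then neg_part (A ! (2 * a))
      else if a = b + 1 then neg_part (A ! (2 * b + 1))
      else backward_rule (neg_label A a (b + 1)) (neg_label A (a - 1) (b + 1)) (neg_label A (a - 1) b))"
  by pat_completeness auto
termination by (relation "measure (\<lambda>(A, a, b). a - b)") auto

declare pos_label.simps [simp del] neg_label.simps [simp del]

definition cross_at :: "int list list \<Rightarrow> nat \<Rightarrow> nat \<Rightarrow> bool" where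
  "cross_at A i j \<longleftrightarrow>
     (if i \<le> j
      then has_cross (pos_label A (i - 1) (j - 1)) (pos_label A i (j - 1)) (pos_label A i j)
      else has_cross (neg_label A i j) (neg_label A (i - 1) j) (neg_label A (i - 1) (j - 1)))"

text \<open>The partial bijection is represented by its graph.\<close>

definition partial_perm :: "nat \<Rightarrow> int list list \<Rightarrow> (nat \<times> nat) set" where
  "partial_perm r A = {(i, j). i \<in> {1..r} \<and> j \<in> {1..r} \<and> cross_at A i j}"

definition reverse_complement :: "nat \<Rightarrow> (nat \<times> nat) set \<Rightarrow> (nat \<times> nat) set" where
  "reverse_complement r \<pi> = (\<lambda>(i, j). (r + 1 - i, r + 1 - j)) ` \<pi>"


section \<open>Partial standard Young tableaux\<close>

text \<open>A (skew) tableau is a partial map from cells to entries.\<close>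

type_synonym tableau = "nat \<times> nat \<Rightarrow> nat option"

definition diagram :: "nat list \<Rightarrow> (nat \<times> nat) set" where
  "diagram \<kappa> = {(i, j). i < length \<kappa> \<and> j < \<kappa> ! i}"

definition tableau_of_chain :: "nat \<Rightarrow> (nat \<Rightarrow> nat list) \<Rightarrow> tableau" where
  "tableau_of_chain r \<Lambda> = (\<lambda>c.
     if \<exists>i \<in> {1..r}. c \<in> diagram (\<Lambda> i) - diagram (\<Lambda> (i - 1))
     then Some (THE i. i \<in> {1..r} \<and> c \<in> diagram (\<Lambda> i) - diagram (\<Lambda> (i - 1)))
     else None)"

definition tableau_P :: "nat \<Rightarrow> int list list \<Rightarrow> tableau" where
  "tableau_P r A = tableau_of_chain r (\<lambda>a. pos_label A a r)"

definition tableau_Q :: "nat \<Rightarrow> int list list \<Rightarrow> tableau" where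
  "tableau_Q r A = tableau_of_chain r (\<lambda>b. neg_label A r b)"


section \<open>Jeu de taquin and evacuation of tableaux\<close>

text \<open>\<open>slide T c U\<close>: starting with a hole at the cell \<open>c\<close> of \<open>T\<close>, repeatedly move the smaller one of
  the entries to the right of the hole and below the hole into the hole, until there are none; the
  result is \<open>U\<close>.\<close>

inductive slide :: "tableau \<Rightarrow> nat \<times> nat \<Rightarrow> tableau \<Rightarrow> bool" where
  stop: "T (i, Suc j) = None \<Longrightarrow> T (Suc i, j) = None \<Longrightarrow> slide T (i, j) T"
| right: "T (i, Suc j) = Some x \<Longrightarrow> (\<And>y. T (Suc i, j) = Some y \<Longrightarrow> x < y) \<Longrightarrow>
    slide (T((i, j) := Some x, (i, Suc j) := None)) (i, Suc j) U \<Longrightarrow> slide T (i, j) U"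
| below: "T (Suc i, j) = Some y \<Longrightarrow> (\<And>x. T (i, Suc j) = Some x \<Longrightarrow> y < x) \<Longrightarrow>
    slide (T((i, j) := Some y, (Suc i, j) := None)) (Suc i, j) U \<Longrightarrow> slide T (i, j) U"

text \<open>For a skew diagram \<open>D\<close>, the set \<open>inner_shape D\<close> is the smallest Young diagram disjoint
  from \<open>D\<close> whose union with \<open>D\<close> is a Young diagram; it is empty iff \<open>D\<close> is a Young diagram.\<close>

definition inner_shape :: "(nat \<times> nat) set \<Rightarrow> (nat \<times> nat) set" where
  "inner_shape D = {(i, j). (i, j) \<notin> D \<and> (\<exists>(k, l) \<in> D. i \<le> k \<and> j \<le> l)}"

definition inner_corner :: "(nat \<times> nat) set \<Rightarrow> nat \<times> nat \<Rightarrow> bool" where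
  "inner_corner D c \<longleftrightarrow> (case c of (i, j) \<Rightarrow>
     (i, j) \<in> inner_shape D \<and> (i, Suc j) \<notin> inner_shape D \<and> (Suc i, j) \<notin> inner_shape D)"

definition jdt_step :: "tableau \<Rightarrow> tableau \<Rightarrow> bool" where
  "jdt_step T U \<longleftrightarrow> (\<exists>c. inner_corner (dom T) c \<and> slide T c U)"

text \<open>The inner corners may be chosen in any order; the definite description expresses that the
  result does not depend on the choices.\<close>

definition rectify :: "tableau \<Rightarrow> tableau" where
  "rectify T = (THE U. jdt_step\<^sup>*\<^sup>* T U \<and> inner_shape (dom U) = {})"

text \<open>Rotation takes place in the smallest rectangle containing the (straight) shape, and is combined
  with complementing the entries.\<close>

definition rotate_complement :: "nat \<Rightarrow> tableau \<Rightarrow> tableau" where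
  "rotate_complement r T =
     (let h = card {i. (i, 0) \<in> dom T}; w = card {j. (0, j) \<in> dom T} in
      (\<lambda>(i, j). if i < h \<and> j < w
               then map_option (\<lambda>x. r + 1 - x) (T (h - 1 - i, w - 1 - j)) else None))"

definition schuetzenberger_evac :: "nat \<Rightarrow> tableau \<Rightarrow> tableau" where
  "schuetzenberger_evac r T = rectify (rotate_complement r T)"

end

theory Submission
  imports Defs "HOL-Library.Multiset"
begin

text \<open>Extend the tableau until it has empty shape. Its crosses then form a partial permutation matrix, and
  each label of the growth diagrams is the Robinson-Schensted shape of a submatrix. The shape of a
  submatrix obeys a local rule for each of the six pairs of sides at which a row or column can be
  attached: Fomin's rule at opposite corners (right and top, left and bottom), its conjugate at the
  other two corners, and the rule of jeu de taquin for two opposite sides. All rules follow from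
  Fomin's rule at one corner by a lemma on cubes of shapes.

  The staircase \<open>T i j\<close> of the evacuation array has as its positive part the shape of the submatrix
  whose columns are the indices between \<open>i / 2\<close> and \<open>j / 2\<close> and whose rows are the remaining indices in cyclic order,
  starting after \<open>j / 2\<close>; its negative part arises from rows between \<open>i / 2\<close> and \<open>j / 2\<close> and the remaining columns. Indeed,
  the rule \<open>sort (\<lambda> + \<nu> - \<kappa>)\<close> amounts to the conjugate of Fomin's rule or to jeu de taquin on either part.
  The bound on \<open>r\<close> ensures that both parts fit into \<open>n\<close> entries. In the last column of the array, the
  matrix appears rotated by 180 degrees.\<close>


section \<open>Shapes and local rules\<close>

text \<open>The statement on tableaux needs an argument of its own. On the outer sides of the growth
  diagrams, \<open>P\<close> of the tableau records the shapes of the columns \<open>1..a\<close>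
  over the rows beyond \<open>r\<close>, and \<open>P\<close> of its evacuation those of the columns
  \<open>r-a+1..r\<close> over the same rows; so initial segments have to be turned into final
  segments by jeu de taquin. The obstacle is that rectification leaves the order of the slides open.
  Rectangles overcome it: for a chain of shapes that ends in a full rectangle, the shape of a final
  segment is the complement of that of the initial segment. A triangle of shapes obeying the rule of
  jeu de taquin is determined by its right side, and complements do not show in which order the
  inner cells were filled. Hence all orders of slides end with the same tableau. Submatrices are
  given by lists of lines because a list can be cyclic and can grow at both ends. Labels are
  compared as functions rather than as lists, so that adding a cell is a function update.\<close>

type_synonym shape = "nat \<Rightarrow> nat"

definition is_shape :: "shape \<Rightarrow> bool" where
  "is_shape f \<longleftrightarrow> antimono f \<and> (\<exists>n. f n = 0)"

text \<open>A step between neighbouring shapes is labelled by the row of the added cell, and by \<open>None\<close> if the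
  shapes agree. In a square of shapes, the arguments \<open>l\<close>, \<open>k\<close>, \<open>n\<close>, \<open>m\<close> are the smallest corner, the two
  corners next to it, and the corner opposite to it; \<open>x\<close> tells whether the cell contains a cross.\<close>

fun add_cell :: "shape \<Rightarrow> nat option \<Rightarrow> shape" (infixl "\<oplus>" 65) where
  "f \<oplus> None = f"
| "f \<oplus> Some k = f(k := Suc (f k))"

text \<open>As a function of its last argument, \<open>top_row f\<close> is the conjugate of \<open>f\<close>.\<close>

definition top_row :: "shape \<Rightarrow> nat \<Rightarrow> nat" where
  "top_row f v = (LEAST t. f t \<le> v)"

text \<open>Row insertion: a collision moves the cell to the next row, and a cross starts in the
  first row.\<close>

fun fomin_label :: "nat option \<Rightarrow> nat option \<Rightarrow> bool \<Rightarrow> nat option" where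
  "fomin_label p q x = (if p \<noteq> q then q else
     case p of None \<Rightarrow> if x then Some 0 else None | Some k \<Rightarrow> Some (Suc k))"

text \<open>Column insertion. The column of the new cell is prescribed, namely 0 at a cross and the
  one after the bumped cell at a collision; \<open>top_row\<close> finds the row that can take a
  cell in this column.\<close>

fun dual_label :: "shape \<Rightarrow> nat option \<Rightarrow> nat option \<Rightarrow> bool \<Rightarrow> nat option" where
  "dual_label f p q x = (if p \<noteq> q then q else
     case p of None \<Rightarrow> if x then Some (top_row f 0) else None
     | Some k \<Rightarrow> Some (top_row (f \<oplus> p) (Suc (f k))))"

text \<open>Two shapes that differ by two cells have a single shape between them exactly if these
  cells form a domino; \<open>f k = f (Suc k)\<close> says that the domino is vertical. This is a
  relation because a collision allows both dominoes; only a corner next to the smallest one is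
  determined by the other three, see \<open>jdt_functional\<close>.\<close>

fun jdt_label :: "shape \<Rightarrow> nat option \<Rightarrow> nat option \<Rightarrow> nat option \<Rightarrow> bool" where
  "jdt_label f p q v \<longleftrightarrow> (if p \<noteq> q then v = q else
     case p of None \<Rightarrow> v = None
     | Some k \<Rightarrow> v = Some k \<or> v = Some (Suc k) \<and> f k = f (Suc k))"

definition fomin :: "shape \<Rightarrow> shape \<Rightarrow> shape \<Rightarrow> shape \<Rightarrow> bool \<Rightarrow> bool" where
  "fomin l k n m x \<longleftrightarrow> (\<exists>p q. k = l \<oplus> p \<and> n = l \<oplus> q \<and> m = k \<oplus> fomin_label p q x \<and>
     (x \<longrightarrow> p = None \<and> q = None))"

definition dual_fomin :: "shape \<Rightarrow> shape \<Rightarrow> shape \<Rightarrow> shape \<Rightarrow> bool \<Rightarrow> bool" where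
  "dual_fomin l k n m x \<longleftrightarrow> (\<exists>p q. k = l \<oplus> p \<and> n = l \<oplus> q \<and> m = k \<oplus> dual_label l p q x \<and>
     (x \<longrightarrow> p = None \<and> q = None))"

definition jdt :: "shape \<Rightarrow> shape \<Rightarrow> shape \<Rightarrow> shape \<Rightarrow> bool" where
  "jdt l k n m \<longleftrightarrow> (\<exists>p q v. k = l \<oplus> p \<and> n = l \<oplus> q \<and> m = k \<oplus> v \<and> jdt_label l p q v)"

section \<open>Addable cells, and the symmetry of the local rules\<close>

lemma add_cell_apply: "(f \<oplus> p) i = f i + (if p = Some i then 1 else 0)"
  by (cases p) auto

lemma add_cell_eq_iff [simp]: "f \<oplus> p = f \<oplus> q \<longleftrightarrow> p = q"
proof
  assume h: "f \<oplus> p = f \<oplus> q"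
  show "p = q"
  proof (cases p)
    case None
    then show ?thesis using h by (cases q) (auto simp: fun_eq_iff split: if_splits)
  next
    case (Some a)
    have "(f \<oplus> p) a = (f \<oplus> q) a" using h by simp
    then show ?thesis using Some by (simp add: add_cell_apply split: if_splits)
  qed
qed auto

lemma add_cell_self_iff [simp]: "f \<oplus> p = f \<longleftrightarrow> p = None" "f = f \<oplus> p \<longleftrightarrow> p = None"
  using add_cell_eq_iff[of f p None] add_cell_eq_iff[of f None p] by auto

lemma add_cell_commute: "f \<oplus> p \<oplus> q = f \<oplus> q \<oplus> p"
  by (rule ext) (simp add: add_cell_apply)

lemma add_cell_commute_cancel: "f \<oplus> p \<oplus> q = f \<oplus> q \<oplus> r \<longleftrightarrow> r = p"
  by (subst add_cell_commute) auto

lemma le_add_cell: "f i \<le> (f \<oplus> p) i"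
  by (simp add: add_cell_apply)

lemma is_shape_antimono: "is_shape f \<Longrightarrow> i \<le> j \<Longrightarrow> f j \<le> f i"
  by (auto simp: is_shape_def antimono_def)

lemma is_shape_eventually_zero: "is_shape f \<Longrightarrow> \<exists>n. \<forall>i\<ge>n. f i = 0"
  unfolding is_shape_def antimono_def by (metis le_zero_eq)

lemma is_shapeI: "(\<And>i. f (Suc i) \<le> f i) \<Longrightarrow> f n = 0 \<Longrightarrow> is_shape f"
  unfolding is_shape_def antimono_def by (metis lift_Suc_antimono_le)

lemma is_shape_zero [simp]: "is_shape (\<lambda>_. 0)"
  by (auto simp: is_shape_def antimono_def)

lemma is_shape_add_cell_iff:
  assumes "is_shape f"
  shows "is_shape (f \<oplus> Some k) \<longleftrightarrow> k = 0 \<or> f k < f (k - 1)"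
proof
  assume "is_shape (f \<oplus> Some k)"
  from is_shape_antimono[OF this, of "k - 1" k] show "k = 0 \<or> f k < f (k - 1)"
    by (cases k) auto
next
  assume h: "k = 0 \<or> f k < f (k - 1)"
  obtain n where n: "\<forall>i\<ge>n. f i = 0" using is_shape_eventually_zero[OF assms] by auto
  show "is_shape (f \<oplus> Some k)"
  proof (rule is_shapeI[where n = "n + Suc k"])
    show "(f \<oplus> Some k) (Suc i) \<le> (f \<oplus> Some k) i" for i
      using is_shape_antimono[OF assms, of i "Suc i"] h by (auto simp: add_cell_apply)
    show "(f \<oplus> Some k) (n + Suc k) = 0" using n by (simp add: add_cell_apply)
  qed
qed

lemma top_row_eqI:
  assumes "is_shape f" "f t \<le> v" "t = 0 \<or> v < f (t - 1)"
  shows "top_row f v = t"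
  unfolding top_row_def
proof (rule Least_equality)
  show "f t \<le> v" by fact
  fix y assume y: "f y \<le> v"
  show "t \<le> y"
  proof (rule ccontr)
    assume "\<not> t \<le> y"
    then have "f (t - 1) \<le> f y" "t \<noteq> 0" by (auto intro: is_shape_antimono[OF assms(1)])
    then show False using assms(3) y by auto
  qed
qed

lemma top_row_props:
  assumes "is_shape f"
  shows "f (top_row f v) \<le> v" "top_row f v = 0 \<or> v < f (top_row f v - 1)"
proof -
  obtain n where "f n = 0" using assms by (auto simp: is_shape_def)
  then have ex: "\<exists>t. f t \<le> v" by (intro exI[of _ n]) simp
  show "f (top_row f v) \<le> v" unfolding top_row_def by (rule LeastI_ex[OF ex])
  show "top_row f v = 0 \<or> v < f (top_row f v - 1)"
    unfolding top_row_def using not_less_Least[of "(LEAST t. f t \<le> v) - 1" "\<lambda>t. f t \<le> v"] by force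
qed

lemma add_cell_rows_distinct:
  assumes "is_shape f" "is_shape (f \<oplus> Some i)" "is_shape (f \<oplus> Some j)" "i \<noteq> j"
  shows "f i \<noteq> f j"
proof -
  have *: "f j < f i" if "i < j" "is_shape (f \<oplus> Some j)" for i j
  proof -
    have "f j < f (j - 1)" using that is_shape_add_cell_iff[OF assms(1)] by auto
    also have "f (j - 1) \<le> f i" using that by (intro is_shape_antimono[OF assms(1)]) auto
    finally show ?thesis .
  qed
  show ?thesis using *[of i j] *[of j i] assms by (cases "i < j") auto
qed

lemma fomin_functional: "fomin l k n m x \<Longrightarrow> fomin l k n m' x \<Longrightarrow> m = m'"
  unfolding fomin_def by (metis add_cell_eq_iff)

lemma fomin_swap: "fomin l k n m x \<Longrightarrow> fomin l n k m x"
  unfolding fomin_def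
  apply (elim exE conjE)
  subgoal for p q
    apply (rule exI[of _ q], rule exI[of _ p])
    apply (cases "p = q")
     apply auto[1]
    apply (simp add: add_cell_commute)
    done
  done

lemma dual_fomin_swap: "dual_fomin l k n m x \<Longrightarrow> dual_fomin l n k m x"
  unfolding dual_fomin_def
  apply (elim exE conjE)
  subgoal for p q
    apply (rule exI[of _ q], rule exI[of _ p])
    apply (cases "p = q")
     apply auto[1]
    apply (simp add: add_cell_commute)
    done
  done

lemma jdt_swap: "jdt l k n m \<Longrightarrow> jdt l n k m"
  unfolding jdt_def
  apply (elim exE conjE)
  subgoal for p q v
    apply (rule exI[of _ q], rule exI[of _ p])
    apply (cases "p = q")
     apply (rule exI[of _ v], simp)
    apply (rule exI[of _ p], simp add: add_cell_commute)
    done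
  done

text \<open>The corners are named after the sides (right, up, left) at which a line has been attached.\<close>

lemma cube:
  assumes shapes: "is_shape l" "is_shape R" "is_shape U" "is_shape L" "is_shape RU" "is_shape RL"
      "is_shape LU" "is_shape LRU"
    and base: "fomin l R U RU x" "jdt l R L RL" "dual_fomin l U L LU y"
    and over: "fomin L RL LU LRU x"
    and xy: "\<not> (x \<and> y)"
  shows "dual_fomin R RU RL LRU y \<and> jdt U RU LU LRU"
proof -
  obtain p q where R: "R = l \<oplus> p" and U: "U = l \<oplus> q" and RU: "RU = l \<oplus> p \<oplus> fomin_label p q x"
    and x: "x \<longrightarrow> p = None \<and> q = None" using base(1) unfolding fomin_def by blast
  obtain s v where L: "L = l \<oplus> s" and RL: "RL = l \<oplus> p \<oplus> v" and v: "jdt_label l p s v"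
    using base(2) R unfolding jdt_def by (metis add_cell_eq_iff)
  have LU: "LU = l \<oplus> q \<oplus> dual_label l q s y" and y: "y \<longrightarrow> q = None \<and> s = None"
    using base(3) U L unfolding dual_fomin_def by (metis add_cell_eq_iff)+
  obtain r u where r: "RL = l \<oplus> s \<oplus> r" and u: "LU = l \<oplus> s \<oplus> u"
    and LRU: "LRU = l \<oplus> s \<oplus> r \<oplus> fomin_label r u x"
    and x': "x \<longrightarrow> r = None \<and> u = None" using over L unfolding fomin_def by blast
  let ?d = "dual_label l q s y"
  \<comment> \<open>If the steps up and left agree, the dual rule adds its cell at the end of the
    topmost row of length \<open>?b\<close>, that is, in column \<open>?b\<close>: the first column
    at a cross, otherwise the column after the cell added by \<open>q\<close>.\<close>
  have topq: "(l \<oplus> q) t = (case q of None \<Rightarrow> 0 | Some k \<Rightarrow> Suc (l k))"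
      "t = 0 \<or> (case q of None \<Rightarrow> 0 | Some k \<Rightarrow> Suc (l k)) < (l \<oplus> q) (t - 1)"
      "\<And>k. q = Some k \<Longrightarrow> t \<le> k" if t: "?d = Some t" and "q = s" for t
  proof -
    let ?b = "case q of None \<Rightarrow> 0 | Some k \<Rightarrow> Suc (l k)"
    have t': "t = top_row (l \<oplus> q) ?b" using that by (cases q) (auto split: if_splits)
    have shU: "is_shape (l \<oplus> q)" using shapes(3) U by simp
    show k: "t \<le> k" if "q = Some k" for k
      unfolding t' top_row_def using that by (intro Least_le) simp
    show "t = 0 \<or> ?b < (l \<oplus> q) (t - 1)" unfolding t' by (rule top_row_props[OF shU])
    have "(l \<oplus> q) t \<le> ?b" unfolding t' by (rule top_row_props[OF shU])
    moreover have "?b \<le> (l \<oplus> q) t"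
    proof (cases q)
      case (Some k)
      then show ?thesis using is_shape_antimono[OF shU k[OF Some]] by simp
    qed simp
    ultimately show "(l \<oplus> q) t = ?b" by simp
  qed
  \<comment> \<open>Both faces contain the edge from \<open>RU\<close> to \<open>LRU\<close>; each
    case below has to name its label \<open>w\<close>.\<close>
  have goalI: ?thesis if "LRU = l \<oplus> p \<oplus> fomin_label p q x \<oplus> dual_label R (fomin_label p q x) v y"
      "y \<longrightarrow> fomin_label p q x = None \<and> v = None"
      "LRU = l \<oplus> q \<oplus> fomin_label q p x \<oplus> w" "jdt_label U (fomin_label q p x) ?d w" for w
  proof -
    have RU': "RU = l \<oplus> q \<oplus> fomin_label q p x"
      unfolding RU by (cases "p = q") (auto simp: add_cell_commute)
    have "dual_fomin R RU RL LRU y"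
      unfolding dual_fomin_def
      apply (rule exI[of _ "fomin_label p q x"], rule exI[of _ v])
      unfolding R RU RL using that(1,2) R by blast
    moreover have "jdt U RU LU LRU"
      unfolding jdt_def
      apply (rule exI[of _ "fomin_label q p x"], rule exI[of _ ?d], rule exI[of _ w])
      unfolding RU' U LU using that(3,4) U by blast
    ultimately show ?thesis by blast
  qed
  \<comment> \<open>The rules only ask which labels coincide, so the patterns of equality among
    \<open>p\<close>, \<open>q\<close>, \<open>s\<close> are the cases.\<close>
  consider (distinct) "p \<noteq> q" "q \<noteq> s" "p \<noteq> s"
    | (pq) "p = q" "q \<noteq> s" | (qs) "q = s" "p \<noteq> q" | (ps) "p = s" "p \<noteq> q" | (eq) "p = q" "q = s"
    by blast
  then show ?thesis
  proof cases
    case distinct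
    then have "v = s" "?d = s" using v by auto
    have "r = p" using r RL \<open>v = s\<close> by (simp add: add_cell_commute_cancel)
    moreover have "u = q" using u LU \<open>?d = s\<close> by (simp add: add_cell_commute_cancel)
    ultimately have 1: "LRU = l \<oplus> s \<oplus> p \<oplus> q" using LRU distinct by simp
    show ?thesis
      apply (rule goalI[of s])
      using distinct \<open>v = s\<close> y by (auto simp: 1 fun_eq_iff add_cell_apply simp del: add_cell.simps)
  next
    case pq
    then have "v = s" "?d = s" "p \<noteq> s" using v by auto
    have r': "r = p" using r RL \<open>v = s\<close> by (simp add: add_cell_commute_cancel)
    have u': "u = q" using u LU \<open>?d = s\<close> by (simp add: add_cell_commute_cancel)
    have \<open>\<not> y\<close> using pq y by auto
    define z where "z = fomin_label p q x"
    have 1: "LRU = l \<oplus> s \<oplus> p \<oplus> z" using LRU r' u' pq by (simp add: z_def)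
    have fqp: "fomin_label q p x = z" unfolding z_def using pq by simp
    show ?thesis
    proof (cases "z = s")
      case False
      show ?thesis
        apply (rule goalI[of s])
        unfolding fqp z_def[symmetric] \<open>?d = s\<close> \<open>v = s\<close>
        using False \<open>\<not> y\<close> pq by (auto simp: 1 fun_eq_iff add_cell_apply simp del: add_cell.simps)
    next
      \<comment> \<open>Now both steps from \<open>R\<close> add to row \<open>c\<close>, and the
        dual rule has to stay in this row. There is room for two cells, since \<open>p\<close> has
        lengthened the row above \<open>c\<close>, if there is one.\<close>
      case True
      then obtain c where c: "z = Some c" "s = Some c" "\<And>k. p = Some k \<Longrightarrow> c = Suc k" "p = None \<Longrightarrow> c = 0"
        using pq unfolding z_def by (cases p) (auto split: if_splits)
      have "top_row (R \<oplus> Some c) (Suc (R c)) = c"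
      proof (rule top_row_eqI)
        show "is_shape (R \<oplus> Some c)" using shapes(5) RU R c z_def by simp
        show "c = 0 \<or> Suc (R c) < (R \<oplus> Some c) (c - 1)"
        proof (cases p)
          case None
          then show ?thesis using c by simp
        next
          case (Some k)
          have "l (Suc k) < l k"
            using shapes(1,4) L c Some is_shape_add_cell_iff[of l "Suc k"] by auto
          then show ?thesis using c Some R by (auto simp: add_cell_apply)
        qed
      qed (simp add: add_cell_apply)
      then have dl: "dual_label R z s y = Some c" using True c by simp
      show ?thesis
        apply (rule goalI[of s])
        unfolding fqp z_def[symmetric] \<open>?d = s\<close> \<open>v = s\<close> dl
        using True c(1,2) \<open>\<not> y\<close> pq by (auto simp: 1 fun_eq_iff add_cell_apply simp del: add_cell.simps)
    qed
  next
    case qs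
    have "v = s" using v qs by simp
    have r': "r = p" using r RL \<open>v = s\<close> by (simp add: add_cell_commute_cancel)
    have u': "u = ?d" using u LU qs by simp
    have fl: "fomin_label p q x = q" "fomin_label q p x = p" using qs by auto
    show ?thesis
    proof (cases "q = None \<and> \<not> y")
      case True
      then have "?d = None" using qs by simp
      then have 1: "LRU = l \<oplus> s \<oplus> p" using LRU r' u' qs True x' by (cases p) auto
      show ?thesis
        apply (rule goalI[of None])
        unfolding fl \<open>?d = None\<close> \<open>v = s\<close> using True qs by (auto simp: 1)
    next
      case False
      obtain t where t: "?d = Some t" using False qs by (cases q) auto
      have xx: "\<not> x" using x qs False xy by auto
      have LU': "is_shape (l \<oplus> q \<oplus> Some t)" using shapes(7) LU t by simp
      have sh: "is_shape (l \<oplus> q)" "is_shape (l \<oplus> p)" "is_shape (l \<oplus> p \<oplus> q)"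
        using shapes U R RU fl by auto
      note tv = topq[OF t qs(1)]
      show ?thesis
      proof (cases "p = Some t")
        case False
        have 1: "LRU = l \<oplus> s \<oplus> p \<oplus> Some t" using LRU r' u' t False by simp
        have dl: "dual_label R q s y = Some t"
        proof (cases q)
          case None
          have "top_row R 0 = t"
          proof (rule top_row_eqI)
            show "is_shape R" by (rule shapes(2))
            show "R t \<le> 0" "t = 0 \<or> 0 < R (t - 1)"
              using tv(1,2) None False R by (auto simp: add_cell_apply)
          qed
          then show ?thesis using None qs \<open>\<not> (q = None \<and> \<not> y)\<close> by simp
        next
          case (Some k)
          have "top_row (R \<oplus> q) (Suc (R k)) = t"
          proof (rule top_row_eqI)
            show "is_shape (R \<oplus> q)" using sh(3) R by simp
            show "(R \<oplus> q) t \<le> Suc (R k)" "t = 0 \<or> Suc (R k) < (R \<oplus> q) (t - 1)"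
              using tv(1,2) Some False R qs by (auto simp: add_cell_apply split: if_splits)
          qed
          then show ?thesis using Some qs by simp
        qed
        show ?thesis
          apply (rule goalI[of "Some t"])
          unfolding fl t \<open>v = s\<close> dl using False qs y by (auto simp: 1 fun_eq_iff add_cell_apply simp del: add_cell.simps)
      next
        \<comment> \<open>The cell that the dual rule adds to \<open>U\<close> is the one that
          \<open>p\<close> adds. Fomin's rule over \<open>L\<close> bumps it into the next row, so a
          vertical domino arises in the face over \<open>U\<close>.\<close>
        case True
        have 1: "LRU = l \<oplus> s \<oplus> p \<oplus> Some (Suc t)" using LRU r' u' t True by simp
        have vert: "U t = U (Suc t)"
        proof (cases q)
          case None
          then show ?thesis using tv(1) U is_shape_antimono[OF shapes(3), of t "Suc t"] by simp
        next
          case (Some k)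
          then have "Suc t \<le> k" using tv(3)[OF Some] True qs by (metis Suc_leI le_neq_implies_less)
          then show ?thesis
            using tv(1) Some U is_shape_antimono[OF shapes(3), of t "Suc t"]
              is_shape_antimono[OF shapes(3), of "Suc t" k] by simp
        qed
        have dl: "dual_label R q s y = Some (Suc t)"
        proof (cases q)
          case None
          have "top_row R 0 = Suc t"
          proof (rule top_row_eqI)
            show "is_shape R" by (rule shapes(2))
            show "R (Suc t) \<le> 0" "Suc t = 0 \<or> 0 < R (Suc t - 1)"
              using tv(1,2) None True R U vert by (auto simp: add_cell_apply)
          qed
          then show ?thesis using None qs \<open>\<not> (q = None \<and> \<not> y)\<close> by simp
        next
          case (Some k)
          have "top_row (R \<oplus> q) (Suc (R k)) = Suc t"
          proof (rule top_row_eqI)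
            show "is_shape (R \<oplus> q)" using sh(3) R by simp
            show "(R \<oplus> q) (Suc t) \<le> Suc (R k)" "Suc t = 0 \<or> Suc (R k) < (R \<oplus> q) (Suc t - 1)"
              using tv(1,2) Some True R U vert qs by (auto simp: add_cell_apply split: if_splits)
          qed
          then show ?thesis using Some qs by simp
        qed
        show ?thesis
          apply (rule goalI[of "Some (Suc t)"])
          unfolding fl t \<open>v = s\<close> dl using True qs y vert by (auto simp: 1 fun_eq_iff add_cell_apply simp del: add_cell.simps)
      qed
    qed
  next
    case ps
    have u': "u = q" using u LU ps by (simp add: add_cell_commute_cancel)
    have r': "r = v" using r RL ps by simp
    have "\<not> x" using x ps y by auto
    have "?d = s" using ps by simp
    have "\<not> y" using y ps by auto
    have fl: "fomin_label p q x = q" "fomin_label q p x = p" using ps by auto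
    have vq: "v \<noteq> q"
      using v ps shapes(1,3) U is_shape_add_cell_iff by (cases p) auto
    have 1: "LRU = l \<oplus> s \<oplus> v \<oplus> q" using LRU r' u' vq by simp
    show ?thesis
      apply (rule goalI[of v])
      unfolding fl \<open>?d = s\<close> using ps vq v \<open>\<not> y\<close> U
      by (auto simp: 1 fun_eq_iff add_cell_apply simp del: add_cell.simps split: option.splits)
  next
    case eq
    have r': "r = v" using r RL eq by simp
    have u': "u = ?d" using u LU eq by simp
    show ?thesis
    proof (cases q)
      case None
      then have "v = None" using v eq by simp
      then show ?thesis
        using None eq LRU xy R x' unfolding r' u' by (intro goalI[of ?d]) auto
    next
      case (Some k)
      then obtain t where t: "?d = Some t" using eq by auto
      note tv = topq[OF t eq(2)]
      have "\<not> x" "\<not> y" using x y Some by auto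
      have fl: "fomin_label p q x = Some (Suc k)" "fomin_label q p x = Some (Suc k)"
        using eq Some by auto
      have tk: "t \<noteq> Suc k" using tv(3)[OF Some] by auto
      consider (row) "v = Some k" | (col) "v = Some (Suc k)" "l k = l (Suc k)"
        using v eq Some by auto
      then show ?thesis
      proof cases
        case row
        \<comment> \<open>\<open>RL\<close> has two new cells in row \<open>k\<close>, so the row
          above is longer than \<open>Suc (l k)\<close> and cannot be the row found by the dual
          rule.\<close>
        have "t = k"
        proof (rule ccontr)
          assume "t \<noteq> k"
          then have "t \<le> k - 1" "k \<noteq> 0" using tv(3)[OF Some] by auto
          then have "(l \<oplus> q) (k - 1) \<le> Suc (l k)"
            using is_shape_antimono[OF shapes(3), of t "k - 1"] tv(1) U Some by simp
          moreover have "is_shape (L \<oplus> Some k)" using shapes(6) RL row L eq by simp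
          ultimately show False
            using is_shape_add_cell_iff[OF shapes(4), of k] \<open>k \<noteq> 0\<close> L eq Some by auto
        qed
        have 1: "LRU = l \<oplus> Some k \<oplus> Some k \<oplus> Some (Suc k)"
          using LRU unfolding r' u' t row \<open>t = k\<close> eq(1) using eq Some by auto
        show ?thesis
          apply (rule goalI[of "Some t"])
          unfolding fl t \<open>t = k\<close> row using eq Some \<open>\<not> y\<close>
          by (auto simp: 1 fun_eq_iff add_cell_apply simp del: add_cell.simps)
      next
        case col
        have 1: "LRU = l \<oplus> Some k \<oplus> Some (Suc k) \<oplus> Some t"
          using LRU tk eq Some t col unfolding r' u' by simp
        have "top_row (R \<oplus> Some (Suc k)) (Suc (R (Suc k))) = t"
        proof (rule top_row_eqI)
          show "is_shape (R \<oplus> Some (Suc k))" using shapes(6) RL col R by simp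
          show "(R \<oplus> Some (Suc k)) t \<le> Suc (R (Suc k))"
              "t = 0 \<or> Suc (R (Suc k)) < (R \<oplus> Some (Suc k)) (t - 1)"
            using tv(1,2) Some R U eq col by (auto simp: add_cell_apply split: if_splits)
        qed
        then have dl: "dual_label R (Some (Suc k)) v y = Some t" using col by simp
        show ?thesis
          apply (rule goalI[of "Some t"])
          unfolding fl t dl using eq Some \<open>\<not> y\<close> tk
          by (auto simp: 1 fun_eq_iff add_cell_apply simp del: add_cell.simps)
      qed
    qed
  qed
qed

section \<open>Shapes of partial permutation matrices\<close>

definition partial_bij :: "('a \<Rightarrow> 'b \<Rightarrow> bool) \<Rightarrow> bool" where
  "partial_bij X \<longleftrightarrow> (\<forall>c r r'. X c r \<longrightarrow> X c r' \<longrightarrow> r = r') \<and> (\<forall>c c' r. X c r \<longrightarrow> X c' r \<longrightarrow> c = c')"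

text \<open>The columns are listed from right to left and the rows from top to bottom, so that the heads are the
  lines attached last.\<close>

fun rsk :: "('a \<Rightarrow> 'b \<Rightarrow> bool) \<Rightarrow> 'a list \<Rightarrow> 'b list \<Rightarrow> shape" where
  "rsk X [] rs = (\<lambda>_. 0)"
| "rsk X (c # cs) [] = (\<lambda>_. 0)"
| "rsk X (c # cs) (r # rs) = (THE m. fomin (rsk X cs rs) (rsk X (c # cs) rs)
     (rsk X cs (r # rs)) m (X c r))"

lemma partial_bij_transpose: "partial_bij X \<Longrightarrow> partial_bij (\<lambda>r c. X c r)"
  unfolding partial_bij_def by blast

lemma rsk_no_rows [simp]: "rsk X cs [] = (\<lambda>_. 0)"
  by (cases cs) auto

lemma fomin_swap_iff: "fomin l k n m x \<longleftrightarrow> fomin l n k m x"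
  using fomin_swap by blast

lemma rsk_transpose: "rsk (\<lambda>r c. X c r) rs cs = rsk X cs rs"
proof (induction X cs rs rule: rsk.induct)
  case (3 X c cs r rs)
  then show ?case by simp (subst fomin_swap_iff, rule refl)
qed auto

declare rsk.simps(3) [simp del]

text \<open>The definite description in \<open>rsk\<close> is meaningful only if both labels are
  \<open>None\<close> at a cross. The induction therefore carries along that a line without crosses
  leaves the shape unchanged; as a cross is alone in its row and column, this gives the side
  condition.\<close>

lemma rsk_fomin_aux:
  assumes "partial_bij X" "distinct cs" "distinct rs"
  shows "(\<forall>c. c \<notin> set cs \<longrightarrow> (\<exists>p. rsk X (c # cs) rs = rsk X cs rs \<oplus> p \<and>
             ((\<forall>r \<in> set rs. \<not> X c r) \<longrightarrow> p = None))) \<and>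
         (\<forall>r. r \<notin> set rs \<longrightarrow> (\<exists>p. rsk X cs (r # rs) = rsk X cs rs \<oplus> p \<and>
             ((\<forall>c \<in> set cs. \<not> X c r) \<longrightarrow> p = None))) \<and>
         (\<forall>c r. c \<notin> set cs \<longrightarrow> r \<notin> set rs \<longrightarrow>
            fomin (rsk X cs rs) (rsk X (c # cs) rs) (rsk X cs (r # rs))
              (rsk X (c # cs) (r # rs)) (X c r))"
    (is "?C cs rs \<and> ?R cs rs \<and> ?F cs rs")
  using assms(2,3)
proof (induction "length cs + length rs" arbitrary: cs rs rule: less_induct)
  case less
  have C: "?C cs rs"
  proof (cases rs)
    case Nil
    then show ?thesis by (auto intro!: exI[of _ None])
  next
    case (Cons r rs')
    then have F: "?F cs rs'" using less by auto
    show ?thesis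
    proof (intro allI impI)
      fix c assume c: "c \<notin> set cs"
      have f: "fomin (rsk X cs rs') (rsk X (c # cs) rs') (rsk X cs (r # rs'))
              (rsk X (c # cs) (r # rs')) (X c r)"
        using F c less.prems Cons by simp
      have "?C cs rs'" using less Cons by auto
      then obtain p' where p': "rsk X (c # cs) rs' = rsk X cs rs' \<oplus> p'"
        "(\<forall>r \<in> set rs'. \<not> X c r) \<longrightarrow> p' = None" using c by blast
      from fomin_swap[OF f] obtain p where p: "rsk X (c # cs) (r # rs') = rsk X cs (r # rs') \<oplus> p"
        unfolding fomin_def by blast
      have "p = None" if "\<forall>r \<in> set rs. \<not> X c r"
      proof -
        have "p' = None" "\<not> X c r" using that p' Cons by auto
        then show ?thesis using fomin_swap[OF f] p p' unfolding fomin_def by (auto split: if_splits)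
      qed
      then show "\<exists>p. rsk X (c # cs) rs = rsk X cs rs \<oplus> p \<and>
             ((\<forall>r \<in> set rs. \<not> X c r) \<longrightarrow> p = None)" using p Cons by blast
    qed
  qed
  have R: "?R cs rs"
  proof (cases cs)
    case Nil
    then show ?thesis by (auto intro!: exI[of _ None])
  next
    case (Cons c cs')
    then have F: "?F cs' rs" using less by auto
    show ?thesis
    proof (intro allI impI)
      fix r assume r: "r \<notin> set rs"
      have f: "fomin (rsk X cs' rs) (rsk X (c # cs') rs) (rsk X cs' (r # rs))
              (rsk X (c # cs') (r # rs)) (X c r)"
        using F r less.prems Cons by simp
      have "?R cs' rs" using less Cons by auto
      then obtain p' where p': "rsk X cs' (r # rs) = rsk X cs' rs \<oplus> p'"
        "(\<forall>c \<in> set cs'. \<not> X c r) \<longrightarrow> p' = None" using r by blast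
      from f obtain p where p: "rsk X (c # cs') (r # rs) = rsk X (c # cs') rs \<oplus> p"
        unfolding fomin_def by blast
      have "p = None" if "\<forall>c \<in> set cs. \<not> X c r"
      proof -
        have "p' = None" "\<not> X c r" using that p' Cons by auto
        then show ?thesis using f p p' unfolding fomin_def by (auto split: if_splits)
      qed
      then show "\<exists>p. rsk X cs (r # rs) = rsk X cs rs \<oplus> p \<and>
             ((\<forall>c \<in> set cs. \<not> X c r) \<longrightarrow> p = None)" using p Cons by blast
    qed
  qed
  have "?F cs rs"
  proof (intro allI impI)
    fix c r assume c: "c \<notin> set cs" and r: "r \<notin> set rs"
    obtain p where p: "rsk X (c # cs) rs = rsk X cs rs \<oplus> p"
        "(\<forall>r \<in> set rs. \<not> X c r) \<longrightarrow> p = None" using C c by blast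
    obtain q where q: "rsk X cs (r # rs) = rsk X cs rs \<oplus> q"
        "(\<forall>c \<in> set cs. \<not> X c r) \<longrightarrow> q = None" using R r by blast
    have "X c r \<longrightarrow> p = None \<and> q = None"
      using p(2) q(2) c r assms(1) unfolding partial_bij_def by blast
    then have "\<exists>m. fomin (rsk X cs rs) (rsk X (c # cs) rs) (rsk X cs (r # rs)) m (X c r)"
      unfolding fomin_def p(1) q(1) by blast
    then obtain m where m: "fomin (rsk X cs rs) (rsk X (c # cs) rs) (rsk X cs (r # rs)) m (X c r)" ..
    show "fomin (rsk X cs rs) (rsk X (c # cs) rs) (rsk X cs (r # rs))
              (rsk X (c # cs) (r # rs)) (X c r)"
      unfolding rsk.simps(3) by (rule theI[where P = "\<lambda>m. fomin _ _ _ m _", OF m]) (rule fomin_functional[OF _ m])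
  qed
  then show ?case using C R by blast
qed

section \<open>Local rules at the sides of a submatrix\<close>

lemma rsk_right_up:
  assumes "partial_bij X" "distinct (c # cs)" "distinct (r # rs)"
  shows "fomin (rsk X cs rs) (rsk X (c # cs) rs) (rsk X cs (r # rs))
              (rsk X (c # cs) (r # rs)) (X c r)"
  using rsk_fomin_aux[OF assms(1), of cs rs] assms by simp

lemma is_shape_fomin:
  assumes "fomin l k n m x" "is_shape l" "is_shape k" "is_shape n"
  shows "is_shape m"
proof -
  obtain p q where k: "k = l \<oplus> p" and n: "n = l \<oplus> q" and m: "m = k \<oplus> fomin_label p q x"
    and x: "x \<longrightarrow> p = None \<and> q = None" using assms(1) unfolding fomin_def by blast
  show ?thesis
  proof (cases "p = q")
    case True
    show ?thesis
    proof (cases p)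
      case None
      then show ?thesis using True m assms is_shape_add_cell_iff[of k 0] by auto
    next
      case (Some i)
      have "l (Suc i) \<le> l i" using is_shape_antimono[OF assms(2)] by simp
      then show ?thesis
        using True m k Some is_shape_add_cell_iff[OF assms(3), of "Suc i"] by auto
    qed
  next
    case False
    then show ?thesis
    proof (cases q)
      case (Some i)
      have "i = 0 \<or> l i < l (i - 1)" using is_shape_add_cell_iff[OF assms(2)] assms(4) n Some by auto
      moreover have "k i = l i" "l (i - 1) \<le> k (i - 1)" using k False Some by (auto simp: add_cell_apply)
      ultimately show ?thesis using False m Some is_shape_add_cell_iff[OF assms(3), of i] by auto
    qed (use m assms in simp)
  qed
qed

lemma is_shape_rsk:
  assumes "partial_bij X"
  shows "distinct cs \<Longrightarrow> distinct rs \<Longrightarrow> is_shape (rsk X cs rs)"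
  using assms
proof (induction X cs rs rule: rsk.induct)
  case (3 X c cs r rs)
  show ?case
    by (rule is_shape_fomin[OF rsk_right_up]) (use 3 in auto)
qed auto

text \<open>Both rules at the left end are proved together because the cube needs both on its faces
  at the smallest corner. One application of \<open>cube\<close> carries \<open>?D\<close> across a
  column on the right and \<open>?J\<close> across a row on top.\<close>

lemma rsk_left_aux:
  assumes "partial_bij X" "distinct (cs @ [a])" "distinct rs"
  shows "(\<forall>c. c \<notin> set (cs @ [a]) \<longrightarrow>
            jdt (rsk X cs rs) (rsk X (c # cs) rs) (rsk X (cs @ [a]) rs)
              (rsk X (c # cs @ [a]) rs)) \<and>
         (\<forall>r. r \<notin> set rs \<longrightarrow>
            dual_fomin (rsk X cs rs) (rsk X cs (r # rs)) (rsk X (cs @ [a]) rs)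
              (rsk X (cs @ [a]) (r # rs)) (X a r))"
    (is "?J cs rs \<and> ?D cs rs")
  using assms(2,3)
proof (induction "length cs + length rs" arbitrary: cs rs rule: less_induct)
  case less
  note sh = is_shape_rsk[OF assms(1)]
  have step: "dual_fomin (rsk X (c # cs) rs) (rsk X (c # cs) (r # rs))
                (rsk X (c # cs @ [a]) rs) (rsk X (c # cs @ [a]) (r # rs)) (X a r) \<and>
              jdt (rsk X cs (r # rs)) (rsk X (c # cs) (r # rs))
                (rsk X (cs @ [a]) (r # rs)) (rsk X (c # cs @ [a]) (r # rs))"
    if "?J cs rs" "?D cs rs" "distinct (c # cs @ [a])" "distinct (r # rs)" for c cs r rs
  proof (rule cube)
    show "fomin (rsk X cs rs) (rsk X (c # cs) rs) (rsk X cs (r # rs))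
            (rsk X (c # cs) (r # rs)) (X c r)"
      "fomin (rsk X (cs @ [a]) rs) (rsk X (c # cs @ [a]) rs)
        (rsk X (cs @ [a]) (r # rs)) (rsk X (c # cs @ [a]) (r # rs)) (X c r)"
      by (rule rsk_right_up[OF assms(1)]; use that in auto)+
    show "jdt (rsk X cs rs) (rsk X (c # cs) rs) (rsk X (cs @ [a]) rs)
            (rsk X (c # cs @ [a]) rs)"
      "dual_fomin (rsk X cs rs) (rsk X cs (r # rs)) (rsk X (cs @ [a]) rs)
            (rsk X (cs @ [a]) (r # rs)) (X a r)"
      using that by auto
    show "\<not> (X c r \<and> X a r)" using assms(1) that(3) unfolding partial_bij_def by auto
  qed (use that in \<open>auto intro!: sh\<close>)
  have "?J cs rs"
  proof (cases rs)
    case Nil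
    then show ?thesis by (auto simp: jdt_def intro!: exI[of _ None])
  next
    case (Cons r rs')
    then have "?J cs rs'" "?D cs rs'" using less by auto
    then show ?thesis using step[of cs rs' _ r] less.prems Cons by auto
  qed
  moreover have "?D cs rs"
  proof (cases cs)
    case Nil
    show ?thesis
    proof (intro allI impI)
      fix r assume r: "r \<notin> set rs"
      \<comment> \<open>A single column is attached on the left and on the right at once, and row
        and column insertion agree as long as there is at most one cell.\<close>
      have "fomin (\<lambda>_. 0) (rsk X [a] rs) (\<lambda>_. 0) (rsk X [a] (r # rs)) (X a r)"
        using rsk_right_up[OF assms(1), of a "[]" r rs] less.prems r by simp
      then obtain p where p: "rsk X [a] rs = (\<lambda>_. 0) \<oplus> p"
        "rsk X [a] (r # rs) = rsk X [a] rs \<oplus> fomin_label p None (X a r)" "X a r \<longrightarrow> p = None"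
        unfolding fomin_def by (metis add_cell_self_iff(2))
      have "top_row (\<lambda>_. 0) 0 = 0" by (rule top_row_eqI) auto
      then have "rsk X [a] (r # rs) = (\<lambda>_. 0) \<oplus> None \<oplus> dual_label (\<lambda>_. 0) None p (X a r)"
        using p by (cases p) auto
      then show "dual_fomin (rsk X cs rs) (rsk X cs (r # rs)) (rsk X (cs @ [a]) rs)
            (rsk X (cs @ [a]) (r # rs)) (X a r)"
        unfolding dual_fomin_def using p(1,3) Nil by (intro exI[of _ None] exI[of _ p]) simp
    qed
  next
    case (Cons c cs')
    then have "?J cs' rs" "?D cs' rs" using less by auto
    then show ?thesis using step[of cs' rs c] less.prems Cons by auto
  qed
  ultimately show ?case by blast
qed

lemma rsk_left_right:
  assumes "partial_bij X" "distinct (c # cs @ [a])" "distinct rs"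
  shows "jdt (rsk X cs rs) (rsk X (c # cs) rs) (rsk X (cs @ [a]) rs)
              (rsk X (c # cs @ [a]) rs)"
  using rsk_left_aux[OF assms(1), of cs a rs] assms by auto

lemma rsk_left_up:
  assumes "partial_bij X" "distinct (cs @ [a])" "distinct (r # rs)"
  shows "dual_fomin (rsk X cs rs) (rsk X (cs @ [a]) rs) (rsk X cs (r # rs))
            (rsk X (cs @ [a]) (r # rs)) (X a r)"
  by (rule dual_fomin_swap) (use rsk_left_aux[OF assms(1), of cs a rs] assms in auto)

lemma rsk_up_down:
  assumes "partial_bij X" "distinct cs" "distinct (r # rs @ [d])"
  shows "jdt (rsk X cs rs) (rsk X cs (r # rs)) (rsk X cs (rs @ [d]))
              (rsk X cs (r # rs @ [d]))"
  using rsk_left_right[OF partial_bij_transpose[OF assms(1)] assms(3,2)]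
  by (simp only: rsk_transpose[of X])

lemma rsk_right_down:
  assumes "partial_bij X" "distinct (c # cs)" "distinct (rs @ [d])"
  shows "dual_fomin (rsk X cs rs) (rsk X (c # cs) rs) (rsk X cs (rs @ [d]))
            (rsk X (c # cs) (rs @ [d])) (X c d)"
  using dual_fomin_swap[OF rsk_left_up[OF partial_bij_transpose[OF assms(1)] assms(3,2)]]
  by (simp only: rsk_transpose[of X])

section \<open>Conjugate shapes and reversed lines\<close>

lemma conj_add_cell:
  assumes "is_shape f" "is_shape (f \<oplus> Some k)"
  shows "top_row (f \<oplus> Some k) = top_row f \<oplus> Some (f k)"
proof
  fix j
  have k: "k = 0 \<or> f k < f (k - 1)" using assms is_shape_add_cell_iff by auto
  show "top_row (f \<oplus> Some k) j = (top_row f \<oplus> Some (f k)) j"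
  proof (cases "j = f k")
    case True
    have "top_row f j = k" by (rule top_row_eqI[OF assms(1)]) (use k True in auto)
    moreover have "top_row (f \<oplus> Some k) j = Suc k"
      by (rule top_row_eqI[OF assms(2)]) (use True is_shape_antimono[OF assms(1), of k "Suc k"] in auto)
    ultimately show ?thesis using True by simp
  next
    case False
    have "top_row (f \<oplus> Some k) j = top_row f j"
    proof (rule top_row_eqI[OF assms(2)])
      show "(f \<oplus> Some k) (top_row f j) \<le> j"
        using top_row_props(1)[OF assms(1), of j] False by (auto simp: add_cell_apply)
      show "top_row f j = 0 \<or> j < (f \<oplus> Some k) (top_row f j - 1)"
        using top_row_props(2)[OF assms(1), of j] le_add_cell order_less_le_trans by blast
    qed
    then show ?thesis using False by simp
  qed
qed

lemma le_top_row_iff: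
  assumes "is_shape f"
  shows "top_row f v \<le> t \<longleftrightarrow> f t \<le> v"
proof
  assume "top_row f v \<le> t"
  then have "f t \<le> f (top_row f v)" by (rule is_shape_antimono[OF assms])
  also have "\<dots> \<le> v" by (rule top_row_props[OF assms])
  finally show "f t \<le> v" .
qed (auto simp: top_row_def intro: Least_le)

lemma is_shape_conj:
  assumes "is_shape f"
  shows "is_shape (top_row f)"
proof (rule is_shapeI)
  show "top_row f (Suc i) \<le> top_row f i" for i
    unfolding le_top_row_iff[OF assms] using top_row_props(1)[OF assms, of i] by simp
  show "top_row f (f 0) = 0" by (rule top_row_eqI[OF assms]) auto
qed

lemma conj_conj [simp]:
  assumes "is_shape f"
  shows "top_row (top_row f) = f"
proof
  fix v
  show "top_row (top_row f) v = f v"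
  proof (rule top_row_eqI[OF is_shape_conj[OF assms]])
    show "top_row f (f v) \<le> v" by (simp add: le_top_row_iff[OF assms])
    show "f v = 0 \<or> v < top_row f (f v - 1)"
      using le_top_row_iff[OF assms, of "f v - 1" v] by auto
  qed
qed

text \<open>A cell added to row \<open>k\<close> of \<open>f\<close> lies in column
  \<open>f k\<close>. Conjugation thus replaces rows by columns in the labels, and the column
  prescribed by \<open>dual_label\<close> is 0 or a successor, as in Fomin's rule.\<close>

lemma fomin_conj:
  assumes "dual_fomin l k n m x" "is_shape l" "is_shape k" "is_shape n" "is_shape m"
  shows "fomin (top_row l) (top_row k) (top_row n) (top_row m) x"
proof -
  obtain p q where k: "k = l \<oplus> p" and n: "n = l \<oplus> q" and m: "m = k \<oplus> dual_label l p q x"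
    and x: "x \<longrightarrow> p = None \<and> q = None" using assms(1) unfolding dual_fomin_def by blast
  define g where "g = map_option l"
  have gk: "top_row k = top_row l \<oplus> g p" using conj_add_cell assms(2,3) k by (cases p) (auto simp: g_def simp del: add_cell.simps(2))
  have gn: "top_row n = top_row l \<oplus> g q" using conj_add_cell assms(2,4) n by (cases q) (auto simp: g_def simp del: add_cell.simps(2))
  have "top_row m = top_row k \<oplus> fomin_label (g p) (g q) x"
  proof (cases "p = q")
    case False
    then have "g p \<noteq> g q"
      using add_cell_rows_distinct[OF assms(2)] assms(3,4) k n unfolding g_def
      by (cases p; cases q) (auto simp del: add_cell.simps(2))
    moreover have "top_row m = top_row k \<oplus> map_option k q"
      using False m assms(3,5) conj_add_cell by (cases q) (auto simp del: add_cell.simps(2))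
    moreover have "map_option k q = map_option l q"
      using False k by (cases q) (auto simp: add_cell_apply)
    ultimately show ?thesis by (simp add: g_def)
  next
    case True
    show ?thesis
    proof (cases p)
      case None
      show ?thesis
      proof (cases x)
        case True
        have "k (top_row l 0) = 0" using top_row_props(1)[OF assms(2), of 0] k None by simp
        moreover have "m = k \<oplus> Some (top_row l 0)" using m None \<open>p = q\<close> True by simp
        ultimately have "top_row m = top_row k \<oplus> Some 0"
          using assms(3,5) conj_add_cell[of k "top_row l 0"] by (simp del: add_cell.simps(2))
        then show ?thesis using None \<open>p = q\<close> True g_def by simp
      next
        case False
        then show ?thesis using None \<open>p = q\<close> m g_def by simp
      qed
    next
      case (Some i)
      let ?t = "top_row k (Suc (l i))"
      have "k ?t \<le> Suc (l i)" by (rule top_row_props[OF assms(3)])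
      moreover have "?t \<le> i" using le_top_row_iff[OF assms(3)] k Some by simp
      then have "k i \<le> k ?t" by (rule is_shape_antimono[OF assms(3)])
      ultimately have "k ?t = Suc (l i)" using k Some by simp
      moreover have "m = k \<oplus> Some ?t" using m Some True k by simp
      ultimately have "top_row m = top_row k \<oplus> Some (Suc (l i))"
        using assms(3,5) conj_add_cell[of k ?t] by (simp del: add_cell.simps(2))
      moreover have "g p = Some (l i)" "g q = Some (l i)" using True Some g_def by auto
      ultimately show ?thesis by simp
    qed
  qed
  then show ?thesis unfolding fomin_def using gk gn x g_def by auto
qed

lemma conj_zero [simp]: "top_row (\<lambda>_. 0) = (\<lambda>_. 0)"
  by (rule ext, rule top_row_eqI) auto

text \<open>Schensted's theorem on reversed words. In the reversed list each new column is attached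
  on the left, where the dual rule holds; hence the conjugate shapes satisfy the recursion that
  defines \<open>rsk X cs rs\<close>.\<close>

lemma rsk_rev_columns:
  assumes "partial_bij X" "distinct cs" "distinct rs"
  shows "rsk X (rev cs) rs = top_row (rsk X cs rs)"
proof -
  have "top_row (rsk X (rev cs) rs) = rsk X cs rs"
    using assms
  proof (induction X cs rs rule: rsk.induct)
    case (3 X c cs r rs)
    note sh = is_shape_rsk[OF 3(4)]
    have "dual_fomin (rsk X (rev cs) rs) (rsk X (rev cs @ [c]) rs) (rsk X (rev cs) (r # rs))
            (rsk X (rev cs @ [c]) (r # rs)) (X c r)"
      by (rule rsk_left_up) (use 3 in auto)
    from fomin_conj[OF this] have "fomin (rsk X cs rs) (rsk X (c # cs) rs) (rsk X cs (r # rs))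
            (top_row (rsk X (rev cs @ [c]) (r # rs))) (X c r)"
      using 3 sh by simp
    then show ?case using rsk_right_up[of X c cs r rs] 3 fomin_functional by fastforce
  qed auto
  then show ?thesis using conj_conj is_shape_rsk[OF assms(1), of "rev cs" rs] assms by (metis distinct_rev)
qed

text \<open>Reversing the columns and reversing the rows conjugate the shape once each, and the two
  conjugations cancel.\<close>

lemma rsk_rotate:
  assumes "partial_bij X" "distinct cs" "distinct rs"
  shows "rsk X (rev cs) (rev rs) = rsk X cs rs"
proof -
  have "rsk X cs (rev rs) = top_row (rsk X cs rs)"
    using rsk_rev_columns[OF partial_bij_transpose[OF assms(1)] assms(3,2)]
    by (simp only: rsk_transpose[of X])
  then show ?thesis
    using rsk_rev_columns[OF assms(1,2), of "rev rs"] assms is_shape_rsk by fastforce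
qed

lemma rsk_left_down:
  assumes "partial_bij X" "distinct (cs @ [a])" "distinct (rs @ [d])"
  shows "fomin (rsk X cs rs) (rsk X (cs @ [a]) rs) (rsk X cs (rs @ [d]))
            (rsk X (cs @ [a]) (rs @ [d])) (X a d)"
  using rsk_right_up[OF assms(1), of a "rev cs" d "rev rs"] assms
    rsk_rotate[OF assms(1), of "cs @ [a]" "rs @ [d]"] rsk_rotate[OF assms(1), of "cs @ [a]" "rs"]
    rsk_rotate[OF assms(1), of "cs" "rs @ [d]"] rsk_rotate[OF assms(1), of "cs" "rs"] by simp

text \<open>A line adds at most one cell, and row \<open>i\<close> can only receive one if row
  \<open>i - 1\<close> is already occupied.\<close>

lemma rsk_rows_bound:
  assumes "partial_bij X" "distinct cs" "distinct rs" "length rs \<le> i"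
  shows "rsk X cs rs i = 0"
  using assms(3,4)
proof (induction rs arbitrary: i)
  case (Cons r rs)
  obtain p where p: "rsk X cs (r # rs) = rsk X cs rs \<oplus> p"
    using rsk_fomin_aux[OF assms(1,2), of rs] Cons.prems by auto
  have sh: "is_shape (rsk X cs rs)" "is_shape (rsk X cs (r # rs))"
    by (rule is_shape_rsk[OF assms(1,2)]; use Cons.prems in simp)+
  have "p \<noteq> Some i" using is_shape_add_cell_iff[OF sh(1), of i] sh(2) p Cons by auto
  then show ?case using p Cons by (simp add: add_cell_apply)
qed simp

lemma rsk_columns_bound:
  assumes "partial_bij X" "distinct cs" "distinct rs" "length cs \<le> i"
  shows "rsk X cs rs i = 0"
  using rsk_rows_bound[OF partial_bij_transpose[OF assms(1)] assms(3,2,4)]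
  by (simp only: rsk_transpose[of X])

section \<open>Growth diagrams of partitions\<close>

definition row_fun :: "nat list \<Rightarrow> shape" where
  "row_fun xs k = (if k < length xs then xs ! k else 0)"

text \<open>The number of nonzero rows is \<open>top_row f 0\<close>; so this inverts
  \<open>row_fun\<close>.\<close>

definition part_of :: "shape \<Rightarrow> nat list" where
  "part_of f = map f [0..<top_row f 0]"

definition is_part :: "nat list \<Rightarrow> bool" where
  "is_part xs \<longleftrightarrow> sorted_wrt (\<ge>) xs \<and> 0 \<notin> set xs"

lemma is_shape_row_fun: "is_part xs \<Longrightarrow> is_shape (row_fun xs)"
  by (rule is_shapeI[where n = "length xs"]) (auto simp: row_fun_def is_part_def sorted_wrt_iff_nth_less)

lemma is_part_part_of:
  assumes "is_shape f" shows "is_part (part_of f)"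
proof -
  have "f i \<noteq> 0" if "i < top_row f 0" for i
    using that le_top_row_iff[OF assms, of 0 i] by auto
  then show ?thesis
    using is_shape_antimono[OF assms] by (auto simp: is_part_def part_of_def sorted_wrt_iff_nth_less) fastforce
qed

lemma row_fun_part_of [simp]:
  assumes "is_shape f" shows "row_fun (part_of f) = f"
  using le_top_row_iff[OF assms, of 0] by (auto simp: row_fun_def part_of_def fun_eq_iff not_less)

lemma part_of_row_fun [simp]:
  assumes "is_part xs" shows "part_of (row_fun xs) = xs"
proof -
  have "top_row (row_fun xs) 0 = length xs"
  proof (rule top_row_eqI[OF is_shape_row_fun[OF assms]])
    have "xs ! (length xs - 1) \<in> set xs" if "xs \<noteq> []" using that by simp
    then show "length xs = 0 \<or> 0 < row_fun xs (length xs - 1)"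
      using assms by (cases xs) (auto simp: row_fun_def is_part_def intro!: gr0I)
  qed (auto simp: row_fun_def)
  then show ?thesis by (auto simp: part_of_def row_fun_def intro!: nth_equalityI)
qed

lemma row_fun_eq_iff: "is_part xs \<Longrightarrow> is_part ys \<Longrightarrow> row_fun xs = row_fun ys \<longleftrightarrow> xs = ys"
  using part_of_row_fun by metis

lemma row_fun_Nil [simp]: "row_fun [] = (\<lambda>_. 0)"
  by (auto simp: row_fun_def)

lemma is_part_Nil [simp]: "is_part []"
  by (auto simp: is_part_def)

lemma row_fun_zero_iff: "is_part xs \<Longrightarrow> row_fun xs = (\<lambda>_. 0) \<longleftrightarrow> xs = []"
  using row_fun_eq_iff[of xs "[]"] by simp

lemma length_filter_map_upt:
  "length (filter P (map f [0..<n])) = card {c. c < n \<and> P (f c)}"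
proof -
  have "length (filter P (map f [0..<n])) = length (filter (\<lambda>c. P (f c)) [0..<n])"
    by (simp add: filter_map comp_def)
  also have "\<dots> = card (set (filter (\<lambda>c. P (f c)) [0..<n]))"
    by (rule distinct_card[symmetric]) simp
  also have "set (filter (\<lambda>c. P (f c)) [0..<n]) = {c. c < n \<and> P (f c)}" by auto
  finally show ?thesis .
qed

lemma col_length_map_conj:
  assumes "is_shape f" "f 0 \<le> n"
  shows "col_length (map (top_row f) [0..<n]) j = f j"
proof -
  have le: "f j \<le> n" using is_shape_antimono[OF assms(1), of 0 j] assms(2) by simp
  have "col_length (map (top_row f) [0..<n]) j = card {c. c < n \<and> j < top_row f c}"
    unfolding col_length_def by (rule length_filter_map_upt)
  also have "{c. c < n \<and> j < top_row f c} = {c. c < n \<and> c < f j}"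
    using le_top_row_iff[OF assms(1), of _ j] by (metis not_le)
  also have "\<dots> = {..<f j}" using le by auto
  finally show ?thesis by simp
qed

text \<open>The list \<open>L\<close> may contain zeros, as the sorted list in
  \<open>backward_rule\<close> does; only its column lengths matter.\<close>

lemma conj_part_eq_part_of:
  assumes "is_shape g" "\<And>j. col_length L j = g j"
  shows "conj_part L = part_of g"
proof -
  have "top_row g 0 \<le> j \<longleftrightarrow> Max (insert 0 (set L)) \<le> j" for j
    unfolding le_top_row_iff[OF assms(1)] assms(2)[symmetric] col_length_def
    by (auto simp: filter_empty_conv not_less)
  then have "top_row g 0 = Max (insert 0 (set L))" by (meson order_antisym order_refl)
  then show ?thesis by (simp add: conj_part_def part_of_def assms(2)[abs_def])
qed

lemma col_length_eq_conj:
  assumes "is_part xs" shows "col_length xs j = top_row (row_fun xs) j"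
  using col_length_map_conj[OF is_shape_conj[OF is_shape_row_fun[OF assms]] order_refl, of j]
    part_of_row_fun[OF assms] is_shape_row_fun[OF assms] by (simp add: part_of_def)

lemma length_conj_part:
  assumes "is_part xs" shows "length (conj_part xs) = row_fun xs 0"
proof -
  have "conj_part xs = part_of (top_row (row_fun xs))"
    by (rule conj_part_eq_part_of[OF is_shape_conj[OF is_shape_row_fun[OF assms]] col_length_eq_conj[OF assms]])
  then show ?thesis using is_shape_row_fun[OF assms] by (simp add: part_of_def)
qed

text \<open>All sorting, in the backward rule as well as in the evacuation array, undoes at most one
  exchange of two entries. This is the common form of these exchanges.\<close>

lemma mset_map_upt_swap:
  assumes "c < n" "d < n"
  shows "mset (map (f(c := f d, d := f c)) [0..<n]) = mset (map f [0..<n])"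
proof -
  have "map (f(c := f d, d := f c)) [0..<n] = (map f [0..<n])[c := map f [0..<n] ! d, d := map f [0..<n] ! c]"
    using assms by (auto intro!: nth_equalityI simp: nth_list_update)
  then show ?thesis using mset_swap[of d "map f [0..<n]" c] assms by simp
qed

lemma col_length_mset: "mset xs = mset ys \<Longrightarrow> col_length xs j = col_length ys j"
  unfolding col_length_def by (metis mset_filter size_mset)

lemma mset_sort_desc [simp]: "mset (sort_desc xs) = mset xs"
  by (simp add: sort_desc_def)

section \<open>The backward rule as the inverse of Fomin's rule\<close>

lemma add_first_row_row_fun: "row_fun (add_first_row xs) = row_fun xs \<oplus> Some 0"
  by (cases xs) (auto simp: row_fun_def fun_eq_iff nth_Cons split: nat.splits)

lemma is_part_add_first_row: "is_part xs \<Longrightarrow> is_part (add_first_row xs)"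
  by (cases xs) (auto simp: is_part_def)

text \<open>If the two neighbours agree, a new cell in the first row can only come from a cross,
  because the label of a collision is a successor.\<close>

lemma has_cross_iff:
  assumes "is_part k" "is_part n" "is_part m" "fomin l (row_fun k) (row_fun n) (row_fun m) x"
  shows "has_cross k m n \<longleftrightarrow> x"
proof -
  obtain p q where k: "row_fun k = l \<oplus> p" and n: "row_fun n = l \<oplus> q"
    and m: "row_fun m = row_fun k \<oplus> fomin_label p q x"
    and x: "x \<longrightarrow> p = None \<and> q = None" using assms(4) unfolding fomin_def by blast
  have "has_cross k m n \<longleftrightarrow> row_fun k = row_fun n \<and> row_fun m = row_fun k \<oplus> Some 0"
    unfolding has_cross_def add_first_row_row_fun[symmetric]
    using row_fun_eq_iff assms is_part_add_first_row by simp
  also have "\<dots> \<longleftrightarrow> p = q \<and> fomin_label p q x = Some 0"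
    unfolding m k n add_cell_eq_iff ..
  also have "\<dots> \<longleftrightarrow> x" using x by (cases p) auto
  finally show ?thesis .
qed

text \<open>On column lengths the subtraction is exact unless both neighbours add a cell to the same
  row \<open>i\<close> of \<open>l\<close>. Then the columns \<open>l i\<close> and
  \<open>l (Suc i)\<close>, of lengths \<open>i\<close> and \<open>Suc i\<close>, come out with
  their lengths exchanged if they are different columns, and sorting undoes the exchange.\<close>

lemma backward_rule_eq:
  assumes "is_part k" "is_part n" "is_part m" "is_shape l" "fomin l (row_fun k) (row_fun n) (row_fun m) x"
  shows "backward_rule k m n = part_of l"
proof (cases x)
  case True
  then have "row_fun k = l" using assms(5) by (auto simp: fomin_def)
  then show ?thesis using True has_cross_iff[OF assms(1-3,5)] assms(1) by (auto simp: backward_rule_def)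
next
  case False
  obtain p q where k: "row_fun k = l \<oplus> p" and n: "row_fun n = l \<oplus> q"
    and m: "row_fun m = row_fun k \<oplus> fomin_label p q x"
    using assms(5) unfolding fomin_def by blast
  note sh = is_shape_row_fun[OF assms(1)] is_shape_row_fun[OF assms(2)] is_shape_row_fun[OF assms(3)]
  let ?h = "\<lambda>j. col_length k j + col_length n j - col_length m j"
  let ?C = "top_row l"
  have h: "?h = (\<lambda>j. top_row (row_fun k) j + top_row (row_fun n) j - top_row (row_fun m) j)"
    using assms col_length_eq_conj by simp
  have l0: "l 0 \<le> row_fun m 0" using k m by (simp add: add_cell_apply)
  have addc: "top_row (f \<oplus> a) = top_row f \<oplus> map_option f a" if "is_shape f" "is_shape (f \<oplus> a)" for f a
    using that conj_add_cell[of f] by (cases a) (auto simp del: add_cell.simps(2))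
  have K: "top_row (row_fun k) = ?C \<oplus> map_option l p"
    using addc[OF assms(4), of p] sh k by simp
  have N: "top_row (row_fun n) = ?C \<oplus> map_option l q"
    using addc[OF assms(4), of q] sh n by simp
  have M: "top_row (row_fun m) = top_row (row_fun k) \<oplus> map_option (row_fun k) (fomin_label p q x)"
    using addc[OF sh(1), of "fomin_label p q x"] sh m by simp
  have "mset (map ?h [0..<row_fun m 0]) = mset (map ?C [0..<row_fun m 0])"
  proof (cases "p = q \<and> p \<noteq> None")
    case False
    have "?h = ?C"
    proof (cases "p = q")
      case True
      then show ?thesis using False h K N M \<open>\<not> x\<close> by auto
    next
      case pq: False
      have "map_option (row_fun k) q = map_option l q" using pq k by (cases q) (auto simp: add_cell_apply)
      then show ?thesis unfolding h M using pq K N by (auto simp: add_cell_apply)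
    qed
    then show ?thesis by simp
  next
    case True
    then obtain i where i: "p = Some i" "q = Some i" by (cases p) auto
    have li: "i = 0 \<or> l i < l (i - 1)" using is_shape_add_cell_iff[OF assms(4)] sh(1) k i by simp
    have le: "l (Suc i) \<le> l i" using is_shape_antimono[OF assms(4)] by simp
    have Cc: "?C (l i) = i" by (rule top_row_eqI[OF assms(4)]) (use li in auto)
    \<comment> \<open>The cells of \<open>k\<close> and \<open>n\<close> lie in column
      \<open>l i\<close>, whereas Fomin's rule puts the last cell of \<open>m\<close> into row
      \<open>Suc i\<close>, hence into column \<open>l (Suc i)\<close>.\<close>
    have hj: "?h j = ?C j + (if j = l i then 1 else 0) - (if j = l (Suc i) then 1 else 0)" for j
      using fun_cong[OF h, of j] unfolding M K N using i k by (auto simp: add_cell_apply)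
    show ?thesis
    proof (cases "l (Suc i) = l i")
      case True
      then have "?h = ?C" using hj by auto
      then show ?thesis by simp
    next
      case neq: False
      have Cd: "?C (l (Suc i)) = Suc i" by (rule top_row_eqI[OF assms(4)]) (use neq le in auto)
      have "?h = ?C(l i := ?C (l (Suc i)), l (Suc i) := ?C (l i))"
        using hj neq Cc Cd by auto
      moreover have "l i < row_fun m 0" "l (Suc i) < row_fun m 0"
      proof -
        have "l i < row_fun k i" using k i by simp
        also have "\<dots> \<le> row_fun k 0" using is_shape_antimono[OF sh(1)] by simp
        also have "\<dots> \<le> row_fun m 0" using m by (simp add: add_cell_apply)
        finally show "l i < row_fun m 0" .
        then show "l (Suc i) < row_fun m 0" using le by simp
      qed
      ultimately show ?thesis using mset_map_upt_swap by simp
    qed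
  qed
  then have "col_length (sort_desc (map ?h [0..<length (conj_part m)])) j = l j" for j
    using col_length_map_conj[OF assms(4) l0, of j] length_conj_part[OF assms(3)]
    by (metis col_length_mset mset_sort_desc)
  then show ?thesis
    using False has_cross_iff[OF assms(1-3,5)] conj_part_eq_part_of[OF assms(4)]
    by (simp add: backward_rule_def)
qed

lemma add_cell_right_cancel: "f \<oplus> p = g \<oplus> p \<longleftrightarrow> f = g"
  by (auto simp: fun_eq_iff add_cell_apply simp del: add_cell.simps)

text \<open>If both last steps add to the same row, the neighbours agree, and the cell was bumped
  from the row above or, in the first row, comes from a cross. In different rows both cells can be
  removed.\<close>

lemma fomin_backward_exists:
  assumes "is_shape k" "is_shape n" "is_shape m" "m = k \<oplus> a" "m = n \<oplus> b"
  shows "\<exists>l x. is_shape l \<and> fomin l k n m x"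
proof -
  consider "a = None" | "b = None" | "a = Some 0" "b = Some 0" | i where "a = Some (Suc i)" "b = Some (Suc i)"
    | i j where "a = Some i" "b = Some j" "i \<noteq> j"
    by (metis not0_implies_Suc option.exhaust)
  then show ?thesis
  proof cases
    case 1
    then have "fomin n k n m False" unfolding fomin_def using assms(4,5)
      by (intro exI[of _ b] exI[of _ None]) auto
    then show ?thesis using assms by blast
  next
    case 2
    then have "fomin k k n m False" unfolding fomin_def using assms(4,5)
      by (intro exI[of _ None] exI[of _ a]) auto
    then show ?thesis using assms by blast
  next
    case 3
    then have "k = n" using assms(4,5) add_cell_right_cancel by metis
    then have "fomin k k n m True" unfolding fomin_def using assms(4,5) 3
      by (intro exI[of _ None]) auto
    then show ?thesis using assms by blast
  next
    case 4
    then have kn: "k = n" using assms(4,5) add_cell_right_cancel by metis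
    define l where "l = k(i := k i - 1)"
    \<comment> \<open>As \<open>m\<close> is a shape with one more cell in row \<open>Suc i\<close>,
      row \<open>i\<close> of \<open>k\<close> can lose a cell.\<close>
    have "Suc (k (Suc i)) \<le> k i" using is_shape_antimono[OF assms(3), of i "Suc i"] assms(4) 4 by simp
    then have lk: "k = l \<oplus> Some i" "k (Suc i) \<le> l i" by (auto simp: l_def)
    have "is_shape l"
    proof -
      obtain z where "k z = 0" using assms(1) by (auto simp: is_shape_def)
      then have "l z = 0" by (auto simp: l_def)
      moreover have "l (Suc j) \<le> l j" for j
        using is_shape_antimono[OF assms(1), of j "Suc j"] lk(2) by (auto simp: l_def)
      ultimately show ?thesis by (intro is_shapeI)
    qed
    moreover have "fomin l k n m False" unfolding fomin_def using lk(1) kn assms(4) 4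
      by (intro exI[of _ "Some i"]) auto
    ultimately show ?thesis by blast
  next
    case 5
    define l where "l = k(j := k j - 1)"
    have kj: "k j = Suc (n j)" "n i = Suc (k i)" "\<And>z. z \<noteq> i \<Longrightarrow> z \<noteq> j \<Longrightarrow> n z = k z"
    proof -
      have *: "(k \<oplus> Some i) z = (n \<oplus> Some j) z" for z using assms(4,5) 5 by metis
      show "k j = Suc (n j)" "n i = Suc (k i)"
        using *[of i] *[of j] 5(3) by (auto simp: add_cell_apply split: if_splits)
      show "n z = k z" if "z \<noteq> i" "z \<noteq> j" for z
        using *[of z] that by (auto simp: add_cell_apply split: if_splits)
    qed
    then have lk: "k = l \<oplus> Some j" "n = l \<oplus> Some i" using 5
      by (auto simp: l_def fun_eq_iff)
    have "is_shape l"
    proof -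
      obtain z where "k z = 0" using assms(1) by (auto simp: is_shape_def)
      then have "l z = 0" by (auto simp: l_def)
      moreover have "l (Suc z) \<le> l z" for z
      proof (cases "z = j")
        case True
        have "k (Suc j) \<le> n (Suc j)" using kj(2) kj(3)[of "Suc j"] by (cases "Suc j = i") auto
        also have "\<dots> \<le> n j" using is_shape_antimono[OF assms(2)] by simp
        finally show ?thesis using True kj(1) by (simp add: l_def)
      next
        case False
        have "l (Suc z) \<le> k (Suc z)" by (simp add: l_def)
        also have "\<dots> \<le> k z" using is_shape_antimono[OF assms(1)] by simp
        finally show ?thesis using False by (simp add: l_def)
      qed
      ultimately show ?thesis by (intro is_shapeI)
    qed
    moreover have "fomin l k n m False" unfolding fomin_def using lk assms(4) 5
      by (intro exI[of _ "Some j"] exI[of _ "Some i"]) auto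
    ultimately show ?thesis by blast
  qed
qed

text \<open>Exchanging rows and columns turns the diagram of the negative parts into one of the same kind as the
  diagram of the positive parts, whose boundary starts one step later.\<close>

function plab :: "(nat \<Rightarrow> nat list) \<Rightarrow> nat \<Rightarrow> nat \<Rightarrow> nat list" where
  "plab p a b =
     (if b < a then p (2 * b + 1)
      else if a = b then p (2 * a)
      else backward_rule (plab p a (b - 1)) (plab p (a + 1) (b - 1)) (plab p (a + 1) b))"
  by pat_completeness auto
termination by (relation "measure (\<lambda>(p, a, b). b - a)") auto

declare plab.simps [simp del]

lemma plab_diag [simp]: "plab p a a = p (2 * a)" "plab p (Suc a) a = p (Suc (2 * a))"
  by (simp_all add: plab.simps)

lemma plab_cell: "a \<le> b \<Longrightarrow> plab p a (Suc b) = backward_rule (plab p a b) (plab p (Suc a) b) (plab p (Suc a) (Suc b))"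
  by (simp add: plab.simps[of p a "Suc b"])

lemma backward_rule_commute: "backward_rule k m n = backward_rule n m k"
  by (auto simp: backward_rule_def has_cross_def add.commute)

lemma has_cross_commute: "has_cross k m n = has_cross n m k"
  by (auto simp: has_cross_def)

lemma pos_label_eq_plab: "pos_label A a b = plab (\<lambda>k. pos_part (A ! k)) a b"
proof (induction A a b rule: pos_label.induct)
  case (1 A a b)
  then show ?case by (simp add: pos_label.simps[of A a b] plab.simps[of _ a b])
qed

text \<open>The shift by one arises because the innermost corners in this half are
  \<open>(a + 1, a)\<close>, labelled by the odd staircases; they take the place of the corners
  \<open>(a, a)\<close>.\<close>

lemma neg_label_eq_plab: "b \<le> Suc a \<Longrightarrow> neg_label A (Suc a) b = plab (\<lambda>k. neg_part (A ! Suc k)) b a"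
proof (induction "Suc a - b" arbitrary: a b rule: less_induct)
  case less
  consider "b = Suc a" | "b = a" | a' where "a = Suc a'" "b \<le> a'"
    using less.prems by (metis le_Suc_eq not0_implies_Suc le_zero_eq)
  then show ?case
  proof cases
    case 3
    have "neg_label A (Suc a) b = backward_rule (neg_label A (Suc a) (Suc b)) (neg_label A a (Suc b)) (neg_label A a b)"
      using 3 by (subst neg_label.simps) simp
    also have "\<dots> = backward_rule (plab (\<lambda>k. neg_part (A ! Suc k)) (Suc b) a)
        (plab (\<lambda>k. neg_part (A ! Suc k)) (Suc b) a') (plab (\<lambda>k. neg_part (A ! Suc k)) b a')"
      using less.hyps[of a "Suc b"] less.hyps[of a' "Suc b"] less.hyps[of a' b] 3 by simp
    also have "\<dots> = plab (\<lambda>k. neg_part (A ! Suc k)) b a"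
      using 3 plab_cell backward_rule_commute by metis
    finally show ?thesis .
  qed (subst neg_label.simps, simp)+
qed

section \<open>Labels and crosses along a boundary path\<close>

definition is_path :: "(nat \<Rightarrow> nat list) \<Rightarrow> bool" where
  "is_path p \<longleftrightarrow> p 0 = [] \<and> (\<forall>k. is_part (p k)) \<and>
     (\<forall>k. (\<exists>a. row_fun (p (Suc (2 * k))) = row_fun (p (2 * k)) \<oplus> a) \<and>
          (\<exists>a. row_fun (p (Suc (2 * k))) = row_fun (p (Suc (Suc (2 * k)))) \<oplus> a))"

definition cell_cross :: "(nat \<Rightarrow> nat list) \<Rightarrow> nat \<Rightarrow> nat \<Rightarrow> bool" where
  "cell_cross p a b \<longleftrightarrow> has_cross (plab p a b) (plab p (Suc a) b) (plab p (Suc a) (Suc b))"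

lemma plab_backward:
  assumes "is_part (plab p a b)" "is_part (plab p (Suc a) b)" "is_part (plab p (Suc a) (Suc b))" "a \<le> b"
    "row_fun (plab p (Suc a) b) = row_fun (plab p a b) \<oplus> s"
    "row_fun (plab p (Suc a) b) = row_fun (plab p (Suc a) (Suc b)) \<oplus> t"
  shows "is_part (plab p a (Suc b)) \<and> fomin (row_fun (plab p a (Suc b))) (row_fun (plab p a b))
    (row_fun (plab p (Suc a) (Suc b))) (row_fun (plab p (Suc a) b)) (cell_cross p a b)"
proof -
  obtain l x where lx: "is_shape l" "fomin l (row_fun (plab p a b)) (row_fun (plab p (Suc a) (Suc b)))
      (row_fun (plab p (Suc a) b)) x"
    using fomin_backward_exists[OF _ _ _ assms(5,6)] assms is_shape_row_fun by blast
  have "plab p a (Suc b) = part_of l"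
    unfolding plab_cell[OF assms(4)] by (rule backward_rule_eq[OF assms(1,3,2) lx])
  then show ?thesis using lx has_cross_iff[OF assms(1,3,2) lx(2)] is_part_part_of by (simp add: cell_cross_def)
qed

text \<open>Induction on the distance \<open>d\<close> from the boundary. The edges belong to the
  induction hypothesis because the backward rule presupposes that neighbouring labels differ by at
  most one cell.\<close>

lemma plab_local:
  assumes "is_path p"
  shows "is_part (plab p a (a + d)) \<and> is_part (plab p (Suc a) (a + d)) \<and>
    (\<exists>s. row_fun (plab p (Suc a) (a + d)) = row_fun (plab p a (a + d)) \<oplus> s) \<and>
    (\<exists>t. row_fun (plab p (Suc a) (a + d)) = row_fun (plab p (Suc a) (Suc (a + d))) \<oplus> t)"
proof (induction d arbitrary: a)
  case 0
  have "plab p (Suc a) (Suc a) = p (Suc (Suc (2 * a)))" by (simp only: plab_diag) simp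
  then show ?case using assms by (simp add: is_path_def)
next
  case (Suc d)
  have *: "is_part (plab p a (Suc (a + d))) \<and> fomin (row_fun (plab p a (Suc (a + d)))) (row_fun (plab p a (a + d)))
    (row_fun (plab p (Suc a) (Suc (a + d)))) (row_fun (plab p (Suc a) (a + d))) (cell_cross p a (a + d))" for a
  proof -
    have "is_part (plab p (Suc a) (Suc (a + d)))" using Suc[of "Suc a"] by simp
    then show ?thesis using plab_backward[of p a "a + d"] Suc[of a] by auto
  qed
  show ?case using *[of a] *[of "Suc a"] Suc[of "Suc a"] unfolding fomin_def by auto
qed

lemma
  assumes "is_path p"
  shows is_part_plab: "a \<le> Suc b \<Longrightarrow> is_part (plab p a b)"
    and plab_fomin: "a \<le> b \<Longrightarrow> fomin (row_fun (plab p a (Suc b))) (row_fun (plab p (Suc a) (Suc b)))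
      (row_fun (plab p a b)) (row_fun (plab p (Suc a) b)) (cell_cross p a b)"
    and plab_right: "a \<le> b \<Longrightarrow> \<exists>s. row_fun (plab p (Suc a) b) = row_fun (plab p a b) \<oplus> s"
    and plab_up: "a \<le> Suc b \<Longrightarrow> \<exists>s. row_fun (plab p a b) = row_fun (plab p a (Suc b)) \<oplus> s"
proof -
  show 1: "is_part (plab p a b)" if "a \<le> Suc b" for a b
    using plab_local[OF assms, of a "b - a"] plab_local[OF assms, of b 0] that by (cases "a = Suc b") auto
  show 2: "\<exists>s. row_fun (plab p (Suc a) b) = row_fun (plab p a b) \<oplus> s" if "a \<le> b" for a b
    using plab_local[OF assms, of a "b - a"] that by auto
  have 3: "\<exists>s. row_fun (plab p (Suc a) b) = row_fun (plab p (Suc a) (Suc b)) \<oplus> s" if "a \<le> b" for a b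
    using plab_local[OF assms, of a "b - a"] that by auto
  show 4: "fomin (row_fun (plab p a (Suc b))) (row_fun (plab p (Suc a) (Suc b)))
      (row_fun (plab p a b)) (row_fun (plab p (Suc a) b)) (cell_cross p a b)" if "a \<le> b" for a b
    using plab_backward[of p a b] 1 2[OF that] 3[OF that] that by (auto intro: fomin_swap)
  show "\<exists>s. row_fun (plab p a b) = row_fun (plab p a (Suc b)) \<oplus> s" if "a \<le> Suc b" for a b
  proof (cases a)
    case 0
    then show ?thesis using 4[of 0 b] unfolding fomin_def by auto
  next
    case (Suc c)
    then show ?thesis using 3[of c b] that by auto
  qed
qed

section \<open>The matrix of a path of staircases\<close>

text \<open>Steps do not disappear on the way from \<open>l\<close> to \<open>m\<close>, and a cross
  creates one in either direction.\<close>

lemma fomin_edges: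
  assumes "fomin l k n m x"
  shows "k \<noteq> l \<Longrightarrow> m \<noteq> n" "n \<noteq> l \<Longrightarrow> m \<noteq> k" "x \<Longrightarrow> k = l \<and> n = l \<and> m \<noteq> l"
proof -
  have 1: "(n \<noteq> l \<longrightarrow> m \<noteq> k) \<and> (x \<longrightarrow> k = l \<and> n = l \<and> m \<noteq> l)" if "fomin l k n m x" for k n
  proof -
    obtain p q where k: "k = l \<oplus> p" and n: "n = l \<oplus> q" and m: "m = k \<oplus> fomin_label p q x"
      and x: "x \<longrightarrow> p = None \<and> q = None" using \<open>fomin l k n m x\<close> unfolding fomin_def by blast
    have "q \<noteq> None \<Longrightarrow> fomin_label p q x \<noteq> None" by (cases q) auto
    then show ?thesis using k n m x by (simp del: add_cell.simps(2))
  qed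
  show "k \<noteq> l \<Longrightarrow> m \<noteq> n" using 1[OF fomin_swap[OF assms]] by blast
  show "n \<noteq> l \<Longrightarrow> m \<noteq> k" "x \<Longrightarrow> k = l \<and> n = l \<and> m \<noteq> l" using 1[OF assms] by blast+
qed

text \<open>Between a cross and the boundary path the horizontal step of the column is present, and
  on the far side of the cross it is absent. Two crosses would contradict each other.\<close>

lemma cell_cross_column:
  assumes "is_path p" "a \<le> b" "cell_cross p a b"
  shows "p (Suc (2 * a)) \<noteq> p (2 * a)" "\<And>b'. a \<le> b' \<Longrightarrow> cell_cross p a b' \<Longrightarrow> b' = b"
proof -
  let ?H = "\<lambda>b. row_fun (plab p (Suc a) b) \<noteq> row_fun (plab p a b)"
  note f = plab_fomin[OF assms(1)]
  have down: "?H b" if "?H (Suc b)" "a \<le> b" for b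
    using fomin_edges(1)[OF f[OF that(2)]] that(1) by auto
  have down': "?H b" if "?H b'" "a \<le> b" "b \<le> b'" for b b'
    using that(3,1,2) by (induction b' rule: dec_induct) (auto dest: down)
  have cr: "?H b \<and> \<not> ?H (Suc b)" if "a \<le> b" "cell_cross p a b" for b
    using fomin_edges(3)[OF f[OF that(1)]] that(2) by auto
  have "?H a" using down'[of b a] cr[OF assms(2,3)] assms(2) by auto
  then show "p (Suc (2 * a)) \<noteq> p (2 * a)" by auto
  have lt: "\<not> b < b'" if "a \<le> b" "a \<le> b'" "cell_cross p a b" "cell_cross p a b'" for b b'
    using cr[OF that(1,3)] cr[OF that(2,4)] down'[of b' "Suc b"] that(1) by auto
  show "b' = b" if "a \<le> b'" "cell_cross p a b'" for b'
    using lt[of b b'] lt[of b' b] that assms by auto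
qed

lemma cell_cross_row:
  assumes "is_path p" "a \<le> b" "cell_cross p a b"
  shows "p (Suc (2 * b)) \<noteq> p (Suc (Suc (2 * b)))" "\<And>a'. a' \<le> b \<Longrightarrow> cell_cross p a' b \<Longrightarrow> a' = a"
proof -
  let ?V = "\<lambda>a. row_fun (plab p a b) \<noteq> row_fun (plab p a (Suc b))"
  note f = plab_fomin[OF assms(1)]
  have up: "?V (Suc a)" if "?V a" "a \<le> b" for a
    using fomin_edges(2)[OF f[OF that(2)]] that(1) by auto
  have up': "?V a'" if "?V a" "a' \<le> Suc b" "a \<le> a'" for a a'
    using that(3,1,2) by (induction a' rule: dec_induct) (auto dest: up)
  have cr: "?V (Suc a) \<and> \<not> ?V a" if "a \<le> b" "cell_cross p a b" for a
    using fomin_edges(3)[OF f[OF that(1)]] that(2) by auto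
  have "?V (Suc b)" using up'[of "Suc a" "Suc b"] cr[OF assms(2,3)] assms(2) by auto
  moreover have "plab p (Suc b) (Suc b) = p (Suc (Suc (2 * b)))" by (simp only: plab_diag) simp
  ultimately show "p (Suc (2 * b)) \<noteq> p (Suc (Suc (2 * b)))" by auto
  have lt: "\<not> a < a'" if "a \<le> b" "a' \<le> b" "cell_cross p a b" "cell_cross p a' b" for a a'
    using cr[OF that(1,3)] cr[OF that(2,4)] up'[of "Suc a" a'] that(2) by auto
  show "a' = a" if "a' \<le> b" "cell_cross p a' b" for a'
    using lt[of a a'] lt[of a' a] that assms by auto
qed

lemma rsk_map_rows: "rsk (\<lambda>c r. X c (f r)) cs rs = rsk X cs (map f rs)"
proof (induction cs arbitrary: rs)
  case (Cons c cs)
  show ?case by (induction rs) (simp_all add: Cons rsk.simps(3))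
qed simp

lemma add_cell_eq_zero:
  assumes "g = f \<oplus> s" "g = (\<lambda>_. 0)"
  shows "f = (\<lambda>_. 0)"
proof
  show "f i = 0" for i using fun_cong[OF assms(1), of i] assms(2) by (simp add: add_cell_apply)
qed

text \<open>Once the path is back at the empty partition, the left and the bottom side of the
  diagram are empty, and Fomin's rule read from the lower left corner is the recursion of
  \<open>rsk\<close>.\<close>

lemma plab_eq_rsk:
  assumes p: "is_path p" and bot: "p (Suc (2 * B)) = []" and Y: "partial_bij Y"
    "\<And>a b. a \<le> b \<Longrightarrow> b < B \<Longrightarrow> Y (Suc a) (Suc b) = cell_cross p a b"
    and ab: "b \<le> B" "a \<le> Suc b"
  shows "row_fun (plab p a b) = rsk Y (rev [1..<Suc a]) [Suc b..<Suc B]"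
proof -
  have bottom: "row_fun (plab p a B) = (\<lambda>_. 0)" if "a \<le> Suc B" for a
    using that
  proof (induction rule: inc_induct)
    case base
    then show ?case using bot by simp
  next
    case (step n)
    then obtain s where "row_fun (plab p (Suc n) B) = row_fun (plab p n B) \<oplus> s"
      using plab_right[OF p, of n B] by auto
    then show ?case by (rule add_cell_eq_zero) fact
  qed
  have left: "row_fun (plab p 0 b) = (\<lambda>_. 0)" for b
  proof (induction b)
    case 0
    then show ?case using p by (simp add: is_path_def)
  next
    case (Suc b)
    obtain s where "row_fun (plab p 0 b) = row_fun (plab p 0 (Suc b)) \<oplus> s"
      using plab_up[OF p, of 0 b] by auto
    then show ?case by (rule add_cell_eq_zero) fact
  qed
  have "\<forall>a \<le> Suc b. row_fun (plab p a b) = rsk Y (rev [1..<Suc a]) [Suc b..<Suc B]"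
    using ab(1)
  proof (induction rule: inc_induct)
    case base
    then show ?case using bottom by simp
  next
    case (step b)
    have "row_fun (plab p a b) = rsk Y (rev [1..<Suc a]) [Suc b..<Suc B]" if "a \<le> Suc b" for a
      using that
    proof (induction a)
      case 0
      then show ?case using left by simp
    next
      case (Suc a)
      have e1: "rev [1..<Suc (Suc a)] = Suc a # rev [1..<Suc a]" by simp
      have e2: "[Suc b..<Suc B] = Suc b # [Suc (Suc b)..<Suc B]" using step(2) by (simp add: upt_conv_Cons)
      have "fomin (rsk Y (rev [1..<Suc a]) [Suc (Suc b)..<Suc B])
        (rsk Y (rev [1..<Suc (Suc a)]) [Suc (Suc b)..<Suc B])
        (rsk Y (rev [1..<Suc a]) [Suc b..<Suc B]) (row_fun (plab p (Suc a) b)) (Y (Suc a) (Suc b))"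
        using plab_fomin[OF p, of a b] step Suc Y(2)[of a b] by simp
      moreover have "fomin (rsk Y (rev [1..<Suc a]) [Suc (Suc b)..<Suc B])
        (rsk Y (rev [1..<Suc (Suc a)]) [Suc (Suc b)..<Suc B])
        (rsk Y (rev [1..<Suc a]) [Suc b..<Suc B])
        (rsk Y (rev [1..<Suc (Suc a)]) [Suc b..<Suc B]) (Y (Suc a) (Suc b))"
        unfolding e1 e2 by (rule rsk_right_up[OF Y(1)]) auto
      ultimately show ?case by (rule fomin_functional)
    qed
    then show ?case by blast
  qed
  then show ?thesis using ab(2) by blast
qed

text \<open>The positive and negative parts of an unending path of staircases. The length of the
  vectors does not occur, so that the path can be continued freely; what is kept is that a step
  changes only one of the two parts.\<close>

locale staircase_path =
  fixes p m :: "nat \<Rightarrow> nat list" and E :: nat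
  assumes start: "p 0 = []" "m 0 = []"
    and parts: "is_part (p k)" "is_part (m k)"
    and step_up: "\<exists>a b. row_fun (p (Suc (2 * k))) = row_fun (p (2 * k)) \<oplus> a \<and>
      row_fun (m (2 * k)) = row_fun (m (Suc (2 * k))) \<oplus> b \<and> (a = None \<or> b = None)"
    and step_down: "\<exists>a b. row_fun (p (Suc (2 * k))) = row_fun (p (Suc (Suc (2 * k)))) \<oplus> a \<and>
      row_fun (m (Suc (Suc (2 * k)))) = row_fun (m (Suc (2 * k))) \<oplus> b \<and> (a = None \<or> b = None)"
    and finish: "2 * E \<le> k \<Longrightarrow> p k = []" "2 * E \<le> k \<Longrightarrow> m k = []"
    and E_pos: "0 < E"
begin

text \<open>Lines are numbered from 1 and corners from 0. The offset 2 combines this with the shift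
  of columns in \<open>neg_label_eq_plab\<close>.\<close>

definition X :: "nat \<Rightarrow> nat \<Rightarrow> bool" where
  "X c r \<longleftrightarrow> 1 \<le> c \<and> 1 \<le> r \<and>
     (if c \<le> r then cell_cross p (c - 1) (r - 1) else cell_cross (\<lambda>k. m (Suc k)) (r - 1) (c - 2))"

lemma is_path_p: "is_path p"
  unfolding is_path_def using start parts step_up step_down by blast

lemma is_path_m: "is_path (\<lambda>k. m (Suc k))"
proof -
  have "m (Suc 0) = []"
  proof -
    obtain b where "row_fun (m 0) = row_fun (m (Suc 0)) \<oplus> b" using step_up[of 0] by auto
    then have "row_fun (m (Suc 0)) = (\<lambda>_. 0)" by (rule add_cell_eq_zero) (simp add: start)
    then show ?thesis using row_fun_zero_iff parts by blast
  qed
  moreover have "\<exists>a. row_fun (m (Suc (Suc (2 * k)))) = row_fun (m (Suc (Suc (Suc (2 * k))))) \<oplus> a" for k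
    using step_up[of "Suc k"] by auto
  ultimately show ?thesis
    unfolding is_path_def using parts step_down by blast
qed

text \<open>A cross on one side of the diagonal forces a change of \<open>p\<close>, on the other
  side a change of \<open>m\<close>, at the same step of the path: one that adds for a column, one
  that subtracts for a row. Only one part changes in a step, so crosses of a line lie on one side,
  where they are unique.\<close>

lemma partial_bij_X: "partial_bij X"
proof -
  have c: "m (2 * a) = m (Suc (2 * a)) \<or> p (Suc (2 * a)) = p (2 * a)" for a
    using step_up[of a] parts row_fun_eq_iff by (metis add_cell.simps(1))
  have r: "m (Suc (2 * a)) = m (Suc (Suc (2 * a))) \<or> p (Suc (2 * a)) = p (Suc (Suc (2 * a)))" for a
    using step_down[of a] parts row_fun_eq_iff by (metis add_cell.simps(1))
  have Xp: "1 \<le> c" "1 \<le> r" "c - 1 \<le> r - 1" "cell_cross p (c - 1) (r - 1)" if "X c r" "c \<le> r" for c r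
    using that by (simp_all add: X_def)
  have Xm: "2 \<le> c" "1 \<le> r" "r - 1 \<le> c - 2" "cell_cross (\<lambda>k. m (Suc k)) (r - 1) (c - 2)"
    if "X c r" "\<not> c \<le> r" for c r
  proof -
    show "1 \<le> r" "cell_cross (\<lambda>k. m (Suc k)) (r - 1) (c - 2)" using that by (simp_all add: X_def)
    then show "2 \<le> c" "r - 1 \<le> c - 2" using that(2) by linarith+
  qed
  have col: "r1 = r2" if X1: "X c r1" and X2: "X c r2" for c r1 r2
  proof -
    have pos: "p (Suc (2 * (c - 1))) \<noteq> p (2 * (c - 1))" if "X c r" "c \<le> r" for r
      using cell_cross_column(1)[OF is_path_p Xp(3,4)[OF that]] .
    have neg: "m (2 * (c - 1)) \<noteq> m (Suc (2 * (c - 1)))" if "X c r" "\<not> c \<le> r" for r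
    proof -
      have "c - 1 = Suc (c - 2)" using Xm(1)[OF that] by linarith
      then show ?thesis using cell_cross_row(1)[OF is_path_m Xm(3,4)[OF that]] by simp
    qed
    have iff: "c \<le> r1 \<longleftrightarrow> c \<le> r2" using pos neg c X1 X2 by metis
    have "r1 - 1 = r2 - 1"
    proof (cases "c \<le> r1")
      case True
      then show ?thesis using cell_cross_column(2)[OF is_path_p Xp(3,4)[OF X2] Xp(3,4)[OF X1]] iff by blast
    next
      case False
      then show ?thesis using cell_cross_row(2)[OF is_path_m Xm(3,4)[OF X2] Xm(3,4)[OF X1]] iff by blast
    qed
    moreover have "1 \<le> r1" "1 \<le> r2" using X1 X2 by (simp_all add: X_def)
    ultimately show ?thesis by linarith
  qed
  have row: "c1 = c2" if X1: "X c1 r" and X2: "X c2 r" for c1 c2 r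
  proof -
    have pos: "p (Suc (2 * (r - 1))) \<noteq> p (Suc (Suc (2 * (r - 1))))" if "X c r" "c \<le> r" for c
      using cell_cross_row(1)[OF is_path_p Xp(3,4)[OF that]] .
    have neg: "m (Suc (2 * (r - 1))) \<noteq> m (Suc (Suc (2 * (r - 1))))" if "X c r" "\<not> c \<le> r" for c
      using cell_cross_column(1)[OF is_path_m Xm(3,4)[OF that]] by auto
    have iff: "c1 \<le> r \<longleftrightarrow> c2 \<le> r" using pos neg r X1 X2 by metis
    show ?thesis
    proof (cases "c1 \<le> r")
      case True
      then have "c1 - 1 = c2 - 1"
        using cell_cross_row(2)[OF is_path_p Xp(3,4)[OF X2] Xp(3,4)[OF X1]] iff by blast
      then show ?thesis using Xp(1)[OF X1 True] Xp(1)[OF X2] True iff by linarith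
    next
      case False
      then have "c1 - 2 = c2 - 2"
        using cell_cross_column(2)[OF is_path_m Xm(3,4)[OF X2] Xm(3,4)[OF X1]] iff by blast
      then show ?thesis using Xm(1)[OF X1 False] Xm(1)[OF X2] False iff by linarith
    qed
  qed
  show ?thesis unfolding partial_bij_def using col row by blast
qed

lemma pos_eq_rsk:
  assumes "b \<le> E" "a \<le> Suc b"
  shows "row_fun (plab p a b) = rsk X (rev [1..<Suc a]) [Suc b..<Suc E]"
  by (rule plab_eq_rsk[OF is_path_p _ partial_bij_X _ assms]) (auto simp: finish X_def)

lemma neg_eq_rsk:
  assumes "a < E" "b \<le> Suc a"
  shows "row_fun (plab (\<lambda>k. m (Suc k)) b a) = rsk X (rev [Suc (Suc a)..<Suc E]) [1..<Suc b]"
proof -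
  have inj: "partial_bij (\<lambda>r c. X (Suc c) r)"
    using partial_bij_X unfolding partial_bij_def by blast
  have "row_fun (plab (\<lambda>k. m (Suc k)) b a) = rsk (\<lambda>r c. X (Suc c) r) (rev [1..<Suc b]) [Suc a..<Suc (E - 1)]"
    by (rule plab_eq_rsk[OF is_path_m _ inj _ _ assms(2)])
      (use assms(1) finish in \<open>auto simp: X_def\<close>)
  also have "\<dots> = rsk (\<lambda>r c. X c r) (rev [1..<Suc b]) (map Suc [Suc a..<Suc (E - 1)])"
    by (rule rsk_map_rows)
  also have "map Suc [Suc a..<Suc (E - 1)] = [Suc (Suc a)..<Suc E]"
    using assms(1) by (simp add: map_Suc_upt del: upt_Suc)
  also have "rsk (\<lambda>r c. X c r) (rev [1..<Suc b]) [Suc (Suc a)..<Suc E]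
      = rsk X [Suc (Suc a)..<Suc E] (rev [1..<Suc b])"
    by (rule rsk_transpose)
  \<comment> \<open>The diagram of the negative parts grows from the opposite corner of the square;
    turning by 180 degrees restores the order of lines used for the positive parts.\<close>
  also have "\<dots> = rsk X (rev [Suc (Suc a)..<Suc E]) [1..<Suc b]"
    using rsk_rotate[OF partial_bij_X, of "rev [Suc (Suc a)..<Suc E]" "[1..<Suc b]"]
    by (simp del: upt_Suc)
  finally show ?thesis .
qed

text \<open>Together with \<open>neg_shape\<close> this distributes the rows and the columns
  \<open>1..E\<close> among two submatrices. Raising \<open>k\<close> or \<open>j\<close> by one
  moves one line from one submatrix to the other: a row for even \<open>k\<close> or odd
  \<open>j\<close>, a column otherwise.\<close>

definition pos_shape :: "nat \<Rightarrow> nat \<Rightarrow> shape" where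
  "pos_shape k j = rsk X (rev [Suc (k div 2)..<Suc (Suc j div 2)])
     ([Suc (j div 2)..<Suc E] @ [1..<Suc (Suc k div 2)])"

definition neg_shape :: "nat \<Rightarrow> nat \<Rightarrow> shape" where
  "neg_shape k j = rsk X (rev ([Suc (Suc j div 2)..<Suc E] @ [1..<Suc (k div 2)]))
     [Suc (Suc k div 2)..<Suc (j div 2)]"

lemma pos_shape_0: "j \<le> 2 * E \<Longrightarrow> pos_shape 0 j = row_fun (p j)"
proof (cases "even j")
  case True
  assume "j \<le> 2 * E"
  then show ?thesis using pos_eq_rsk[of "j div 2" "j div 2"] True by (simp add: pos_shape_def del: upt_Suc)
next
  case False
  assume j: "j \<le> 2 * E"
  obtain i where i: "j = Suc (2 * i)" using False by (metis oddE Suc_eq_plus1)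
  have "row_fun (p j) = row_fun (plab p (Suc i) i)" using i by simp
  then show ?thesis using pos_eq_rsk[of i "Suc i"] i j by (simp add: pos_shape_def del: upt_Suc)
qed

lemma neg_shape_0: "j \<le> 2 * E \<Longrightarrow> neg_shape 0 j = row_fun (m j)"
proof (cases "even j")
  case True
  assume j: "j \<le> 2 * E"
  show ?thesis
  proof (cases "j = 0")
    case True
    then show ?thesis using start by (simp add: neg_shape_def)
  next
    case False
    then obtain i where i: "j = Suc (Suc (2 * i))" using True by (metis evenE not0_implies_Suc mult_0_right mult_Suc_right add_2_eq_Suc)
    have "row_fun (m j) = row_fun (plab (\<lambda>k. m (Suc k)) (Suc i) i)" using i by simp
    then show ?thesis using neg_eq_rsk[of i "Suc i"] i j by (simp add: neg_shape_def del: upt_Suc)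
  qed
next
  case False
  assume j: "j \<le> 2 * E"
  obtain i where i: "j = Suc (2 * i)" using False by (metis oddE Suc_eq_plus1)
  have "row_fun (m j) = row_fun (plab (\<lambda>k. m (Suc k)) i i)" using i by simp
  then show ?thesis using neg_eq_rsk[of i i] i j by (simp add: neg_shape_def del: upt_Suc)
qed

end

section \<open>The local rule for staircases\<close>

definition vec :: "nat \<Rightarrow> (nat \<Rightarrow> int) \<Rightarrow> (nat \<Rightarrow> int) \<Rightarrow> int list" where
  "vec n P N = map (\<lambda>k. P k - N (n - 1 - k)) [0..<n]"

abbreviation stair :: "nat \<Rightarrow> shape \<Rightarrow> shape \<Rightarrow> int list" where
  "stair n p m \<equiv> vec n (\<lambda>i. int (p i)) (\<lambda>i. int (m i))"

text \<open>It makes the two summands of an entry of \<open>stair\<close> exclude each other, so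
  that both parts can be read off.\<close>

definition fits :: "nat \<Rightarrow> shape \<Rightarrow> shape \<Rightarrow> bool" where
  "fits n p m \<longleftrightarrow> (\<exists>a b. a + b \<le> n \<and> (\<forall>i\<ge>a. p i = 0) \<and> (\<forall>i\<ge>b. m i = 0))"

lemma fits_commute: "fits n p m \<Longrightarrow> fits n m p"
  unfolding fits_def by (metis add.commute)

lemma fits_pos:
  assumes "fits n p m" "p i \<noteq> 0"
  shows "i < n" "m (n - 1 - i) = 0"
proof -
  obtain a b where ab: "a + b \<le> n" "\<forall>i\<ge>a. p i = 0" "\<forall>i\<ge>b. m i = 0"
    using assms(1) unfolding fits_def by blast
  have "i < a" using ab(2) assms(2) by (meson not_le)
  then have "i < n \<and> b \<le> n - 1 - i" using ab(1) by linarith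
  then show "i < n" "m (n - 1 - i) = 0" using ab(3) by auto
qed

text \<open>Duality of staircases exchanges the two parts; it saves half of the cases below.\<close>

lemma vec_flip: "vec n N P = map uminus (rev (vec n P N))"
  by (auto simp: vec_def rev_map rev_nth intro!: nth_equalityI)

lemma mset_vec_flip:
  assumes "mset (vec n P N) = mset (vec n P' N')"
  shows "mset (vec n N P) = mset (vec n N' P')"
  unfolding vec_flip[of n N P] vec_flip[of n N' P'] using assms by simp

lemma mset_vec_swap:
  assumes "P' = P(c := P t, t := P c)" "c < n" "t < n" "N (n - 1 - c) = 0" "N (n - 1 - t) = 0"
  shows "mset (vec n P' N) = mset (vec n P N)"
proof -
  let ?f = "\<lambda>k. P k - N (n - 1 - k)"
  have "(\<lambda>k. P' k - N (n - 1 - k)) = ?f(c := ?f t, t := ?f c)" using assms by (auto simp: fun_eq_iff)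
  then show ?thesis unfolding vec_def using mset_map_upt_swap[OF assms(2,3), of ?f] by simp
qed

lemma sorted_stair:
  assumes "is_shape p" "is_shape m"
  shows "sorted_wrt (\<ge>) (stair n p m)"
  unfolding sorted_wrt_iff_nth_less
proof (intro allI impI)
  fix i j assume ij: "i < j" "j < length (stair n p m)"
  then have "p j \<le> p i" "m (n - 1 - i) \<le> m (n - 1 - j)"
    using is_shape_antimono[OF assms(1), of i j] is_shape_antimono[OF assms(2), of "n - 1 - j" "n - 1 - i"]
    by (auto simp: vec_def)
  then show "stair n p m ! j \<le> stair n p m ! i" using ij by (simp add: vec_def)
qed

lemma sort_desc_eqI:
  assumes "mset xs = mset ys" "sorted_wrt (\<ge>) ys"
  shows "sort_desc xs = ys"
proof -
  have "sort xs = rev ys"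
    by (rule properties_for_sort) (use assms in \<open>auto simp: sorted_wrt_rev\<close>)
  then show ?thesis by (simp add: sort_desc_def)
qed

section \<open>Sorting in one square of the evacuation array\<close>

lemma map2_vec:
  "map2 (-) (map2 (+) (vec n P1 N1) (vec n P2 N2)) (vec n P3 N3)
     = vec n (\<lambda>i. P1 i + P2 i - P3 i) (\<lambda>i. N1 i + N2 i - N3 i)"
  by (auto simp: vec_def intro!: nth_equalityI)

text \<open>The rule is plain addition of vectors unless the two steps collide. Addition would then
  put both cells into row \<open>c\<close>, whereas the rule uses the first row \<open>t\<close>
  that is as long as row \<open>c\<close> has become.\<close>

lemma dual_fomin_cases:
  assumes "dual_fomin l k n m False" "is_shape k"
  obtains "\<And>i. m i + l i = k i + n i"
    | c t where "k = n" "k = l \<oplus> Some c" "m = k \<oplus> Some t" "k t = k c"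
proof -
  obtain p q where k: "k = l \<oplus> p" and n: "n = l \<oplus> q" and m: "m = k \<oplus> dual_label l p q False"
    using assms(1) unfolding dual_fomin_def by blast
  show ?thesis
  proof (cases "p = q \<and> p \<noteq> None")
    case True
    then obtain c where c: "p = Some c" "q = Some c" by (cases p) auto
    let ?t = "top_row k (Suc (l c))"
    have kc: "k c = Suc (l c)" using k c by simp
    have "k ?t \<le> k c" using top_row_props(1)[OF assms(2), of "Suc (l c)"] kc by simp
    moreover have "?t \<le> c" using le_top_row_iff[OF assms(2)] kc by simp
    then have "k c \<le> k ?t" by (rule is_shape_antimono[OF assms(2)])
    ultimately have "k ?t = k c" by simp
    moreover have "m = k \<oplus> Some ?t" using m c k by simp
    ultimately show ?thesis using that(2)[of c ?t] k n c by simp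
  next
    case False
    have "m i + l i = k i + n i" for i
    proof (cases "p = q")
      case True
      then show ?thesis using False k n m by simp
    next
      case False
      then have "m = k \<oplus> q" using m by simp
      then show ?thesis using k n by (simp add: add_cell_apply)
    qed
    then show ?thesis using that(1) by blast
  qed
qed

lemma jdt_cases:
  assumes "jdt l k n m"
  obtains "\<And>i. m i + l i = k i + n i"
    | c where "k = n" "k = l \<oplus> Some c" "m = k \<oplus> Some (Suc c)" "l c = l (Suc c)"
proof -
  obtain p q v where k: "k = l \<oplus> p" and n: "n = l \<oplus> q" and m: "m = k \<oplus> v" and v: "jdt_label l p q v"
    using assms unfolding jdt_def by blast
  show ?thesis
  proof (cases "v = q")
    case True
    then show ?thesis using that(1) k n m by (simp add: add_cell_apply)
  next
    case False
    then obtain c where "p = Some c" "q = Some c" "v = Some (Suc c)" "l c = l (Suc c)"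
      using v by (cases p) (auto split: if_splits)
    then show ?thesis using that(2)[of c] k n m by simp
  qed
qed

text \<open>The letters \<open>k\<close>, \<open>n\<close>, \<open>l\<close>, \<open>u\<close> stand
  for the entries \<open>(k, j)\<close>, \<open>(k, j + 1)\<close>, \<open>(k + 1, j)\<close>,
  \<open>(k + 1, j + 1)\<close> of the array. At a collision, adding 2 to row \<open>a\<close>
  differs from adding 1 to each of the rows \<open>a\<close> and \<open>t\<close> by an exchange of
  these rows.\<close>

lemma mset_vec_dual_pos:
  assumes d: "dual_fomin pk pn pl pu False" and c: "mk = mn" "ml = mn" "mu = mn" and f: "fits n pu mu"
    and s: "is_shape pn"
  shows "mset (vec n (\<lambda>i. int (pl i) + int (pn i) - int (pk i)) (\<lambda>i. int (ml i) + int (mn i) - int (mk i)))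
      = mset (stair n pu mu)"
  using d s
proof (cases rule: dual_fomin_cases)
  case 1
  have "(\<lambda>i. int (pl i) + int (pn i) - int (pk i)) = (\<lambda>i. int (pu i))"
  proof
    show "int (pl i) + int (pn i) - int (pk i) = int (pu i)" for i using 1[of i] by linarith
  qed
  then show ?thesis using c by simp
next
  case (2 a t)
  have e: "pn = pk \<oplus> Some a" "pl = pk \<oplus> Some a" "pu = pk \<oplus> Some a \<oplus> Some t" using 2(1-3) by metis+
  have t: "t \<noteq> a \<Longrightarrow> pk t = Suc (pk a)" using 2(4) unfolding e(1) by (simp add: add_cell_apply)
  have pos: "pu a \<noteq> 0" "pu t \<noteq> 0" by (simp_all add: e)
  have "mset (vec n (\<lambda>i. int (pl i) + int (pn i) - int (pk i)) (\<lambda>i. int (mu i))) = mset (stair n pu mu)"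
  proof (rule mset_vec_swap[where c = a and t = t])
    show "(\<lambda>i. int (pl i) + int (pn i) - int (pk i)) = (\<lambda>i. int (pu i))(a := int (pu t), t := int (pu a))"
      unfolding e using t by (auto simp: fun_eq_iff add_cell_apply simp del: add_cell.simps)
  qed (use fits_pos[OF f] pos in auto)
  then show ?thesis using c by simp
qed

lemma mset_vec_dual_neg:
  assumes d: "dual_fomin mu ml mn mk False" and c: "pk = pn" "pl = pn" "pu = pn" and f: "fits n pk mk"
    and s: "is_shape ml"
  shows "mset (vec n (\<lambda>i. int (pl i) + int (pn i) - int (pk i)) (\<lambda>i. int (ml i) + int (mn i) - int (mk i)))
      = mset (stair n pu mu)"
  using d s
proof (cases rule: dual_fomin_cases)
  case 1
  have "(\<lambda>i. int (ml i) + int (mn i) - int (mk i)) = (\<lambda>i. int (mu i))"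
  proof
    show "int (ml i) + int (mn i) - int (mk i) = int (mu i)" for i using 1[of i] by linarith
  qed
  then show ?thesis using c by simp
next
  case (2 a t)
  have e: "mn = mu \<oplus> Some a" "ml = mu \<oplus> Some a" "mk = mu \<oplus> Some a \<oplus> Some t" using 2(1-3) by metis+
  have t: "t \<noteq> a \<Longrightarrow> mu t = Suc (mu a)" using 2(4) unfolding e(2) by (simp add: add_cell_apply)
  have pos: "mk a \<noteq> 0" "mk t \<noteq> 0" by (simp_all add: e)
  have "mset (vec n (\<lambda>i. int (ml i) + int (mn i) - int (mk i)) (\<lambda>i. int (pk i))) = mset (stair n mu pk)"
  proof (rule mset_vec_swap[where c = a and t = t])
    show "(\<lambda>i. int (ml i) + int (mn i) - int (mk i)) = (\<lambda>i. int (mu i))(a := int (mu t), t := int (mu a))"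
      unfolding e using t by (auto simp: fun_eq_iff add_cell_apply simp del: add_cell.simps)
  qed (use fits_pos[OF fits_commute[OF f]] pos in auto)
  from mset_vec_flip[OF this] show ?thesis using c by simp
qed

text \<open>Without a cross, each direction changes at most one part, so that either one part
  undergoes both changes or the sum is already correct. With a cross, the negative part loses a cell
  and the positive part gains one; the sum has its new 1 at the last of the zero entries, the rule
  wants it at the first. Such an entry exists because \<open>pu\<close> and \<open>mu\<close>
  fit.\<close>

lemma mset_vec_dual:
  assumes p: "dual_fomin pk pn pl pu x" and m: "dual_fomin mu ml mn mk x"
    and s: "is_shape pk" "is_shape pn" "is_shape pl" "is_shape pu" "is_shape mk" "is_shape mn" "is_shape ml" "is_shape mu"
    and f: "fits n pk mk" "fits n pu mu"
    and e: "\<not> x \<Longrightarrow> pn = pk \<and> pu = pl \<or> mk = mn \<and> ml = mu" "\<not> x \<Longrightarrow> pl = pk \<and> pu = pn \<or> mk = ml \<and> mn = mu"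
  shows "mset (vec n (\<lambda>i. int (pl i) + int (pn i) - int (pk i)) (\<lambda>i. int (ml i) + int (mn i) - int (mk i)))
      = mset (stair n pu mu)"
proof (cases x)
  case False
  show ?thesis
    using e(1)[OF False]
  proof
    assume c: "pn = pk \<and> pu = pl"
    show ?thesis
      using e(2)[OF False]
    proof
      assume "pl = pk \<and> pu = pn"
      then show ?thesis using c m False f s by (intro mset_vec_dual_neg) auto
    next
      assume "mk = ml \<and> mn = mu"
      then show ?thesis using c by simp
    qed
  next
    assume c: "mk = mn \<and> ml = mu"
    show ?thesis
      using e(2)[OF False]
    proof
      assume "pl = pk \<and> pu = pn"
      then show ?thesis using c by simp
    next
      assume "mk = ml \<and> mn = mu"
      then show ?thesis using c p False f s by (intro mset_vec_dual_pos) auto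
    qed
  qed
next
  case True
  define a b where "a = top_row pk 0" and "b = top_row mu 0"
  have eq: "pn = pk" "pl = pk" "pu = pk \<oplus> Some a" "ml = mu" "mn = mu" "mk = mu \<oplus> Some b"
    using p m True unfolding dual_fomin_def a_def b_def by auto
  have z: "pk i = 0 \<longleftrightarrow> a \<le> i" "mu i = 0 \<longleftrightarrow> b \<le> i" for i
    unfolding a_def b_def using le_top_row_iff[OF s(1), of 0 i] le_top_row_iff[OF s(8), of 0 i] by auto
  obtain u v where uv: "u + v \<le> n" "\<forall>i\<ge>u. pu i = 0" "\<forall>i\<ge>v. mu i = 0"
    using f(2) unfolding fits_def by blast
  have "pu a \<noteq> 0" using eq(3) by simp
  then have "a < u" using uv(2) by (meson not_le)
  moreover have "b \<le> v" using uv(3) z(2) by blast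
  ultimately have ab: "a + b < n" using uv(1) by linarith
  let ?c = "a" and ?d = "n - 1 - b"
  let ?g = "\<lambda>k. int (pu k) - int (mu (n - 1 - k))"
  have gc: "?g ?c = 1" using eq(3) z(1)[of a] z(2)[of "n - 1 - a"] ab by simp
  have nd: "n - 1 - (n - 1 - k) = k" if "k < n" for k using that by simp
  have "(\<lambda>k. (int (pl k) + int (pn k) - int (pk k)) - (int (ml (n - 1 - k)) + int (mn (n - 1 - k)) - int (mk (n - 1 - k)))) k
     = (?g(?c := ?g ?d, ?d := ?g ?c)) k" if "k < n" for k
  proof -
    have iff: "n - 1 - k = b \<longleftrightarrow> k = n - 1 - b" using that ab by auto
    have p0: "pk (n - 1 - b) = 0" unfolding z(1) using ab by simp
    have m0: "mu (n - 1 - a) = 0" unfolding z(2) using ab by simp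
    have b0: "mu b = 0" "pk a = 0" using z by auto
    have nb: "n - Suc (n - Suc b) = b" using ab by simp
    show ?thesis
      using iff p0 m0 b0 gc unfolding eq by (auto simp: add_cell_apply nd nb)
  qed
  then have "vec n (\<lambda>i. int (pl i) + int (pn i) - int (pk i)) (\<lambda>i. int (ml i) + int (mn i) - int (mk i))
      = map (?g(?c := ?g ?d, ?d := ?g ?c)) [0..<n]"
    unfolding vec_def by (intro map_cong) auto
  moreover have "mset (map (?g(?c := ?g ?d, ?d := ?g ?c)) [0..<n]) = mset (map ?g [0..<n])"
    by (rule mset_map_upt_swap) (use ab in auto)
  ultimately show ?thesis unfolding vec_def by (simp only:)
qed

text \<open>Here the positive part shrinks with \<open>j\<close> and grows with \<open>k\<close>; so
  \<open>pn\<close> is the smallest corner and \<open>pl\<close> the largest. Only a vertical domino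
  requires sorting: its two rows are equal in \<open>pn\<close> and exchange the added cell.\<close>

lemma mset_vec_jdt_pos:
  assumes d: "jdt pn pk pu pl" and c: "mk = mn" "ml = mn" "mu = mn" and f: "fits n pl ml"
  shows "mset (vec n (\<lambda>i. int (pl i) + int (pn i) - int (pk i)) (\<lambda>i. int (ml i) + int (mn i) - int (mk i)))
      = mset (stair n pu mu)"
  using d
proof (cases rule: jdt_cases)
  case 1
  have "(\<lambda>i. int (pl i) + int (pn i) - int (pk i)) = (\<lambda>i. int (pu i))"
  proof
    show "int (pl i) + int (pn i) - int (pk i) = int (pu i)" for i using 1[of i] by linarith
  qed
  then show ?thesis using c by simp
next
  case (2 a)
  have e: "pk = pn \<oplus> Some a" "pu = pn \<oplus> Some a" "pl = pn \<oplus> Some a \<oplus> Some (Suc a)" using 2(1-3) by metis+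
  have pos: "pl a \<noteq> 0" "pl (Suc a) \<noteq> 0" by (simp_all add: e)
  have "mset (vec n (\<lambda>i. int (pl i) + int (pn i) - int (pk i)) (\<lambda>i. int (mu i))) = mset (stair n pu mu)"
  proof (rule mset_vec_swap[where c = a and t = "Suc a"])
    show "(\<lambda>i. int (pl i) + int (pn i) - int (pk i)) = (\<lambda>i. int (pu i))(a := int (pu (Suc a)), Suc a := int (pu a))"
      unfolding e using 2(4) by (auto simp: fun_eq_iff add_cell_apply simp del: add_cell.simps)
  qed (use fits_pos[OF f] pos c in auto)
  then show ?thesis using c by simp
qed

lemma mset_vec_jdt:
  assumes p: "jdt pn pk pu pl" and m: "jdt ml mk mu mn"
    and f: "fits n pl ml" "fits n pn mn"
    and e: "pn = pk \<and> pu = pl \<or> mk = mn \<and> ml = mu" "pl = pk \<and> pu = pn \<or> mk = ml \<and> mn = mu"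
  shows "mset (vec n (\<lambda>i. int (pl i) + int (pn i) - int (pk i)) (\<lambda>i. int (ml i) + int (mn i) - int (mk i)))
      = mset (stair n pu mu)"
  using e(1)
proof
  assume c: "pn = pk \<and> pu = pl"
  show ?thesis
    using e(2)
  proof
    assume "pl = pk \<and> pu = pn"
    then have "mset (vec n (\<lambda>i. int (mn i) + int (ml i) - int (mk i)) (\<lambda>i. int (pn i) + int (pl i) - int (pk i)))
      = mset (stair n mu pu)" by (intro mset_vec_jdt_pos) (use c m fits_commute[OF f(2)] in auto)
    from mset_vec_flip[OF this] show ?thesis by (simp add: add.commute)
  next
    assume "mk = ml \<and> mn = mu"
    then show ?thesis using c by simp
  qed
next
  assume c: "mk = mn \<and> ml = mu"
  show ?thesis
    using e(2)
  proof
    assume "pl = pk \<and> pu = pn"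
    then show ?thesis using c by simp
  next
    assume "mk = ml \<and> mn = mu"
    then show ?thesis using c p f by (intro mset_vec_jdt_pos) auto
  qed
qed

section \<open>Lines without crosses, and the four kinds of squares\<close>

lemma rsk_skip_right:
  assumes "partial_bij X" "distinct (c # cs)" "distinct rs" "\<And>r. r \<in> set rs \<Longrightarrow> \<not> X c r"
  shows "rsk X (c # cs) rs = rsk X cs rs"
proof -
  have "c \<notin> set cs" "distinct cs" using assms(2) by auto
  then obtain p where "rsk X (c # cs) rs = rsk X cs rs \<oplus> p" "(\<forall>r \<in> set rs. \<not> X c r) \<longrightarrow> p = None"
    using rsk_fomin_aux[OF assms(1), of cs rs] assms(3) by blast
  then show ?thesis using assms(4) by simp
qed

lemma rsk_skip_left:
  assumes "partial_bij X" "distinct (cs @ [c])" "distinct rs" "\<And>r. r \<in> set rs \<Longrightarrow> \<not> X c r"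
  shows "rsk X (cs @ [c]) rs = rsk X cs rs"
  using rsk_skip_right[of X c "rev cs" "rev rs"] assms
    rsk_rotate[OF assms(1), of "cs @ [c]" rs] rsk_rotate[OF assms(1), of cs rs] by simp

lemma rsk_skip_up:
  assumes "partial_bij X" "distinct cs" "distinct (r # rs)" "\<And>c. c \<in> set cs \<Longrightarrow> \<not> X c r"
  shows "rsk X cs (r # rs) = rsk X cs rs"
  using rsk_skip_right[OF partial_bij_transpose[OF assms(1)] assms(3,2,4)]
  by (simp only: rsk_transpose[of X])

lemma rsk_skip_down:
  assumes "partial_bij X" "distinct cs" "distinct (rs @ [r])" "\<And>c. c \<in> set cs \<Longrightarrow> \<not> X c r"
  shows "rsk X cs (rs @ [r]) = rsk X cs rs"
  using rsk_skip_left[OF partial_bij_transpose[OF assms(1)] assms(3,2,4)]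
  by (simp only: rsk_transpose[of X])

context
  fixes X :: "'a \<Rightarrow> 'b \<Rightarrow> bool"
  assumes bij: "partial_bij X"
begin

text \<open>In the following four lemmas, the row lists \<open>rs\<close> and \<open>rs'\<close> and the column lists \<open>cs\<close> and \<open>cs'\<close>
  belong to the positive and the negative part, respectively.\<close>

lemma square_column_in_row_out:
  assumes d: "distinct (c # cs)" "distinct (rs @ [r])" "distinct (cs' @ [c])" "distinct (r # rs')"
      "set rs \<inter> set (r # rs') = {}" "set cs \<inter> set (cs' @ [c]) = {}"
    and f: "fits n (rsk X cs rs) (rsk X (cs' @ [c]) (r # rs'))"
      "fits n (rsk X (c # cs) (rs @ [r])) (rsk X cs' rs')"
  shows "mset (vec n
      (\<lambda>i. int (rsk X cs (rs @ [r]) i) + int (rsk X (c # cs) rs i) - int (rsk X cs rs i))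
      (\<lambda>i. int (rsk X (cs' @ [c]) rs' i) + int (rsk X cs' (r # rs') i) - int (rsk X (cs' @ [c]) (r # rs') i)))
    = mset (stair n (rsk X (c # cs) (rs @ [r])) (rsk X cs' rs'))"
proof (rule mset_vec_dual)
  show "dual_fomin (rsk X cs rs) (rsk X (c # cs) rs) (rsk X cs (rs @ [r]))
      (rsk X (c # cs) (rs @ [r])) (X c r)"
    by (rule rsk_right_down[OF bij d(1,2)])
  show "dual_fomin (rsk X cs' rs') (rsk X (cs' @ [c]) rs') (rsk X cs' (r # rs'))
      (rsk X (cs' @ [c]) (r # rs')) (X c r)"
    by (rule rsk_left_up[OF bij d(3,4)])
  assume x: "\<not> X c r"
  show "rsk X (c # cs) rs = rsk X cs rs \<and> rsk X (c # cs) (rs @ [r]) = rsk X cs (rs @ [r]) \<or>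
    rsk X (cs' @ [c]) (r # rs') = rsk X cs' (r # rs') \<and> rsk X (cs' @ [c]) rs' = rsk X cs' rs'"
  \<comment> \<open>Column \<open>c\<close> has at most one cross. If it lies in a row of the
    positive part, then \<open>c\<close> does not change the negative part; otherwise it does not
    change the positive part.\<close>
  proof (cases "\<exists>z \<in> set rs. X c z")
    case True
    then have "\<not> X c z" if "z \<in> set (r # rs')" for z
      using bij d(5) that unfolding partial_bij_def by blast
    then show ?thesis by (intro disjI2 conjI rsk_skip_left[OF bij]) (use d in auto)
  next
    case False
    then show ?thesis by (intro disjI1 conjI rsk_skip_right[OF bij]) (use d x in auto)
  qed
  show "rsk X cs (rs @ [r]) = rsk X cs rs \<and> rsk X (c # cs) (rs @ [r]) = rsk X (c # cs) rs \<or>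
    rsk X (cs' @ [c]) (r # rs') = rsk X (cs' @ [c]) rs' \<and> rsk X cs' (r # rs') = rsk X cs' rs'"
  proof (cases "\<exists>z \<in> set cs. X z r")
    case True
    then have "\<not> X z r" if "z \<in> set (cs' @ [c])" for z
      using bij d(6) that unfolding partial_bij_def by blast
    then show ?thesis by (intro disjI2 conjI rsk_skip_up[OF bij]) (use d in auto)
  next
    case False
    then show ?thesis by (intro disjI1 conjI rsk_skip_down[OF bij]) (use d x in auto)
  qed
qed (use d f in \<open>auto intro!: is_shape_rsk[OF bij]\<close>)

lemma square_row_out_column_out:
  assumes d: "distinct (cs @ [c])" "distinct (r # rs)" "distinct (c # cs')" "distinct (rs' @ [r])"
      "set rs' \<inter> set (r # rs) = {}" "set cs' \<inter> set (cs @ [c]) = {}"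
    and f: "fits n (rsk X (cs @ [c]) (r # rs)) (rsk X cs' rs')"
      "fits n (rsk X cs rs) (rsk X (c # cs') (rs' @ [r]))"
  shows "mset (vec n
      (\<lambda>i. int (rsk X cs (r # rs) i) + int (rsk X (cs @ [c]) rs i) - int (rsk X (cs @ [c]) (r # rs) i))
      (\<lambda>i. int (rsk X (c # cs') rs' i) + int (rsk X cs' (rs' @ [r]) i) - int (rsk X cs' rs' i)))
    = mset (stair n (rsk X cs rs) (rsk X (c # cs') (rs' @ [r])))"
  using mset_vec_flip[OF square_column_in_row_out[OF d(3,4,1,2,5,6) fits_commute[OF f(1)] fits_commute[OF f(2)]]]
  by (simp add: add.commute)

lemma square_rows:
  assumes d: "distinct cs" "distinct (t # rs @ [d])" "distinct cs'" "distinct (d # rs' @ [t])"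
      "set cs \<inter> set cs' = {}"
    and f: "fits n (rsk X cs (t # rs @ [d])) (rsk X cs' rs')"
      "fits n (rsk X cs rs) (rsk X cs' (d # rs' @ [t]))"
  shows "mset (vec n
      (\<lambda>i. int (rsk X cs (t # rs @ [d]) i) + int (rsk X cs rs i) - int (rsk X cs (t # rs) i))
      (\<lambda>i. int (rsk X cs' rs' i) + int (rsk X cs' (d # rs' @ [t]) i) - int (rsk X cs' (d # rs') i)))
    = mset (stair n (rsk X cs (rs @ [d])) (rsk X cs' (rs' @ [t])))"
proof (rule mset_vec_jdt)
  show "jdt (rsk X cs rs) (rsk X cs (t # rs)) (rsk X cs (rs @ [d])) (rsk X cs (t # rs @ [d]))"
    by (rule rsk_up_down[OF bij d(1,2)])
  show "jdt (rsk X cs' rs') (rsk X cs' (d # rs')) (rsk X cs' (rs' @ [t])) (rsk X cs' (d # rs' @ [t]))"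
    by (rule rsk_up_down[OF bij d(3,4)])
  have d': "distinct (rs @ [d])" "distinct (t # rs)" "distinct (rs' @ [t])" "distinct (d # rs')"
      "distinct ((t # rs) @ [d])" "distinct ((d # rs') @ [t])"
    using d by auto
  have ex: "(\<forall>z \<in> set cs. \<not> X z y) \<or> (\<forall>z \<in> set cs'. \<not> X z y)" for y
    using bij d(5) unfolding partial_bij_def by blast
  show "rsk X cs rs = rsk X cs (t # rs) \<and> rsk X cs (rs @ [d]) = rsk X cs (t # rs @ [d]) \<or>
    rsk X cs' (d # rs') = rsk X cs' (d # rs' @ [t]) \<and> rsk X cs' rs' = rsk X cs' (rs' @ [t])"
    using ex[of t] rsk_skip_up[OF bij d(1) d'(2)] rsk_skip_up[OF bij d(1), of t "rs @ [d]"]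
      rsk_skip_down[OF bij d(3) d'(3)] rsk_skip_down[OF bij d(3) d'(6)] d by auto
  show "rsk X cs (t # rs @ [d]) = rsk X cs (t # rs) \<and> rsk X cs (rs @ [d]) = rsk X cs rs \<or>
    rsk X cs' (d # rs') = rsk X cs' rs' \<and> rsk X cs' (d # rs' @ [t]) = rsk X cs' (rs' @ [t])"
    using ex[of d] rsk_skip_up[OF bij d(3) d'(4)] rsk_skip_up[OF bij d(3), of d "rs' @ [t]"]
      rsk_skip_down[OF bij d(1) d'(1)] rsk_skip_down[OF bij d(1) d'(5)] d by auto
qed (use f in auto)

lemma square_columns:
  assumes d: "distinct (t # cs @ [d])" "distinct rs" "distinct (d # cs' @ [t])" "distinct rs'"
      "set rs \<inter> set rs' = {}"
    and f: "fits n (rsk X (t # cs @ [d]) rs) (rsk X cs' rs')"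
      "fits n (rsk X cs rs) (rsk X (d # cs' @ [t]) rs')"
  shows "mset (vec n
      (\<lambda>i. int (rsk X cs rs i) + int (rsk X (t # cs @ [d]) rs i) - int (rsk X (cs @ [d]) rs i))
      (\<lambda>i. int (rsk X (d # cs' @ [t]) rs' i) + int (rsk X cs' rs' i) - int (rsk X (cs' @ [t]) rs' i)))
    = mset (stair n (rsk X (t # cs) rs) (rsk X (d # cs') rs'))"
proof (rule mset_vec_flip, rule mset_vec_jdt)
  show "jdt (rsk X cs rs) (rsk X (cs @ [d]) rs) (rsk X (t # cs) rs) (rsk X (t # cs @ [d]) rs)"
    by (rule jdt_swap[OF rsk_left_right[OF bij d(1,2)]])
  show "jdt (rsk X cs' rs') (rsk X (cs' @ [t]) rs') (rsk X (d # cs') rs') (rsk X (d # cs' @ [t]) rs')"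
    by (rule jdt_swap[OF rsk_left_right[OF bij d(3,4)]])
  have d': "distinct (cs @ [d])" "distinct (t # cs)" "distinct (cs' @ [t])" "distinct (d # cs')"
      "distinct ((t # cs) @ [d])" "distinct ((d # cs') @ [t])"
    using d by auto
  have ex: "(\<forall>z \<in> set rs. \<not> X y z) \<or> (\<forall>z \<in> set rs'. \<not> X y z)" for y
    using bij d(5) unfolding partial_bij_def by blast
  show "rsk X cs' rs' = rsk X (cs' @ [t]) rs' \<and> rsk X (d # cs') rs' = rsk X (d # cs' @ [t]) rs' \<or>
    rsk X (cs @ [d]) rs = rsk X (t # cs @ [d]) rs \<and> rsk X cs rs = rsk X (t # cs) rs"
    using ex[of t] rsk_skip_right[OF bij d'(2) d(2)] rsk_skip_right[OF bij, of t "cs @ [d]" rs]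
      rsk_skip_left[OF bij d'(3) d(4)] rsk_skip_left[OF bij d'(6) d(4)] d by auto
  show "rsk X (d # cs' @ [t]) rs' = rsk X (cs' @ [t]) rs' \<and> rsk X (d # cs') rs' = rsk X cs' rs' \<or>
    rsk X (cs @ [d]) rs = rsk X cs rs \<and> rsk X (t # cs @ [d]) rs = rsk X (t # cs) rs"
    using ex[of d] rsk_skip_right[OF bij d'(4) d(4)] rsk_skip_right[OF bij, of d "cs' @ [t]" rs']
      rsk_skip_left[OF bij d'(1) d(2)] rsk_skip_left[OF bij d'(5) d(2)] d by auto
qed (use fits_commute[OF f(1)] fits_commute[OF f(2)] in auto)

end

section \<open>The evacuation array\<close>

text \<open>The order of the rows does not matter for one column. This justifies the entry that the
  array copies from the row above, where the cyclic order of the rows moves on.\<close>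

lemma rsk_single_column:
  assumes "partial_bij X" "distinct rs"
  shows "rsk X [c] rs = (\<lambda>_. 0) \<oplus> (if \<exists>r \<in> set rs. X c r then Some 0 else None)"
  using assms(2)
proof (induction rs)
  case (Cons r rs)
  have f: "fomin (\<lambda>_. 0) (rsk X [c] rs) (\<lambda>_. 0) (rsk X [c] (r # rs)) (X c r)"
    using rsk_right_up[OF assms(1), of c "[]" r rs] Cons.prems by simp
  have "\<not> (\<exists>r' \<in> set rs. X c r')" if "X c r"
    using that Cons.prems assms(1) unfolding partial_bij_def by auto
  then have "fomin (\<lambda>_. 0) (rsk X [c] rs) (\<lambda>_. 0)
      ((\<lambda>_. 0) \<oplus> (if \<exists>r \<in> set (r # rs). X c r then Some 0 else None)) (X c r)"
    unfolding fomin_def using Cons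
    by (intro exI[of _ "if \<exists>r \<in> set rs. X c r then Some 0 else None"] exI[of _ None]) auto
  then show ?case using f fomin_functional by blast
qed simp

context staircase_path
begin

lemma is_shape_pos_shape:
  assumes "Suc k div 2 \<le> j div 2" shows "is_shape (pos_shape k j)"
  unfolding pos_shape_def by (rule is_shape_rsk[OF partial_bij_X]) (use assms in auto)

lemma is_shape_neg_shape:
  assumes "Suc k div 2 \<le> j div 2" shows "is_shape (neg_shape k j)"
  unfolding neg_shape_def by (rule is_shape_rsk[OF partial_bij_X]) (use assms in auto)

text \<open>The number of rows of a shape is bounded by the rows and by the columns of its matrix.
  Counting columns for the positive part and rows for the negative one gives \<open>j - k\<close> in
  total.\<close>

lemma fits_pos_neg_shape:
  assumes "Suc k div 2 \<le> j div 2" "j - k \<le> n"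
  shows "fits n (pos_shape k j) (neg_shape k j)"
  unfolding fits_def
proof (intro exI conjI allI impI)
  have half: "x div 2 + Suc x div 2 = x" for x :: nat by presburger
  have "k div 2 \<le> Suc k div 2" "j div 2 \<le> Suc j div 2" by (simp_all add: div_le_mono)
  then show "(Suc j div 2 - k div 2) + (j div 2 - Suc k div 2) \<le> n"
    using assms half[of j] half[of k] by linarith
  show "pos_shape k j i = 0" if "Suc j div 2 - k div 2 \<le> i" for i
    unfolding pos_shape_def by (rule rsk_columns_bound[OF partial_bij_X]) (use assms(1) that in \<open>auto simp del: upt_Suc\<close>)
  show "neg_shape k j i = 0" if "j div 2 - Suc k div 2 \<le> i" for i
    unfolding neg_shape_def by (rule rsk_rows_bound[OF partial_bij_X]) (use assms(1) that in \<open>auto simp del: upt_Suc\<close>)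
qed

text \<open>If \<open>k\<close> and \<open>j\<close> have equal parity, a row and a column change
  sides and the dual rule applies. Otherwise two rows or two columns change sides, at opposite ends
  of the lists, and jeu de taquin applies.\<close>

lemma square:
  assumes k: "even k \<Longrightarrow> k + 2 \<le> j" "odd k \<Longrightarrow> k + 1 \<le> j" and j: "Suc j \<le> 2 * E"
    and f: "fits n (pos_shape k j) (neg_shape k j)" "fits n (pos_shape (Suc k) (Suc j)) (neg_shape (Suc k) (Suc j))"
      "fits n (pos_shape (Suc k) j) (neg_shape (Suc k) j)" "fits n (pos_shape k (Suc j)) (neg_shape k (Suc j))"
  shows "mset (vec n
      (\<lambda>i. int (pos_shape (Suc k) j i) + int (pos_shape k (Suc j) i) - int (pos_shape k j i))
      (\<lambda>i. int (neg_shape (Suc k) j i) + int (neg_shape k (Suc j) i) - int (neg_shape k j i)))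
    = mset (stair n (pos_shape (Suc k) (Suc j)) (neg_shape (Suc k) (Suc j)))"
proof -
  define i b where ib: "i = k div 2" "b = j div 2"
  have "k div 2 < j div 2"
  proof (cases "even k")
    case True
    then have "k + 2 \<le> j" using k by simp
    then show ?thesis by linarith
  next
    case False
    then have "k + 1 \<le> j" using k by simp
    then show ?thesis using False by presburger
  qed
  moreover have "j div 2 < E" using j by linarith
  ultimately have bounds: "i < b" "b < E" unfolding ib by blast+
  have u: "[Suc i..<Suc b] = Suc i # [Suc (Suc i)..<Suc b]"
      "[Suc i..<Suc (Suc b)] = Suc i # [Suc (Suc i)..<Suc (Suc b)]"
      "[Suc b..<Suc E] = Suc b # [Suc (Suc b)..<Suc E]"
    using bounds by (simp_all add: upt_conv_Cons del: upt_Suc)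
  have v: "[Suc (Suc i)..<Suc (Suc b)] = [Suc (Suc i)..<Suc b] @ [Suc b]"
      "[1..<Suc (Suc i)] = [1..<Suc i] @ [Suc i]"
    using bounds by simp_all
  note defs = pos_shape_def neg_shape_def
  consider (ee) "k = 2 * i" "j = 2 * b" | (eo) "k = 2 * i" "j = Suc (2 * b)"
    | (oe) "k = Suc (2 * i)" "j = 2 * b" | (oo) "k = Suc (2 * i)" "j = Suc (2 * b)"
    unfolding ib by (metis even_two_times_div_two odd_two_times_div_two_succ Suc_eq_plus1)
  then show ?thesis
  proof cases
    case ee
    have "distinct (Suc b # rev [Suc i..<Suc b])"
      "distinct (([Suc b..<Suc E] @ [1..<Suc i]) @ [Suc i])"
      "distinct (rev ([Suc (Suc b)..<Suc E] @ [1..<Suc i]) @ [Suc b])"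
      "distinct (Suc i # [Suc (Suc i)..<Suc b])"
      "set ([Suc b..<Suc E] @ [1..<Suc i]) \<inter> set (Suc i # [Suc (Suc i)..<Suc b]) = {}"
      "set (rev [Suc i..<Suc b]) \<inter> set (rev ([Suc (Suc b)..<Suc E] @ [1..<Suc i]) @ [Suc b]) = {}"
      using bounds by (auto simp del: upt_Suc One_nat_def)
    from square_column_in_row_out[OF partial_bij_X this]
    show ?thesis
      using f unfolding ee defs by (simp add: u v del: upt_Suc One_nat_def)
  next
    case eo
    have "distinct (rev [Suc i..<Suc (Suc b)])"
      "distinct (Suc b # ([Suc (Suc b)..<Suc E] @ [1..<Suc i]) @ [Suc i])"
      "distinct (rev ([Suc (Suc b)..<Suc E] @ [1..<Suc i]))"
      "distinct (Suc i # [Suc (Suc i)..<Suc b] @ [Suc b])"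
      "set (rev [Suc i..<Suc (Suc b)]) \<inter> set (rev ([Suc (Suc b)..<Suc E] @ [1..<Suc i])) = {}"
      using bounds by (auto simp del: upt_Suc One_nat_def)
    from square_rows[OF partial_bij_X this]
    show ?thesis
      using f unfolding eo defs by (simp add: u v del: upt_Suc One_nat_def)
  next
    case oe
    have "distinct (Suc b # rev [Suc (Suc i)..<Suc b] @ [Suc i])"
      "distinct ([Suc b..<Suc E] @ [1..<Suc (Suc i)])"
      "distinct (Suc i # rev ([Suc (Suc b)..<Suc E] @ [1..<Suc i]) @ [Suc b])"
      "distinct ([Suc (Suc i)..<Suc b])"
      "set ([Suc b..<Suc E] @ [1..<Suc (Suc i)]) \<inter> set ([Suc (Suc i)..<Suc b]) = {}"
      using bounds by (auto simp del: upt_Suc One_nat_def)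
    from square_columns[OF partial_bij_X this]
    show ?thesis
      using f unfolding oe defs by (simp add: u v del: upt_Suc One_nat_def)
  next
    case oo
    have "distinct (rev [Suc (Suc i)..<Suc (Suc b)] @ [Suc i])"
      "distinct (Suc b # [Suc (Suc b)..<Suc E] @ [1..<Suc (Suc i)])"
      "distinct (Suc i # rev ([Suc (Suc b)..<Suc E] @ [1..<Suc i]))"
      "distinct ([Suc (Suc i)..<Suc b] @ [Suc b])"
      "set ([Suc (Suc i)..<Suc b]) \<inter> set (Suc b # [Suc (Suc b)..<Suc E] @ [1..<Suc (Suc i)]) = {}"
      "set (rev ([Suc (Suc b)..<Suc E] @ [1..<Suc i])) \<inter> set (rev [Suc (Suc i)..<Suc (Suc b)] @ [Suc i]) = {}"
      using bounds by (auto simp del: upt_Suc One_nat_def)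
    from square_row_out_column_out[OF partial_bij_X this]
    show ?thesis
      using f unfolding oo defs by (simp add: u v del: upt_Suc One_nat_def)
  qed
qed

text \<open>The first proper column of row \<open>k\<close> of the array is
  \<open>k + k mod 2\<close>.\<close>

lemma evac_array_eq:
  assumes A: "\<And>j. j \<le> 2 * r \<Longrightarrow> A ! j = stair n (row_fun (p j)) (row_fun (m j))"
    and A_fits: "\<And>j. j \<le> 2 * r \<Longrightarrow> fits n (row_fun (p j)) (row_fun (m j))"
    and r: "r \<le> E" "2 * r \<le> Suc n"
  shows "k + k mod 2 \<le> j \<Longrightarrow> j \<le> 2 * r \<Longrightarrow> evac_array n A k j = stair n (pos_shape k j) (neg_shape k j)"
proof (induction k arbitrary: j)
  case 0
  then show ?case using A[of j] pos_shape_0[of j] neg_shape_0[of j] r by simp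
next
  case (Suc k)
  have fits: "fits n (pos_shape k j) (neg_shape k j)" if "k + k mod 2 \<le> j" "j \<le> 2 * r" for k j
  proof (cases "k = 0")
    case True
    then show ?thesis using A_fits[of j] that pos_shape_0[of j] neg_shape_0[of j] r by simp
  next
    \<comment> \<open>The bound on \<open>r\<close> enters here: from row 1 on, both parts together
      have at most \<open>j - k \<le> 2 * r - 1 \<le> n\<close> rows. In row 0 the given staircases
      provide the room.\<close>
    case False
    have "Suc k div 2 \<le> j div 2" using that(1) by presburger
    moreover have "j - k \<le> n" using that(2) r(2) False by linarith
    ultimately show ?thesis by (rule fits_pos_neg_shape)
  qed
  define s where "s = Suc k + Suc k mod 2"
  have step: "evac_array n A (Suc k) (Suc j) = stair n (pos_shape (Suc k) (Suc j)) (neg_shape (Suc k) (Suc j))"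
    if "evac_array n A (Suc k) j = stair n (pos_shape (Suc k) j) (neg_shape (Suc k) j)" "s \<le> j" "Suc j \<le> 2 * r" for j
  proof -
    have kj: "even k \<Longrightarrow> k + 2 \<le> j" "odd k \<Longrightarrow> k + 1 \<le> j" "k + k mod 2 \<le> j" "Suc k + Suc k mod 2 \<le> j"
      using that(2) unfolding s_def by (auto simp: mod_Suc odd_iff_mod_2_eq_one even_iff_mod_2_eq_zero split: if_splits)
    have "evac_array n A (Suc k) (Suc j) = sort_desc (map2 (-) (map2 (+) (stair n (pos_shape (Suc k) j) (neg_shape (Suc k) j))
        (stair n (pos_shape k (Suc j)) (neg_shape k (Suc j)))) (stair n (pos_shape k j) (neg_shape k j)))"
      using that kj Suc.IH by auto
    also have "\<dots> = stair n (pos_shape (Suc k) (Suc j)) (neg_shape (Suc k) (Suc j))"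
      unfolding map2_vec
    proof (rule sort_desc_eqI)
      show "mset (vec n
          (\<lambda>i. int (pos_shape (Suc k) j i) + int (pos_shape k (Suc j) i) - int (pos_shape k j i))
          (\<lambda>i. int (neg_shape (Suc k) j i) + int (neg_shape k (Suc j) i) - int (neg_shape k j i)))
        = mset (stair n (pos_shape (Suc k) (Suc j)) (neg_shape (Suc k) (Suc j)))"
        by (rule square) (use kj that r in \<open>auto intro!: fits\<close>)
      have "Suc (Suc k) div 2 \<le> Suc j div 2" using kj by linarith
      then show "sorted_wrt (\<ge>) (stair n (pos_shape (Suc k) (Suc j)) (neg_shape (Suc k) (Suc j)))"
        by (intro sorted_stair is_shape_pos_shape is_shape_neg_shape)
    qed
    finally show ?thesis .
  qed
  have base: "evac_array n A (Suc k) s = stair n (pos_shape (Suc k) s) (neg_shape (Suc k) s)" if "s \<le> 2 * r"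
  proof (cases "even k")
    case True
    then obtain i where i: "k = 2 * i" by blast
    then have s: "s = Suc (Suc k)" by (simp add: s_def mod_Suc)
    have "i < E" using s i that r by simp
    \<comment> \<open>The copied entry involves one column against all rows; from row
      \<open>k\<close> to the next, row \<open>Suc i\<close> moves from the top of the list to its
      bottom.\<close>
    then have sets: "set ([Suc i..<Suc E] @ [1..<Suc i]) = {1..<Suc E}"
        "set ([Suc (Suc i)..<Suc E] @ [1..<Suc (Suc i)]) = {1..<Suc E}" by auto
    have "pos_shape k (Suc k) = rsk X [Suc i] ([Suc i..<Suc E] @ [1..<Suc i])"
      "pos_shape (Suc k) s = rsk X [Suc i] ([Suc (Suc i)..<Suc E] @ [1..<Suc (Suc i)])"
      unfolding pos_shape_def i s by (simp_all)
    then have "pos_shape k (Suc k) = pos_shape (Suc k) s"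
      using rsk_single_column[OF partial_bij_X, of "[Suc i..<Suc E] @ [1..<Suc i]" "Suc i"]
        rsk_single_column[OF partial_bij_X, of "[Suc (Suc i)..<Suc E] @ [1..<Suc (Suc i)]" "Suc i"] sets
      by (simp del: upt_Suc)
    moreover have "neg_shape k (Suc k) = neg_shape (Suc k) s"
      unfolding neg_shape_def i s by simp
    moreover have "evac_array n A (Suc k) s = evac_array n A k (Suc k)" using True s by simp
    ultimately show ?thesis using Suc.IH[of "Suc k"] True s that by (simp add: even_iff_mod_2_eq_zero)
  next
    case False
    then have s: "s = Suc k" by (simp add: s_def mod_Suc odd_iff_mod_2_eq_one)
    obtain i where i: "k = Suc (2 * i)" using False by (metis oddE Suc_eq_plus1)
    have "pos_shape (Suc k) s = (\<lambda>_. 0)" "neg_shape (Suc k) s = (\<lambda>_. 0)"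
      unfolding pos_shape_def neg_shape_def i s by simp_all
    moreover have "vec n (\<lambda>_. 0) (\<lambda>_. 0) = replicate n 0" by (simp add: vec_def map_replicate_trivial)
    ultimately show ?thesis using False s by simp
  qed
  have "s \<le> j" using Suc.prems s_def by simp
  then show ?case using Suc.prems(2)
    by (induction rule: dec_induct) (use base step in auto)
qed

end

section \<open>Growth diagrams of the evacuated tableau\<close>

lemma neg_part_eq_pos_part: "neg_part v = pos_part (map uminus (rev v))"
  by (simp add: neg_part_def pos_part_def filter_map comp_def rev_map rev_filter)

lemma pos_part_stair:
  assumes "fits n p m" "is_shape p"
  shows "pos_part (stair n p m) = part_of p"
proof -
  define l where "l = top_row p 0"
  have l: "p k \<noteq> 0 \<longleftrightarrow> k < l" for k
    using le_top_row_iff[OF assms(2), of 0 k] by (auto simp: l_def not_le)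
  have "l \<le> n"
  proof (cases l)
    case (Suc l')
    then show ?thesis using fits_pos(1)[OF assms(1), of l'] l[of l'] by simp
  qed simp
  let ?f = "\<lambda>k. int (p k) - int (m (n - 1 - k))"
  have "stair n p m = map ?f [0..<l] @ map ?f [l..<n]"
    unfolding vec_def map_append[symmetric] using \<open>l \<le> n\<close> by (metis le0 upt_add_eq_append le_add_diff_inverse)
  moreover have "map ?f [0..<l] = map (\<lambda>k. int (p k)) [0..<l]"
  proof (rule map_cong[OF refl])
    fix k assume "k \<in> set [0..<l]"
    then have "p k \<noteq> 0" using l[of k] by simp
    from fits_pos(2)[OF assms(1) this] show "?f k = int (p k)" by simp
  qed
  moreover have "\<not> 0 < ?f k" if "k \<in> set [l..<n]" for k
    using that l[of k] by simp
  then have "filter (\<lambda>x. 0 < x) (map ?f [l..<n]) = []"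
    unfolding filter_empty_conv by (simp only: set_map) blast
  moreover have "0 < int (p k)" if "k \<in> set [0..<l]" for k
    using that l[of k] by simp
  then have "filter (\<lambda>x. 0 < x) (map (\<lambda>k. int (p k)) [0..<l]) = map (\<lambda>k. int (p k)) [0..<l]"
    unfolding filter_id_conv by (simp only: set_map) blast
  ultimately have "pos_part (stair n p m) = map nat (map (\<lambda>k. int (p k)) [0..<l])"
    unfolding pos_part_def by (simp only: filter_append append_Nil2)
  then show ?thesis by (simp add: part_of_def l_def comp_def)
qed

lemma neg_part_stair:
  assumes "fits n p m" "is_shape m"
  shows "neg_part (stair n p m) = part_of m"
  unfolding neg_part_eq_pos_part vec_flip[symmetric]
  by (rule pos_part_stair[OF fits_commute[OF assms(1)] assms(2)])

lemma staircase_eq_stair: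
  assumes "staircase n v"
  shows "v = stair n (row_fun (pos_part v)) (row_fun (neg_part v))"
    and "fits n (row_fun (pos_part v)) (row_fun (neg_part v))"
    and "is_part (pos_part v)" and "is_part (neg_part v)"
proof -
  have len: "length v = n" and sorted: "\<And>i j. i < j \<Longrightarrow> j < n \<Longrightarrow> v ! j \<le> v ! i"
    using assms by (auto simp: staircase_def sorted_wrt_iff_nth_less)
  define p where "p = (\<lambda>k. if k < n then nat (v ! k) else 0)"
  define m where "m = (\<lambda>k. if k < n then nat (- v ! (n - 1 - k)) else 0)"
  have v: "v = stair n p m"
    by (rule nth_equalityI) (auto simp: vec_def p_def m_def len)
  have p: "is_shape p"
    by (rule is_shapeI[where n = n]) (auto simp: p_def intro!: nat_mono sorted)
  have m: "is_shape m"
    by (rule is_shapeI[where n = n]) (auto simp: m_def intro!: nat_mono sorted)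
  have fits: "fits n p m"
    unfolding fits_def
  proof (intro exI conjI allI impI)
    show "p i = 0" if "top_row p 0 \<le> i" for i using that le_top_row_iff[OF p] by auto
    show "m i = 0" if "top_row m 0 \<le> i" for i using that le_top_row_iff[OF m] by auto
    show "top_row p 0 + top_row m 0 \<le> n"
    \<comment> \<open>Otherwise the entry of the last row of the positive part would also have to be
      negative.\<close>
    proof (rule ccontr)
      assume h: "\<not> ?thesis"
      have le: "top_row p 0 \<le> n" "top_row m 0 \<le> n"
        using le_top_row_iff[OF p, of 0 n] le_top_row_iff[OF m, of 0 n] by (auto simp: p_def m_def)
      define i where "i = top_row p 0 - 1"
      have i: "i < top_row p 0" using h le by (auto simp: i_def)
      have "p i \<noteq> 0" using i le_top_row_iff[OF p, of 0 i] by auto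
      then have "0 < v ! i" by (auto simp: p_def split: if_splits)
      moreover have j: "n - 1 - i < top_row m 0" using h le i by (auto simp: i_def)
      have "m (n - 1 - i) \<noteq> 0" using j le_top_row_iff[OF m, of 0 "n - 1 - i"] by auto
      then have "v ! (n - 1 - (n - 1 - i)) < 0" by (auto simp: m_def split: if_splits)
      ultimately show False using i le by simp
    qed
  qed
  have "pos_part v = part_of p" "neg_part v = part_of m"
    using pos_part_stair[OF fits p] neg_part_stair[OF fits m] v by simp_all
  then show "v = stair n (row_fun (pos_part v)) (row_fun (neg_part v))"
    and "fits n (row_fun (pos_part v)) (row_fun (neg_part v))"
    and "is_part (pos_part v)" and "is_part (neg_part v)"
    using v p m fits is_part_part_of by simp_all
qed

text \<open>A diagram is recognised by labels \<open>G\<close> that agree with it on the boundary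
  and satisfy Fomin's rule, which the backward rule inverts. There are two bounds because the
  diagram of the negative parts, read transposed, is not square: it has \<open>B = r - 1\<close> and
  \<open>C = r\<close>.\<close>

lemma plab_eqI:
  assumes cell: "\<And>a b. a \<le> b \<Longrightarrow> Suc b \<le> B \<Longrightarrow> Suc a \<le> C \<Longrightarrow>
      fomin (G a (Suc b)) (G (Suc a) (Suc b)) (G a b) (G (Suc a) b) (Y a b)"
    and shape: "\<And>a b. a \<le> Suc b \<Longrightarrow> b \<le> B \<Longrightarrow> a \<le> C \<Longrightarrow> is_shape (G a b)"
    and diag: "\<And>a. a \<le> B \<Longrightarrow> a \<le> C \<Longrightarrow> q (2 * a) = part_of (G a a)"
      "\<And>a. a \<le> B \<Longrightarrow> Suc a \<le> C \<Longrightarrow> q (Suc (2 * a)) = part_of (G (Suc a) a)"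
    and C: "B \<le> C"
  shows "a \<le> Suc b \<Longrightarrow> b \<le> B \<Longrightarrow> a \<le> C \<Longrightarrow> plab q a b = part_of (G a b)"
    and "a \<le> b \<Longrightarrow> Suc b \<le> B \<Longrightarrow> cell_cross q a b = Y a b"
proof -
  show 1: "plab q a b = part_of (G a b)" if "a \<le> Suc b" "b \<le> B" "a \<le> C" for a b
    using that
  proof (induction "Suc b - a" arbitrary: a b rule: less_induct)
    case less
    consider "a = Suc b" | "a = b" | b' where "b = Suc b'" "a \<le> b'"
      using less.prems by (metis le_Suc_eq not0_implies_Suc le_zero_eq)
    then show ?case
    proof cases
      case 3
      have "plab q a b' = part_of (G a b')" "plab q (Suc a) b' = part_of (G (Suc a) b')"
        "plab q (Suc a) (Suc b') = part_of (G (Suc a) (Suc b'))"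
        by (rule less.hyps; use 3 less.prems C in linarith)+
      then have "plab q a b = backward_rule (part_of (G a b')) (part_of (G (Suc a) b')) (part_of (G (Suc a) (Suc b')))"
        using 3 by (simp add: plab_cell)
      also have "\<dots> = part_of (G a (Suc b'))"
      proof (rule backward_rule_eq)
        have s: "is_shape (G a b')" "is_shape (G (Suc a) b')" "is_shape (G (Suc a) (Suc b'))" "is_shape (G a (Suc b'))"
          by (rule shape; use 3 less.prems C in linarith)+
        then show "is_part (part_of (G a b'))" "is_part (part_of (G (Suc a) b'))" "is_part (part_of (G (Suc a) (Suc b')))"
          "is_shape (G a (Suc b'))" by (auto intro: is_part_part_of)
        have "Suc a \<le> C" using 3 less.prems C by linarith
        then show "fomin (G a (Suc b')) (row_fun (part_of (G a b'))) (row_fun (part_of (G (Suc a) (Suc b'))))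
          (row_fun (part_of (G (Suc a) b'))) (Y a b')"
          using fomin_swap[OF cell[of a b']] 3 less.prems s by simp
      qed
      finally show ?thesis using 3 by simp
    qed (use diag less.prems in auto)
  qed
  show "cell_cross q a b = Y a b" if ab: "a \<le> b" "Suc b \<le> B"
  proof -
    have s: "is_shape (G a b)" "is_shape (G (Suc a) b)" "is_shape (G (Suc a) (Suc b))"
      by (rule shape; use ab C in linarith)+
    have e: "plab q a b = part_of (G a b)" "plab q (Suc a) b = part_of (G (Suc a) b)"
        "plab q (Suc a) (Suc b) = part_of (G (Suc a) (Suc b))"
      by (rule 1; use ab C in linarith)+
    have "Suc a \<le> C" using ab C by linarith
    then show ?thesis unfolding cell_cross_def e
      using fomin_swap[OF cell[of a b]] ab s by (intro has_cross_iff) (auto intro: is_part_part_of)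
  qed
qed

lemma plab_cong:
  assumes "\<And>k. k \<le> N \<Longrightarrow> p k = q k"
  shows "a \<le> Suc b \<Longrightarrow> 2 * b \<le> N \<Longrightarrow> a \<le> b \<or> Suc (2 * b) \<le> N \<Longrightarrow> plab p a b = plab q a b"
proof (induction "Suc b - a" arbitrary: a b rule: less_induct)
  case less
  consider "a = Suc b" | "a = b" | b' where "b = Suc b'" "a \<le> b'"
    using less.prems by (metis le_Suc_eq not0_implies_Suc le_zero_eq)
  then show ?case
  proof cases
    case 3
    have "plab p a b' = plab q a b'" "plab p (Suc a) b' = plab q (Suc a) b'"
      "plab p (Suc a) (Suc b') = plab q (Suc a) (Suc b')"
      by (rule less.hyps; use 3 less.prems in auto)+
    then show ?thesis using 3 by (simp add: plab_cell)
  qed (use assms less.prems in auto)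
qed

lemma cell_cross_cong:
  assumes "\<And>k. k \<le> N \<Longrightarrow> p k = q k" "a \<le> b" "2 * Suc b \<le> N"
  shows "cell_cross p a b = cell_cross q a b"
proof -
  have "plab p a b = plab q a b" "plab p (Suc a) b = plab q (Suc a) b"
      "plab p (Suc a) (Suc b) = plab q (Suc a) (Suc b)"
    by (rule plab_cong[OF assms(1)]; use assms(2,3) in auto)+
  then show ?thesis by (simp add: cell_cross_def)
qed

lemma cross_at_eq:
  assumes "1 \<le> i" "1 \<le> j"
  shows "cross_at A i j \<longleftrightarrow> (if i \<le> j then cell_cross (\<lambda>k. pos_part (A ! k)) (i - 1) (j - 1)
    else cell_cross (\<lambda>k. neg_part (A ! Suc k)) (j - 1) (i - 2))"
proof (cases "i \<le> j")
  case True
  obtain i' j' where "i = Suc i'" "j = Suc j'" using assms by (metis Suc_le_D One_nat_def)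
  then show ?thesis using True by (simp add: cross_at_def cell_cross_def pos_label_eq_plab)
next
  case False
  obtain j' where j: "j = Suc j'" using assms by (metis Suc_le_D One_nat_def)
  then have "2 \<le> i" using False by simp
  then obtain i' where i: "i = Suc (Suc i')" by (metis add_2_eq_Suc le_Suc_ex)
  show ?thesis using False i j neg_label_eq_plab[of "Suc j'" "Suc i'" A] neg_label_eq_plab[of "Suc j'" "i'" A]
      neg_label_eq_plab[of "j'" "i'" A]
    by (simp add: cross_at_def cell_cross_def has_cross_commute)
qed

context staircase_path
begin

context
  fixes n r :: nat and A :: "int list list"
  assumes A: "\<And>j. j \<le> 2 * r \<Longrightarrow> staircase n (A ! j)"
    and pm: "\<And>j. j \<le> 2 * r \<Longrightarrow> p j = pos_part (A ! j)" "\<And>j. j \<le> 2 * r \<Longrightarrow> m j = neg_part (A ! j)"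
    and r: "r \<le> E" "2 * r \<le> Suc n"
begin

lemma evac_nth:
  assumes "k \<le> 2 * r"
  shows "pos_part (evac n r A ! k) = part_of (pos_shape (2 * r - k) (2 * r))"
    and "neg_part (evac n r A ! k) = part_of (neg_shape (2 * r - k) (2 * r))"
proof -
  let ?k = "2 * r - k"
  have st: "A ! j = stair n (row_fun (p j)) (row_fun (m j))" "fits n (row_fun (p j)) (row_fun (m j))"
    if "j \<le> 2 * r" for j
    unfolding pm(1)[OF that] pm(2)[OF that]
    by (rule staircase_eq_stair[OF A[OF that]])+
  have k: "?k + ?k mod 2 \<le> 2 * r" "Suc ?k div 2 \<le> 2 * r div 2"
  proof -
    have "d + d mod 2 \<le> 2 * r" "Suc d div 2 \<le> 2 * r div 2" if "d \<le> 2 * r" for d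
      using that by presburger+
    then show "?k + ?k mod 2 \<le> 2 * r" "Suc ?k div 2 \<le> 2 * r div 2" by simp_all
  qed
  have "evac n r A ! k = evac_array n A ?k (2 * r)" using assms by (simp add: evac_def del: upt_Suc evac_array.simps)
  also have "\<dots> = stair n (pos_shape ?k (2 * r)) (neg_shape ?k (2 * r))"
    by (rule evac_array_eq[OF st r k(1)]) auto
  finally have e: "evac n r A ! k = stair n (pos_shape ?k (2 * r)) (neg_shape ?k (2 * r))" .
  have "fits n (pos_shape ?k (2 * r)) (neg_shape ?k (2 * r))"
  proof (cases "?k = 0")
    case True
    then show ?thesis using st(2)[of "2 * r"] pos_shape_0[of "2 * r"] neg_shape_0[of "2 * r"] r by simp
  next
    case False
    then have "2 * r - ?k \<le> n" using r by linarith
    then show ?thesis by (rule fits_pos_neg_shape[OF k(2)])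
  qed
  then show "pos_part (evac n r A ! k) = part_of (pos_shape ?k (2 * r))"
    "neg_part (evac n r A ! k) = part_of (neg_shape ?k (2 * r))"
    unfolding e using pos_part_stair neg_part_stair is_shape_pos_shape[OF k(2)] is_shape_neg_shape[OF k(2)] by blast+
qed

text \<open>On the boundary this is \<open>pos_shape (2 * r - k) (2 * r)\<close>. There the columns
  depend on \<open>a\<close> only and the rows on \<open>b\<close> only, which suggests the labels
  inside.\<close>

definition evac_pos :: "nat \<Rightarrow> nat \<Rightarrow> shape" where
  "evac_pos a b = rsk X (rev [Suc (r - a)..<Suc r]) ([Suc r..<Suc E] @ [1..<Suc (r - b)])"

text \<open>The second argument is shifted as in \<open>neg_label_eq_plab\<close>: it belongs to the
  corner \<open>(Suc a, b)\<close>, so the last column is \<open>r - Suc a\<close>.\<close>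

definition evac_neg :: "nat \<Rightarrow> nat \<Rightarrow> shape" where
  "evac_neg b a = rsk X (rev ([Suc r..<Suc E] @ [1..<r - a])) [Suc (r - b)..<Suc r]"

text \<open>Cell \<open>(a, b)\<close> attaches column \<open>r - a\<close> on the left and row
  \<open>r - b\<close> below. That Fomin's rule also holds at this corner is what turns the matrix
  by 180 degrees.\<close>

lemma evac_pos_labels:
  shows "a \<le> Suc b \<Longrightarrow> b \<le> r \<Longrightarrow> a \<le> r \<Longrightarrow> plab (\<lambda>k. pos_part (evac n r A ! k)) a b = part_of (evac_pos a b)"
    and "a \<le> b \<Longrightarrow> Suc b \<le> r \<Longrightarrow> cell_cross (\<lambda>k. pos_part (evac n r A ! k)) a b = X (r - a) (r - b)"
proof -
  have cell: "fomin (evac_pos a (Suc b)) (evac_pos (Suc a) (Suc b)) (evac_pos a b) (evac_pos (Suc a) b) (X (r - a) (r - b))"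
    if "a \<le> b" "Suc b \<le> r" "Suc a \<le> r" for a b
  proof -
    have "[Suc (r - Suc a)..<Suc r] = (r - a) # [Suc (r - a)..<Suc r]" "[1..<Suc (r - b)] = [1..<Suc (r - Suc b)] @ [r - b]"
      using that upt_conv_Cons[of "r - a" "Suc r"] by (simp_all add: Suc_diff_Suc Suc_diff_le)
    moreover have "\<not> r - b < Suc (r - Suc b)" using that by simp
    ultimately show ?thesis unfolding evac_pos_def
      using rsk_left_down[OF partial_bij_X, of "rev [Suc (r - a)..<Suc r]" "r - a"
        "[Suc r..<Suc E] @ [1..<Suc (r - Suc b)]" "r - b"] that
      by (auto simp del: upt_Suc One_nat_def)
  qed
  have shape: "is_shape (evac_pos a b)" for a b
    unfolding evac_pos_def by (rule is_shape_rsk[OF partial_bij_X]) auto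
  have d1: "pos_part (evac n r A ! (2 * a)) = part_of (evac_pos a a)" if "a \<le> r" for a
  proof -
    have "2 * r - 2 * a = 2 * (r - a)" by simp
    then show ?thesis using evac_nth(1)[of "2 * a"] that unfolding evac_pos_def pos_shape_def
      by (simp del: upt_Suc)
  qed
  have d2: "pos_part (evac n r A ! Suc (2 * a)) = part_of (evac_pos (Suc a) a)" if "Suc a \<le> r" for a
  proof -
    have "2 * r - Suc (2 * a) = Suc (2 * (r - Suc a))" "Suc (Suc (2 * (r - Suc a))) div 2 = r - a" using that by auto
    then show ?thesis using evac_nth(1)[of "Suc (2 * a)"] that unfolding evac_pos_def pos_shape_def
      by (simp del: upt_Suc)
  qed
  show "plab (\<lambda>k. pos_part (evac n r A ! k)) a b = part_of (evac_pos a b)" if "a \<le> Suc b" "b \<le> r" "a \<le> r"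
    by (rule plab_eqI(1)[OF cell shape d1 d2 order_refl that])
  show "cell_cross (\<lambda>k. pos_part (evac n r A ! k)) a b = X (r - a) (r - b)" if "a \<le> b" "Suc b \<le> r"
    by (rule plab_eqI(2)[OF cell shape d1 d2 order_refl that])
qed

lemma evac_neg_labels:
  shows "b \<le> Suc a \<Longrightarrow> Suc a \<le> r \<Longrightarrow> b \<le> r \<Longrightarrow> plab (\<lambda>k. neg_part (evac n r A ! Suc k)) b a = part_of (evac_neg b a)"
    and "b \<le> a \<Longrightarrow> Suc (Suc a) \<le> r \<Longrightarrow> cell_cross (\<lambda>k. neg_part (evac n r A ! Suc k)) b a = X (r - Suc a) (r - b)"
proof -
  have cell: "fomin (evac_neg b (Suc a)) (evac_neg (Suc b) (Suc a)) (evac_neg b a) (evac_neg (Suc b) a) (X (r - Suc a) (r - b))"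
    if "b \<le> a" "Suc a \<le> r - 1" "Suc b \<le> r" for a b
  proof -
    have "[Suc (r - Suc b)..<Suc r] = (r - b) # [Suc (r - b)..<Suc r]" "[1..<r - a] = [1..<r - Suc a] @ [r - Suc a]"
      using that upt_conv_Cons[of "r - b" "Suc r"] upt_Suc_append[of 1 "r - Suc a"] by (simp_all add: Suc_diff_Suc Suc_diff_le)
    then show ?thesis unfolding evac_neg_def
      using fomin_swap[OF rsk_right_up[OF partial_bij_X, of "r - Suc a" "rev ([Suc r..<Suc E] @ [1..<r - Suc a])"
        "r - b" "[Suc (r - b)..<Suc r]"]] that
      by (auto simp del: upt_Suc One_nat_def)
  qed
  have shape: "is_shape (evac_neg b a)" for a b
    unfolding evac_neg_def by (rule is_shape_rsk[OF partial_bij_X]) auto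
  have d1: "neg_part (evac n r A ! Suc (2 * b)) = part_of (evac_neg b b)" if "b \<le> r - 1" "b \<le> r" "0 < r" for b
  proof -
    have "2 * r - Suc (2 * b) = Suc (2 * (r - Suc b))" "Suc (Suc (2 * (r - Suc b))) div 2 = r - b"
      "Suc (r - Suc b) = r - b" using that by auto
    then show ?thesis using evac_nth(2)[of "Suc (2 * b)"] that unfolding evac_neg_def neg_shape_def
      by (simp del: upt_Suc)
  qed
  have d2: "neg_part (evac n r A ! Suc (Suc (2 * a))) = part_of (evac_neg (Suc a) a)" if "a \<le> r - 1" "Suc a \<le> r" for a
  proof -
    have "2 * r - Suc (Suc (2 * a)) = 2 * (r - Suc a)" "Suc (r - Suc a) = r - a" using that by auto
    then show ?thesis using evac_nth(2)[of "Suc (Suc (2 * a))"] that unfolding evac_neg_def neg_shape_def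
      by (simp del: upt_Suc)
  qed
  show "plab (\<lambda>k. neg_part (evac n r A ! Suc k)) b a = part_of (evac_neg b a)" if "b \<le> Suc a" "Suc a \<le> r" "b \<le> r"
    by (rule plab_eqI(1)[where B = "r - 1" and C = r, OF cell shape d1 d2]) (use that in auto)
  show "cell_cross (\<lambda>k. neg_part (evac n r A ! Suc k)) b a = X (r - Suc a) (r - b)" if "b \<le> a" "Suc (Suc a) \<le> r"
    by (rule plab_eqI(2)[where B = "r - 1" and C = r, OF cell shape d1 d2]) (use that in auto)
qed

lemma cross_at_evac:
  assumes "1 \<le> i" "i \<le> r" "1 \<le> j" "j \<le> r"
  shows "cross_at (evac n r A) i j \<longleftrightarrow> X (r + 1 - i) (r + 1 - j)"
proof (cases "i \<le> j")
  case True
  have "r - (i - 1) = r + 1 - i" "r - (j - 1) = r + 1 - j" using assms by auto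
  then show ?thesis using evac_pos_labels(2)[of "i - 1" "j - 1"] cross_at_eq[OF assms(1,3)] True assms by simp
next
  case False
  have "r - Suc (i - 2) = r + 1 - i" "r - (j - 1) = r + 1 - j" using assms False by auto
  then show ?thesis using evac_neg_labels(2)[of "j - 1" "i - 2"] cross_at_eq[OF assms(1,3)] False assms by simp
qed

lemma cross_at_iff_X:
  assumes "1 \<le> i" "i \<le> r" "1 \<le> j" "j \<le> r"
  shows "cross_at A i j \<longleftrightarrow> X i j"
proof (cases "i \<le> j")
  case True
  have "cell_cross p (i - 1) (j - 1) = cell_cross (\<lambda>k. pos_part (A ! k)) (i - 1) (j - 1)"
    by (rule cell_cross_cong[where N = "2 * r"]) (use pm assms True in auto)
  then show ?thesis using cross_at_eq[OF assms(1,3)] True assms by (simp add: X_def)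
next
  case False
  have "cell_cross (\<lambda>k. m (Suc k)) (j - 1) (i - 2) = cell_cross (\<lambda>k. neg_part (A ! Suc k)) (j - 1) (i - 2)"
    by (rule cell_cross_cong[where N = "2 * r - 1"]) (use pm assms False in auto)
  then show ?thesis using cross_at_eq[OF assms(1,3)] False assms by (simp add: X_def)
qed

lemma partial_perm_evac: "partial_perm r (evac n r A) = reverse_complement r (partial_perm r A)"
proof -
  have iff: "(i, j) \<in> partial_perm r (evac n r A) \<longleftrightarrow> (r + 1 - i, r + 1 - j) \<in> partial_perm r A"
    if "1 \<le> i" "i \<le> r" "1 \<le> j" "j \<le> r" for i j
    using that cross_at_evac[OF that] cross_at_iff_X[of "r + 1 - i" "r + 1 - j"] by (auto simp: partial_perm_def)
  show ?thesis
  proof (intro equalityI subsetI)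
    fix x assume x: "x \<in> partial_perm r (evac n r A)"
    then obtain i j where ij: "x = (i, j)" "1 \<le> i" "i \<le> r" "1 \<le> j" "j \<le> r"
      by (auto simp: partial_perm_def)
    then have "(r + 1 - i, r + 1 - j) \<in> partial_perm r A" using iff x by simp
    moreover have "x = (r + 1 - (r + 1 - i), r + 1 - (r + 1 - j))" using ij by simp
    ultimately show "x \<in> reverse_complement r (partial_perm r A)"
      unfolding reverse_complement_def by (intro image_eqI[where x = "(r + 1 - i, r + 1 - j)"]) simp_all
  next
    fix x assume "x \<in> reverse_complement r (partial_perm r A)"
    then obtain i j where ij: "x = (r + 1 - i, r + 1 - j)" "(i, j) \<in> partial_perm r A"
      by (auto simp: reverse_complement_def)
    then have b: "1 \<le> i" "i \<le> r" "1 \<le> j" "j \<le> r" by (auto simp: partial_perm_def)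
    then have "r + 1 - (r + 1 - i) = i" "r + 1 - (r + 1 - j) = j" by simp_all
    then show "x \<in> partial_perm r (evac n r A)"
      using iff[of "r + 1 - i" "r + 1 - j"] ij b by simp
  qed
qed

lemma pos_label_evac:
  assumes "a \<le> r"
  shows "pos_label (evac n r A) a r = part_of (rsk X (rev [Suc (r - a)..<Suc r]) [Suc r..<Suc E])"
  using evac_pos_labels(1)[of a r] assms by (simp add: pos_label_eq_plab evac_pos_def)

lemma pos_label_A:
  assumes "a \<le> r"
  shows "pos_label A a r = part_of (rsk X (rev [1..<Suc a]) [Suc r..<Suc E])"
proof -
  have "pos_label A a r = plab p a r"
    unfolding pos_label_eq_plab by (rule plab_cong[where N = "2 * r"]) (use pm assms in auto)
  also have "\<dots> = part_of (row_fun (plab p a r))"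
    using is_part_plab[OF is_path_p, of a r] assms by simp
  finally show ?thesis using pos_eq_rsk[of r a] assms r by simp
qed

lemma neg_label_evac:
  assumes "b \<le> r"
  shows "neg_label (evac n r A) r b = part_of (rsk X (rev [Suc r..<Suc E]) [Suc (r - b)..<Suc r])"
proof (cases r)
  case 0
  then show ?thesis using evac_nth(2)[of 0] assms
    by (simp add: neg_label.simps[of "evac n 0 A" 0 0] neg_shape_def)
next
  case (Suc r')
  \<comment> \<open>On the right side of the square \<open>[1..<r - r']\<close> is empty, and only
    columns beyond \<open>r\<close> remain.\<close>
  have "r - r' = 1" using Suc by simp
  then have e: "evac_neg b r' = rsk X (rev [Suc r..<Suc E]) [Suc (r - b)..<Suc r]"
    unfolding evac_neg_def by (simp del: upt_Suc)
  have "neg_label (evac n r A) (Suc r') b = part_of (evac_neg b r')"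
    using neg_label_eq_plab[of b r' "evac n r A"] evac_neg_labels(1)[of b r'] assms Suc by simp
  then show ?thesis unfolding e Suc[symmetric] .
qed

lemma neg_label_A:
  assumes "b \<le> r"
  shows "neg_label A r b = part_of (rsk X (rev [Suc r..<Suc E]) [1..<Suc b])"
proof (cases r)
  case 0
  have "neg_part (A ! 0) = []" using pm(2)[of 0] start by simp
  then show ?thesis using 0 assms part_of_row_fun[of "[]"] by (simp add: neg_label.simps[of A 0 0])
next
  case (Suc r')
  have "neg_label A r b = plab (\<lambda>k. neg_part (A ! Suc k)) b r'"
    using neg_label_eq_plab[of b r' A] Suc assms by simp
  also have "\<dots> = plab (\<lambda>k. m (Suc k)) b r'"
    by (rule plab_cong[where N = "2 * r - 1"]) (use pm assms Suc in auto)
  also have "\<dots> = part_of (row_fun (plab (\<lambda>k. m (Suc k)) b r'))"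
    using is_part_plab[OF is_path_m, of b r'] assms Suc by simp
  finally show ?thesis using neg_eq_rsk[of r' b] assms r Suc by (simp del: upt_Suc)
qed

end
end

section \<open>Rectangular shapes\<close>

definition is_chain :: "(nat \<Rightarrow> shape) \<Rightarrow> bool" where
  "is_chain W \<longleftrightarrow> W 0 = (\<lambda>_. 0) \<and> (\<forall>a. is_shape (W a)) \<and> (\<forall>a. \<exists>p. W (Suc a) = W a \<oplus> p)"

definition box :: "nat \<Rightarrow> nat \<Rightarrow> shape" where
  "box h w x = (if x < h then w else 0)"

definition box_compl :: "nat \<Rightarrow> nat \<Rightarrow> shape \<Rightarrow> shape" where
  "box_compl h w f x = (if x < h then w - f (h - 1 - x) else 0)"

text \<open>With the cells in the order of \<open>box_cells\<close> this is the matrix of the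
  reading word of the chain's tableau, bottom row first. Inserting the reading word gives back the
  tableau, see \<open>rsk_chain_matrix\<close>.\<close>

definition chain_matrix :: "(nat \<Rightarrow> shape) \<Rightarrow> nat \<Rightarrow> nat \<times> nat \<Rightarrow> bool" where
  "chain_matrix W c = (\<lambda>(k, t). 1 \<le> c \<and> W (c - 1) k = t \<and> W c k = Suc t)"

text \<open>The cells of the box in the order in which they index the rows of the matrix, from top to bottom.
  The list starts in row \<open>k\<close> of the box, with the cells in the first \<open>t\<close> columns.\<close>

definition box_cells :: "nat \<Rightarrow> nat \<Rightarrow> nat \<Rightarrow> nat \<Rightarrow> (nat \<times> nat) list" where
  "box_cells h w k t = map (Pair k) (rev [0..<t]) @ concat (map (\<lambda>k. map (Pair k) (rev [0..<w])) [Suc k..<h])"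

text \<open>What is left of \<open>f\<close> if only the rows below \<open>k\<close> and the first
  \<open>t\<close> cells of row \<open>k\<close> are kept: the columns from \<open>t\<close> on move
  up by one.\<close>

definition partial_content :: "nat \<Rightarrow> nat \<Rightarrow> shape \<Rightarrow> shape" where
  "partial_content k t f x = min t (f (k + x)) + (f (Suc (k + x)) - t)"

lemma chain_mono:
  assumes "is_chain W" "a \<le> b" shows "W a x \<le> W b x"
  using assms(2)
proof (induction rule: dec_induct)
  case (step b)
  obtain p where "W (Suc b) = W b \<oplus> p" using assms(1) unfolding is_chain_def by blast
  then show ?case using step le_add_cell[of "W b" x p] by simp
qed simp

lemma pbij_chain_matrix:
  assumes "is_chain W" shows "partial_bij (chain_matrix W)"
proof -
  have col: "kt = kt'" if h: "chain_matrix W c kt" "chain_matrix W c kt'" for c kt kt'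
  proof -
    obtain d where d: "c = Suc d" using h(1) by (cases c; cases kt) (auto simp: chain_matrix_def)
    obtain p where p: "W (Suc d) = W d \<oplus> p" using assms unfolding is_chain_def by blast
    have "p = Some (fst z) \<and> snd z = W d (fst z)" if "chain_matrix W c z" for z
    proof -
      have "(W d \<oplus> p) (fst z) = Suc (W d (fst z))" "snd z = W d (fst z)"
        using that unfolding d p[symmetric] by (auto simp: chain_matrix_def split: prod.splits)
      then show ?thesis by (auto simp: add_cell_apply split: if_splits)
    qed
    from this[OF h(1)] this[OF h(2)] show ?thesis by (simp add: prod_eq_iff)
  qed
  have lt: "\<not> c < c'" if "chain_matrix W c kt" "chain_matrix W c' kt" for c c' kt
  proof
    assume "c < c'"
    then have "W c (fst kt) \<le> W (c' - 1) (fst kt)" by (intro chain_mono[OF assms]) simp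
    then show False using that by (cases kt) (auto simp: chain_matrix_def)
  qed
  show ?thesis unfolding partial_bij_def using col lt by (metis linorder_neqE_nat)
qed

section \<open>The matrix of a chain inside a box\<close>

lemma partial_content_add_cell:
  "partial_content k t (f \<oplus> Some j) = partial_content k t f \<oplus>
     (if j < k then None else if f j < t then Some (j - k) else if j = k then None else Some (j - k - 1))"
  by (rule ext) (auto simp: partial_content_def add_cell_apply min_def simp del: add_cell.simps)

text \<open>Column \<open>t\<close> gets back its cell of row \<open>k\<close> and so becomes longer
  by one; the new cell is at its lower end.\<close>

lemma partial_content_Suc:
  assumes "is_shape f"
  shows "\<exists>q. partial_content k (Suc t) f = partial_content k t f \<oplus> q \<and>
    (q = None \<longleftrightarrow> f k \<le> t) \<and> (\<forall>x. q = Some x \<longleftrightarrow> t < f (k + x) \<and> f (Suc (k + x)) \<le> t)"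
proof (cases "f k \<le> t")
  case True
  have le: "f (k + x) \<le> t" for x using is_shape_antimono[OF assms, of k "k + x"] True by simp
  have "partial_content k (Suc t) f = partial_content k t f \<oplus> None"
  proof
    fix x show "partial_content k (Suc t) f x = (partial_content k t f \<oplus> None) x"
      using le[of x] le[of "Suc x"] by (simp add: partial_content_def min_def)
  qed
  moreover have "\<not> t < f (k + x)" for x using le[of x] by simp
  ultimately show ?thesis using True by (intro exI[of _ None]) simp
next
  case False
  define y where "y = top_row f t - Suc k"
  have "k < top_row f t" using le_top_row_iff[OF assms, of t k] False by auto
  then have y: "top_row f t = Suc (k + y)" by (simp add: y_def)
  have gt: "t < f z \<longleftrightarrow> z \<le> k + y" for z
    using le_top_row_iff[OF assms, of t z] unfolding y by auto
  have iff: "y = x \<longleftrightarrow> t < f (k + x) \<and> f (Suc (k + x)) \<le> t" for x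
    using gt[of "k + x"] gt[of "Suc (k + x)"] by auto
  have "partial_content k (Suc t) f = partial_content k t f \<oplus> Some y"
  proof
    fix x
    have "f (Suc (k + x)) \<le> f (k + x)" using is_shape_antimono[OF assms] by simp
    then show "partial_content k (Suc t) f x = (partial_content k t f \<oplus> Some y) x"
      using iff[of x] unfolding partial_content_def add_cell_apply by (auto simp: min_def)
  qed
  then show ?thesis using False iff by (intro exI[of _ "Some y"]) simp
qed

text \<open>The labels collide exactly if the cell added in row \<open>j > k\<close> lies in column
  \<open>t\<close>. It stands in row \<open>j - k - 1\<close> while this column is moved up and in
  row \<open>j - k\<close> afterwards, as Fomin's rule demands. For \<open>j = k\<close> it becomes
  visible only now, which is the cross.\<close>

lemma partial_content_fomin:
  assumes "is_shape f" "is_shape (f \<oplus> p)"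
  shows "fomin (partial_content k t f) (partial_content k t (f \<oplus> p)) (partial_content k (Suc t) f)
    (partial_content k (Suc t) (f \<oplus> p)) (p = Some k \<and> f k = t)"
proof (rule fomin_swap)
  obtain q where q: "partial_content k (Suc t) f = partial_content k t f \<oplus> q"
    "q = None \<longleftrightarrow> f k \<le> t" "\<And>x. q = Some x \<longleftrightarrow> t < f (k + x) \<and> f (Suc (k + x)) \<le> t"
    using partial_content_Suc[OF assms(1)] by blast
  show "fomin (partial_content k t f) (partial_content k (Suc t) f) (partial_content k t (f \<oplus> p))
    (partial_content k (Suc t) (f \<oplus> p)) (p = Some k \<and> f k = t)"
  proof (cases p)
    case None
    have "fomin_label q None False = None" by (cases q) auto
    then show ?thesis unfolding fomin_def None add_cell.simps(1) q(1)
      by (intro exI[of _ q] exI[of _ None]) (simp del: fomin_label.simps)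
  next
    case (Some j)
    define lab where "lab t = (if j < k then None else if f j < t then Some (j - k)
        else if j = k then None else Some (j - k - 1))" for t
    have pc: "partial_content k t (f \<oplus> p) = partial_content k t f \<oplus> lab t" for t
      unfolding Some lab_def by (rule partial_content_add_cell)
    have j: "j = 0 \<or> f j < f (j - 1)" using is_shape_add_cell_iff assms Some by blast
    have "lab (Suc t) = fomin_label q (lab t) (p = Some k \<and> f k = t)"
    proof (cases "f j = t \<and> k \<le> j")
      case True
      show ?thesis
      proof (cases "j = k")
        case True
        then have "q = None" using q(2) \<open>f j = t \<and> k \<le> j\<close> by auto
        then show ?thesis using True \<open>f j = t \<and> k \<le> j\<close> Some by (auto simp: lab_def)
      next
        case False
        then have "q = Some (j - k - 1)" using q(3) j True by (auto simp: Suc_diff_Suc)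
        then show ?thesis using True False Some by (auto simp: lab_def)
      qed
    next
      case False
      then have l: "lab (Suc t) = lab t" by (auto simp: lab_def)
      have "q \<noteq> lab t \<or> q = None \<and> \<not> (p = Some k \<and> f k = t)"
      proof (rule ccontr)
        assume "\<not> ?thesis"
        then have ql: "q = lab t" "q \<noteq> None \<or> p = Some k \<and> f k = t" by auto
        show False
        proof (cases "lab t")
          case None
          then show ?thesis using ql False Some by auto
        next
          case x: (Some x)
          then have "k \<le> j" "t < f (k + x)" "f (Suc (k + x)) \<le> t"
            using ql(1) q(3) by (auto simp: lab_def split: if_splits)
          then show ?thesis using x False by (auto simp: lab_def Suc_diff_Suc split: if_splits)
        qed
      qed
      then show ?thesis using l by auto
    qed
    moreover have "q = None \<and> lab t = None" if "p = Some k \<and> f k = t"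
      using that Some q(2) by (auto simp: lab_def)
    ultimately show ?thesis unfolding fomin_def q(1) pc by (intro exI[of _ q] exI[of _ "lab t"]) simp
  qed
qed

lemma distinct_box_cells: "distinct (box_cells h w k t)"
proof -
  have d: "distinct (concat (map (\<lambda>k. map (Pair k) (rev [0..<w])) ks)) \<and>
    fst ` set (concat (map (\<lambda>k. map (Pair k) (rev [0..<w])) ks)) \<subseteq> set ks" if "distinct ks" for ks :: "nat list"
    using that by (induction ks) (auto simp: distinct_map inj_on_def)
  show ?thesis unfolding box_cells_def using d[of "[Suc k..<h]"] by (auto simp: distinct_map inj_on_def)
qed

lemma box_cells_Suc: "box_cells h w k (Suc t) = (k, t) # box_cells h w k t"
  by (simp add: box_cells_def)

lemma box_cells_0: "Suc k < h \<Longrightarrow> box_cells h w k 0 = box_cells h w (Suc k) w"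
  by (simp add: box_cells_def upt_conv_Cons)

lemma box_cells_last: "h \<le> Suc k \<Longrightarrow> box_cells h w k 0 = []"
  by (simp add: box_cells_def)

text \<open>Induction from the last row of the box upwards. The complete row \<open>Suc k\<close>
  and the empty beginning of row \<open>k\<close> have the same content, which links consecutive
  rows.\<close>

lemma rsk_chain_matrix_partial:
  assumes "is_chain W" "\<And>a x. W a x \<le> box h w x"
  shows "k < h \<Longrightarrow> \<forall>t \<le> w. \<forall>a. rsk (chain_matrix W) (rev [1..<Suc a]) (box_cells h w k t) = partial_content k t (W a)"
proof (induction "h - k" arbitrary: k rule: less_induct)
  case less
  have zero: "rsk (chain_matrix W) (rev [1..<Suc a]) (box_cells h w k 0) = partial_content k 0 (W a)" for a
  proof (cases "Suc k < h")
    case True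
    have "partial_content (Suc k) w (W a) = partial_content k 0 (W a)"
    proof
      fix x show "partial_content (Suc k) w (W a) x = partial_content k 0 (W a) x"
        using assms(2)[of a "Suc (k + x)"] assms(2)[of a "Suc (Suc (k + x))"]
        by (auto simp: partial_content_def box_def split: if_splits)
    qed
    then show ?thesis using less.hyps[of "Suc k"] True by (simp add: box_cells_0 del: upt_Suc)
  next
    case False
    have "partial_content k 0 (W a) x = 0" for x
      using assms(2)[of a "Suc (k + x)"] False by (simp add: partial_content_def box_def)
    then show ?thesis using False by (auto simp: box_cells_last simp del: upt_Suc)
  qed
  have "rsk (chain_matrix W) (rev [1..<Suc a]) (box_cells h w k t) = partial_content k t (W a)" if "t \<le> w" for t a
    using that
  proof (induction t arbitrary: a)
    case 0
    show ?case by (rule zero)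
  next
    case (Suc t)
    then have IH: "rsk (chain_matrix W) (rev [1..<Suc a]) (box_cells h w k t) = partial_content k t (W a)" for a
      by simp
    show ?case
    proof (induction a)
      case 0
      have "W 0 = (\<lambda>_. 0)" using assms(1) by (simp add: is_chain_def)
      then show ?case by (simp add: partial_content_def)
    next
      case (Suc a)
      obtain p where p: "W (Suc a) = W a \<oplus> p" using assms(1) unfolding is_chain_def by blast
      have e: "rev [1..<Suc (Suc a)] = Suc a # rev [1..<Suc a]" by simp
      have x: "chain_matrix W (Suc a) (k, t) = (p = Some k \<and> W a k = t)"
        unfolding chain_matrix_def p by (auto simp: add_cell_apply simp del: add_cell.simps)
      have "fomin (partial_content k t (W a)) (partial_content k t (W (Suc a))) (partial_content k (Suc t) (W a))
        (rsk (chain_matrix W) (rev [1..<Suc (Suc a)]) (box_cells h w k (Suc t))) (p = Some k \<and> W a k = t)"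
        unfolding Suc[symmetric] IH[symmetric] x[symmetric] unfolding e box_cells_Suc
        by (rule rsk_right_up[OF pbij_chain_matrix[OF assms(1)]])
          (use distinct_box_cells[of h w k "Suc t"] in \<open>auto simp: box_cells_Suc\<close>)
      moreover have "fomin (partial_content k t (W a)) (partial_content k t (W (Suc a))) (partial_content k (Suc t) (W a))
        (partial_content k (Suc t) (W (Suc a))) (p = Some k \<and> W a k = t)"
        unfolding p by (rule partial_content_fomin) (use assms(1) p in \<open>auto simp: is_chain_def\<close>, metis)
      ultimately show ?case by (rule fomin_functional)
    qed
  qed
  then show ?case by blast
qed

text \<open>For \<open>h = 0\<close> the list \<open>box_cells h w 0 w\<close> consists of cells outside of the box.\<close>

abbreviation all_cells :: "nat \<Rightarrow> nat \<Rightarrow> (nat \<times> nat) list" where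
  "all_cells h w \<equiv> (if h = 0 then [] else box_cells h w 0 w)"

lemma rsk_chain_matrix:
  assumes "is_chain W" "\<And>a x. W a x \<le> box h w x"
  shows "rsk (chain_matrix W) (rev [1..<Suc a]) (all_cells h w) = W a"
proof (cases "h = 0")
  case True
  then show ?thesis using assms(2)[of a] by (auto simp: box_def)
next
  case False
  have "partial_content 0 w (W a) x = W a x" for x
    using assms(2)[of a x] assms(2)[of a "Suc x"] by (auto simp: partial_content_def box_def split: if_splits)
  then show ?thesis using rsk_chain_matrix_partial[OF assms, of 0] False by (auto simp del: upt_Suc)
qed

lemma rsk_cong:
  "(\<And>c r. c \<in> set cs \<Longrightarrow> r \<in> set rs \<Longrightarrow> X c r = Y c r) \<Longrightarrow> rsk X cs rs = rsk Y cs rs"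
proof (induction X cs rs rule: rsk.induct)
  case (3 X c cs r rs)
  then show ?case by (simp add: rsk.simps(3))
qed auto

lemma rsk_map: "rsk X (map g cs) (map f rs) = rsk (\<lambda>c r. X (g c) (f r)) cs rs"
proof (induction cs arbitrary: rs)
  case (Cons c cs)
  show ?case by (induction rs) (simp_all add: rsk.simps(3) Cons[of "_ # _", simplified] Cons)
qed simp

lemma set_all_cells: "kt \<in> set (all_cells h w) \<Longrightarrow> fst kt < h \<and> snd kt < w"
  by (auto simp: box_cells_def split: if_splits)

lemma rev_all_cells: "rev (all_cells h w) = map (\<lambda>(k, t). (h - 1 - k, w - 1 - t)) (all_cells h w)"
proof -
  have row: "map (\<lambda>t. w - 1 - t) (rev [0..<w]) = [0..<w]" for w :: nat
    by (rule nth_equalityI) (auto simp: rev_nth)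
  have all: "all_cells h w = concat (map (\<lambda>k. map (Pair k) (rev [0..<w])) [0..<h])"
    by (auto simp: box_cells_def upt_conv_Cons)
  have "map (\<lambda>(k, t). (h - 1 - k, w - 1 - t)) (all_cells h w)
    = concat (map (\<lambda>k. map (Pair (h - 1 - k)) (map (\<lambda>t. w - 1 - t) (rev [0..<w]))) [0..<h])"
    unfolding all by (simp add: map_concat comp_def)
  also have "\<dots> = concat (map (\<lambda>k. map (Pair k) [0..<w]) (map (\<lambda>k. h - 1 - k) [0..<h]))"
    unfolding row by (simp add: comp_def)
  also have "map (\<lambda>k. h - 1 - k) [0..<h] = rev [0..<h]"
    by (rule nth_equalityI) (auto simp: rev_nth)
  also have "concat (map (\<lambda>k. map (Pair k) [0..<w]) (rev [0..<h])) = rev (all_cells h w)"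
    unfolding all by (simp add: rev_concat rev_map comp_def)
  finally show ?thesis by simp
qed

lemma distinct_all_cells: "distinct (all_cells h w)"
  by (simp add: distinct_box_cells)

lemma is_shape_box_compl:
  assumes "is_shape f" "\<And>x. f x \<le> box h w x" shows "is_shape (box_compl h w f)"
proof (rule is_shapeI[where n = h])
  show "box_compl h w f (Suc i) \<le> box_compl h w f i" for i
  proof -
    have "f (h - 1 - i) \<le> f (h - 1 - Suc i)" by (rule is_shape_antimono[OF assms(1)]) linarith
    then show ?thesis by (auto simp: box_compl_def intro!: diff_le_mono2)
  qed
qed (simp add: box_compl_def)

lemma box_compl_add_cell:
  assumes "\<And>x. (f \<oplus> p) x \<le> box h w x"
  shows "\<exists>q. box_compl h w f = box_compl h w (f \<oplus> p) \<oplus> q"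
proof (cases p)
  case None
  then show ?thesis by (intro exI[of _ None]) simp
next
  case (Some j)
  have "j < h" using assms[of j] Some by (auto simp: box_def split: if_splits)
  have "box_compl h w f = box_compl h w (f \<oplus> p) \<oplus> Some (h - 1 - j)"
  proof
    fix x
    have "(f \<oplus> p) (h - 1 - x) \<le> w" if "x < h" using assms[of "h - 1 - x"] that by (simp add: box_def split: if_splits)
    moreover have "j = h - 1 - x \<longleftrightarrow> x = h - 1 - j" if "x < h" using that \<open>j < h\<close> by auto
    ultimately show "box_compl h w f x = (box_compl h w (f \<oplus> p) \<oplus> Some (h - 1 - j)) x"
      using Some \<open>j < h\<close> by (auto simp: box_compl_def add_cell_apply simp del: add_cell.simps)
  qed
  then show ?thesis by blast
qed

text \<open>Rotation by 180 degrees turns the matrix of \<open>W\<close> into that of the chain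
  \<open>V\<close> of complements, read backwards from the full box. By \<open>rsk_rotate\<close>
  the final columns of \<open>W\<close> become the initial columns of \<open>V\<close>.\<close>

lemma rsk_chain_matrix_suffix:
  assumes W: "is_chain W" "\<And>a x. W a x \<le> box h w x" and N: "W N = box h w" and i: "i \<le> N"
  shows "rsk (chain_matrix W) (rev [Suc i..<Suc N]) (all_cells h w) = box_compl h w (W i)"
proof -
  define V where "V b = box_compl h w (W (N - b))" for b
  have V: "is_chain V"
    unfolding is_chain_def
  proof (intro conjI allI)
    show "V 0 = (\<lambda>_. 0)" using N by (auto simp: V_def box_compl_def box_def)
    show "is_shape (V a)" for a unfolding V_def
      by (rule is_shape_box_compl) (use W in \<open>auto simp: is_chain_def\<close>)
    show "\<exists>p. V (Suc a) = V a \<oplus> p" for a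
    proof (cases "a < N")
      case True
      then have s: "N - a = Suc (N - Suc a)" by simp
      obtain p where p: "W (Suc (N - Suc a)) = W (N - Suc a) \<oplus> p"
        using W(1) unfolding is_chain_def by blast
      show ?thesis unfolding V_def s p
        by (rule box_compl_add_cell) (use W(2)[of "Suc (N - Suc a)"] p in simp)
    next
      case False
      then show ?thesis by (auto simp: V_def intro!: exI[of _ None])
    qed
  qed
  have V_le: "V a x \<le> box h w x" for a x by (simp add: V_def box_compl_def box_def)
  have cols: "map (\<lambda>c. Suc N - c) (rev [1..<Suc (N - i)]) = [Suc i..<Suc N]"
    by (rule nth_equalityI) (use i in \<open>auto simp: rev_nth simp del: upt_Suc\<close>)
  have "rsk (chain_matrix W) (rev [Suc i..<Suc N]) (all_cells h w)
    = rsk (chain_matrix W) [Suc i..<Suc N] (rev (all_cells h w))"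
    using rsk_rotate[OF pbij_chain_matrix[OF W(1)], of "rev [Suc i..<Suc N]" "all_cells h w"]
      distinct_all_cells by (metis distinct_rev distinct_upt rev_rev_ident)
  also have "\<dots> = rsk (\<lambda>c r. chain_matrix W (Suc N - c) ((\<lambda>(k, t). (h - 1 - k, w - 1 - t)) r))
      (rev [1..<Suc (N - i)]) (all_cells h w)"
    unfolding cols[symmetric] rev_all_cells by (rule rsk_map)
  also have "\<dots> = rsk (chain_matrix V) (rev [1..<Suc (N - i)]) (all_cells h w)"
  proof (rule rsk_cong)
    fix c r assume c: "c \<in> set (rev [1..<Suc (N - i)])" and r: "r \<in> set (all_cells h w)"
    obtain k t where kt: "r = (k, t)" by force
    have kh: "k < h" "t < w" using set_all_cells[OF r] kt by auto
    have cN: "1 \<le> c" "c \<le> N" using c by auto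
    define x y where "x = W (N - c) (h - 1 - k)" and "y = W (Suc N - c) (h - 1 - k)"
    have "W a (h - 1 - k) \<le> w" for a using W(2)[of a "h - 1 - k"] kh by (simp add: box_def)
    then have xy: "x \<le> w" "y \<le> w" unfolding x_def y_def by blast+
    have "N - (c - 1) = Suc N - c" "Suc N - c - 1 = N - c" "1 \<le> Suc N - c" using cN by auto
    then have "chain_matrix V c r \<longleftrightarrow> w - y = t \<and> w - x = Suc t"
      "chain_matrix W (Suc N - c) ((\<lambda>(k, t). (h - 1 - k, w - 1 - t)) r) \<longleftrightarrow> x = w - 1 - t \<and> y = Suc (w - 1 - t)"
      using cN kh by (simp_all add: kt chain_matrix_def V_def box_compl_def x_def y_def del: diff_Suc_1)
    then show "chain_matrix W (Suc N - c) ((\<lambda>(k, t). (h - 1 - k, w - 1 - t)) r) = chain_matrix V c r"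
      using xy kh by auto
  qed
  also have "\<dots> = V (N - i)" by (rule rsk_chain_matrix[OF V V_le])
  finally show ?thesis using i by (simp add: V_def)
qed

section \<open>Triangles of shapes under jeu de taquin\<close>

definition triangle :: "nat \<Rightarrow> (nat \<Rightarrow> nat \<Rightarrow> shape) \<Rightarrow> bool" where
  "triangle N J \<longleftrightarrow> (\<forall>i \<le> N. J i i = (\<lambda>_. 0)) \<and> (\<forall>i a. i \<le> a \<longrightarrow> a \<le> N \<longrightarrow> is_shape (J i a)) \<and>
    (\<forall>i a. i < a \<longrightarrow> a < N \<longrightarrow> jdt (J (Suc i) a) (J (Suc i) (Suc a)) (J i a) (J i (Suc a))) \<and>
    (\<forall>i < N. \<exists>p. J i (Suc i) = (\<lambda>_. 0) \<oplus> p)"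

lemma triangle_rsk:
  assumes X: "partial_bij X" "distinct rs"
  shows "triangle N (\<lambda>i a. rsk X (rev [Suc i..<Suc a]) rs)"
  unfolding triangle_def
proof (intro conjI allI impI)
  fix i a :: nat
  assume ia: "i < a"
  then have "rev [Suc i..<Suc (Suc a)] = Suc a # rev [Suc (Suc i)..<Suc a] @ [Suc i]"
      "rev [Suc (Suc i)..<Suc (Suc a)] = Suc a # rev [Suc (Suc i)..<Suc a]"
      "rev [Suc i..<Suc a] = rev [Suc (Suc i)..<Suc a] @ [Suc i]"
    using upt_conv_Cons[of "Suc i" "Suc a"] by simp_all
  then show "jdt (rsk X (rev [Suc (Suc i)..<Suc a]) rs) (rsk X (rev [Suc (Suc i)..<Suc (Suc a)]) rs)
      (rsk X (rev [Suc i..<Suc a]) rs) (rsk X (rev [Suc i..<Suc (Suc a)]) rs)"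
    using rsk_left_right[OF X(1), of "Suc a" "rev [Suc (Suc i)..<Suc a]" "Suc i" rs] X(2) \<open>i < a\<close>
    by (simp del: upt_Suc)
next
  fix i :: nat
  show "\<exists>p. rsk X (rev [Suc i..<Suc (Suc i)]) rs = (\<lambda>_. 0) \<oplus> p"
    using rsk_single_column[OF X, of "Suc i"] by (simp add: exI del: add_cell.simps)
qed (auto intro!: is_shape_rsk X simp del: upt_Suc)

text \<open>The rule is symmetric in its two middle corners, so the triangle may be reflected; its
  right side then becomes its top side.\<close>

lemma triangle_reverse:
  assumes "triangle N J"
  shows "triangle N (\<lambda>i a. J (N - a) (N - i))"
  unfolding triangle_def
proof (intro conjI allI impI)
  fix i a assume ia: "i < a" "a < N"
  then have s: "N - a = Suc (N - Suc a)" "N - i = Suc (N - Suc i)" by simp_all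
  show "jdt (J (N - a) (N - Suc i)) (J (N - Suc a) (N - Suc i)) (J (N - a) (N - i)) (J (N - Suc a) (N - i))"
    unfolding s by (rule jdt_swap) (use assms ia in \<open>auto simp: triangle_def\<close>)
next
  fix i assume "i < N"
  then have s: "N - i = Suc (N - Suc i)" by simp
  show "\<exists>p. J (N - Suc i) (N - i) = (\<lambda>_. 0) \<oplus> p"
    unfolding s using assms \<open>i < N\<close> by (auto simp: triangle_def)
qed (use assms in \<open>auto simp: triangle_def\<close>)

text \<open>The edge from \<open>n\<close> to \<open>m\<close> has the same label as the edge from
  \<open>l\<close> to \<open>k\<close>, unless its cell forms a domino with that of
  \<open>q\<close>; then only one shape lies between \<open>l\<close> and \<open>m\<close>, and
  \<open>k = n\<close>.\<close>

lemma jdt_functional: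
  assumes "jdt l k n m" "jdt l k' n m" "is_shape k" "is_shape k'" "is_shape l"
  shows "k = k'"
proof -
  have *: "p = (case u of None \<Rightarrow> None | Some x \<Rightarrow> if q = Some x then q
      else if \<exists>y. q = Some y \<and> x = Suc y \<and> l y = l x then q else u)"
    if k: "k = l \<oplus> p" and u: "m = n \<oplus> u" and n: "n = l \<oplus> q" and "jdt l k n m" "is_shape k" for k p q u
  proof -
    obtain v where "m = k \<oplus> v" "jdt_label l p q v"
      using \<open>jdt l k n m\<close> k n unfolding jdt_def by (metis add_cell_eq_iff)
    note v = this
    show ?thesis
    proof (cases "p = q")
      case True
      then have "u = v" using k u n v(1) by simp
      then show ?thesis using True v(2) by (cases p) (auto split: if_splits)
    next
      case False
      then have "n \<oplus> u = n \<oplus> p" using u v k n add_cell_commute by simp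
      then have "u = p" by simp
      moreover have "l x < l y" if "p = Some x" "x = Suc y" for x y
        using is_shape_add_cell_iff[OF assms(5), of x] \<open>is_shape k\<close> k that by auto
      ultimately show ?thesis using False by (cases p) auto
    qed
  qed
  obtain p where p: "k = l \<oplus> p" using assms(1) unfolding jdt_def by blast
  obtain p' where p': "k' = l \<oplus> p'" using assms(2) unfolding jdt_def by blast
  obtain q u where "n = l \<oplus> q" "m = n \<oplus> u" using jdt_swap[OF assms(1)] unfolding jdt_def by blast
  then show ?thesis using *[OF p _ _ assms(1,3)] *[OF p' _ _ assms(2,4)] p p' by blast
qed

text \<open>Each line of the triangle follows from the one before, starting with the empty shape on
  the diagonal and solving for one corner at a time by \<open>jdt_functional\<close>.\<close>

lemma triangle_eq_top:
  assumes "triangle N J" "triangle N' J'" "M \<le> N" "M \<le> N'"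
    and top: "\<And>a. a \<le> M \<Longrightarrow> J 0 a = J' 0 a"
  shows "i \<le> a \<Longrightarrow> a \<le> M \<Longrightarrow> J i a = J' i a"
proof (induction i arbitrary: a)
  case 0
  then show ?case using top by simp
next
  case (Suc i)
  have "J (Suc i) a = J' (Suc i) a" if "Suc i \<le> a" "a \<le> M" for a
    using that
  proof (induction rule: dec_induct)
    case base
    then show ?case using assms by (simp add: triangle_def)
  next
    case (step a)
    show ?case
    proof (rule jdt_functional)
      show "jdt (J (Suc i) a) (J (Suc i) (Suc a)) (J i a) (J i (Suc a))"
        using assms(1,3) step.hyps step.prems by (auto simp: triangle_def)
      have "jdt (J' (Suc i) a) (J' (Suc i) (Suc a)) (J' i a) (J' i (Suc a))"
        using assms(2,4) step.hyps step.prems by (auto simp: triangle_def)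
      then show "jdt (J (Suc i) a) (J' (Suc i) (Suc a)) (J i a) (J i (Suc a))"
        using step Suc.IH[of a] Suc.IH[of "Suc a"] by simp
      show "is_shape (J (Suc i) (Suc a))" "is_shape (J (Suc i) a)"
        using assms(1,3) step.hyps step.prems by (auto simp: triangle_def)
      show "is_shape (J' (Suc i) (Suc a))"
        using assms(2,4) step.hyps step.prems by (auto simp: triangle_def)
    qed
  qed
  then show ?case using Suc.prems by blast
qed

lemma triangle_eq_right:
  assumes "triangle N J" "triangle N J'"
    and right: "\<And>i. i \<le> N \<Longrightarrow> J i N = J' i N" and ia: "i \<le> a" "a \<le> N"
  shows "J i a = J' i a"
proof -
  have "J (N - (N - i)) (N - (N - a)) = J' (N - (N - i)) (N - (N - a))"
    by (rule triangle_eq_top[OF triangle_reverse[OF assms(1)] triangle_reverse[OF assms(2)] order_refl order_refl])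
      (use right ia in auto)
  then show ?thesis using ia by simp
qed

lemma triangle_right:
  assumes "triangle N J" "i \<le> a" "a < N"
  shows "\<exists>p. J i (Suc a) = J i a \<oplus> p"
proof (cases "i = a")
  case True
  then show ?thesis using assms by (simp add: triangle_def)
next
  case False
  then have "jdt (J (Suc i) a) (J (Suc i) (Suc a)) (J i a) (J i (Suc a))"
    using assms by (auto simp: triangle_def)
  from jdt_swap[OF this] show ?thesis unfolding jdt_def by blast
qed

lemma triangle_left:
  assumes "triangle N J" "i < a" "a \<le> N"
  shows "\<exists>p. J i a = J (Suc i) a \<oplus> p"
proof -
  have "N - Suc (N - Suc i) = i" "N - (N - Suc i) = Suc i" "N - (N - a) = a" using assms by auto
  then show ?thesis
    using triangle_right[OF triangle_reverse[OF assms(1)], of "N - a" "N - Suc i"] assms by auto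
qed

lemma triangle_mono:
  assumes "triangle N J" "i \<le> a" "a \<le> b" "b \<le> N"
  shows "J i a x \<le> J i b x"
  using assms(3,4)
proof (induction rule: dec_induct)
  case (step b)
  then obtain p where "J i (Suc b) = J i b \<oplus> p" using triangle_right[OF assms(1), of i b] assms(2) by auto
  then show ?case using step le_add_cell[of "J i b" x p] by simp
qed simp

text \<open>All that the study of slides uses of \<open>chain_matrix\<close>: a triangle whose top
  side is the chain and whose right side consists of complements once the box is full.\<close>

lemma chain_matrix_triangle:
  assumes W: "is_chain W" "\<And>a x. W a x \<le> box h w x"
  obtains J where "\<And>N. triangle N J" "\<And>a. J 0 a = W a"
    "\<And>N i. W N = box h w \<Longrightarrow> i \<le> N \<Longrightarrow> J i N = box_compl h w (W i)"
proof -
  let ?J = "\<lambda>i a. rsk (chain_matrix W) (rev [Suc i..<Suc a]) (all_cells h w)"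
  show ?thesis
  proof (rule that)
    show "triangle N ?J" for N
      by (rule triangle_rsk[OF pbij_chain_matrix[OF W(1)] distinct_all_cells])
    show "?J 0 a = W a" for a using rsk_chain_matrix[OF W, of a] by simp
    show "?J i N = box_compl h w (W i)" if "W N = box h w" "i \<le> N" for N i
      by (rule rsk_chain_matrix_suffix[OF W that])
  qed
qed

lemma chain_between:
  assumes "is_shape f" "is_shape g" "\<And>x. f x \<le> g x"
  shows "\<exists>V M. V 0 = f \<and> (\<forall>a \<ge> M. V a = g) \<and> (\<forall>a. is_shape (V a)) \<and>
    (\<forall>a < M. \<exists>k. V (Suc a) = V a \<oplus> Some k)"
proof -
  obtain h where h: "\<forall>x\<ge>h. g x = 0" using is_shape_eventually_zero[OF assms(2)] by blast
  show ?thesis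
    using assms(1,3)
  proof (induction "\<Sum>x<h. g x - f x" arbitrary: f rule: less_induct)
    case less
    show ?case
    proof (cases "f = g")
      case True
      then show ?thesis using less.prems by (intro exI[of _ "\<lambda>_. f"] exI[of _ 0]) simp
    next
      case False
      then have "\<exists>x. f x \<noteq> g x" by auto
      \<comment> \<open>The first row in which the shapes differ can take a cell, as the row above
        already has its length in \<open>g\<close>.\<close>
      define y where "y = (LEAST x. f x \<noteq> g x)"
      have y: "f y \<noteq> g y" unfolding y_def by (rule LeastI_ex) fact
      have below: "f x = g x" if "x < y" for x using that not_less_Least unfolding y_def by blast
      have fy: "f y < g y" using y less.prems(2)[of y] by simp
      then have yh: "y < h" using h by (metis not_less less_nat_zero_code)
      let ?g = "f \<oplus> Some y"
      have "y = 0 \<or> f y < f (y - 1)"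
      proof (cases "y = 0")
        case False
        have "g y \<le> g (y - 1)" by (rule is_shape_antimono[OF assms(2)]) simp
        then show ?thesis using fy below[of "y - 1"] False by simp
      qed simp
      then have g: "is_shape ?g" using is_shape_add_cell_iff[OF less.prems(1)] by blast
      have gb: "?g x \<le> g x" for x using less.prems(2)[of x] fy by (auto simp: add_cell_apply)
      have "(\<Sum>x<h. g x - ?g x) < (\<Sum>x<h. g x - f x)"
      proof (rule sum_strict_mono_ex1)
        show "\<forall>x\<in>{..<h}. g x - ?g x \<le> g x - f x" by (auto intro!: diff_le_mono2 le_add_cell simp del: add_cell.simps)
        show "\<exists>a\<in>{..<h}. g a - ?g a < g a - f a" using yh fy by (intro bexI[of _ y]) auto
      qed simp
      from less.hyps[OF this g gb] obtain V M where V: "V 0 = ?g" "\<And>a. M \<le> a \<Longrightarrow> V a = g"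
        "\<And>a. is_shape (V a)" "\<And>a. a < M \<Longrightarrow> \<exists>k. V (Suc a) = V a \<oplus> Some k" by blast
      define V' where "V' a = (case a of 0 \<Rightarrow> f | Suc a \<Rightarrow> V a)" for a
      have "V' 0 = f" by (simp add: V'_def)
      moreover have "\<forall>a \<ge> Suc M. V' a = g" using V(2) by (auto simp: V'_def split: nat.splits)
      moreover have "\<forall>a. is_shape (V' a)" using V(3) less.prems(1) by (auto simp: V'_def split: nat.splits)
      moreover have "\<exists>k. V' (Suc a) = V' a \<oplus> Some k" if "a < Suc M" for a
        using V(1) V(4)[of "a - 1"] that by (cases a) (auto simp: V'_def simp del: add_cell.simps)
      ultimately show ?thesis by blast
    qed
  qed
qed

lemma is_shape_box: "is_shape (box h w)"
  by (rule is_shapeI[where n = h]) (auto simp: box_def)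

section \<open>Jeu de taquin\<close>

text \<open>\<open>D\<close> is a skew tableau that fills the box, and \<open>S\<close> prescribes
  the order in which its inner cells are removed by slides. The lines \<open>K t\<close> are the
  tableaux in between, and the last one is \<open>T 0\<close> whatever \<open>S\<close> is. The
  final inequality keeps the inner shape visible, see \<open>inner_shape_skew\<close>.\<close>

lemma growth_rectangle:
  assumes D: "\<And>a. a \<le> r \<Longrightarrow> is_shape (D a)" "\<And>a. a < r \<Longrightarrow> \<exists>p. D (Suc a) = D a \<oplus> p" "D r = box h w"
    and \<alpha>: "\<And>x. D 0 x \<le> box (h - 1) (w - 1) x"
    and T: "triangle r T" "\<And>i. i \<le> r \<Longrightarrow> T i r = box_compl h w (D i)"
    and S: "S 0 = (\<lambda>_. 0)" "S m = D 0" "\<And>t. t < m \<Longrightarrow> \<exists>k. S (Suc t) = S t \<oplus> Some k"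
      "\<And>t. t \<le> m \<Longrightarrow> is_shape (S t)"
  obtains K where "\<And>a. a \<le> r \<Longrightarrow> K m a = D a" "\<And>t. t \<le> m \<Longrightarrow> K t 0 = S t" "\<And>a. a \<le> r \<Longrightarrow> K 0 a = T 0 a"
    "\<And>t a. t \<le> m \<Longrightarrow> a \<le> r \<Longrightarrow> is_shape (K t a)"
    "\<And>t a. t < m \<Longrightarrow> a < r \<Longrightarrow> jdt (K t a) (K t (Suc a)) (K (Suc t) a) (K (Suc t) (Suc a))"
    "\<And>t x. t \<le> m \<Longrightarrow> 0 < K t 0 x \<Longrightarrow> K t 0 x < K t r x"
proof -
  define S' where "S' t = S (min t m)" for t
  have S': "is_chain S'"
    unfolding is_chain_def
  proof (intro conjI allI)
    show "\<exists>p. S' (Suc a) = S' a \<oplus> p" for a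
    proof (cases "a < m")
      case True
      then show ?thesis using S(3)[of a] by (auto simp: S'_def min_def simp del: add_cell.simps)
    next
      case False
      then show ?thesis by (auto simp: S'_def min_def intro!: exI[of _ None])
    qed
  qed (use S in \<open>auto simp: S'_def\<close>)
  have small: "box (h - 1) (w - 1) x \<le> box h w x" for x by (auto simp: box_def)
  have S'_le: "S' t x \<le> D 0 x" for t x
    using chain_mono[OF S', of t "max t m" x] S(2) by (simp add: S'_def)
  have S'_box: "S' t x \<le> box h w x" for t x
    using S'_le \<alpha> small by (meson order_trans)
  obtain J' where J': "\<And>N. triangle N J'" "\<And>a. J' 0 a = S' a"
    by (rule chain_matrix_triangle[OF S' S'_box]) blast
  \<comment> \<open>The first \<open>m\<close> steps fill \<open>D 0\<close> along the evacuation of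
    \<open>S\<close>; reversing the triangle over them restores \<open>S\<close> as the side
    \<open>K t 0\<close>.\<close>
  define W where "W a = (if a \<le> m then J' (m - a) m else D (min (a - m) r))" for a
  have Wm: "W (m + a) = D a" if "a \<le> r" for a
    using that J'(2)[of m] S(2) by (auto simp: W_def S'_def)
  have W: "is_chain W"
    unfolding is_chain_def
  proof (intro conjI allI)
    show "W 0 = (\<lambda>_. 0)" using J'(1)[of m] by (simp add: W_def triangle_def)
    show "is_shape (W a)" for a using J'(1)[of m] D(1) by (auto simp: W_def triangle_def)
    show "\<exists>p. W (Suc a) = W a \<oplus> p" for a
    proof (cases "a < m")
      case True
      then have "m - a = Suc (m - Suc a)" by simp
      then show ?thesis using triangle_left[OF J'(1)[of m], of "m - Suc a" m] True by (simp add: W_def)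
    next
      case False
      then have e: "W a = D (min (a - m) r)" "W (Suc a) = D (min (Suc (a - m)) r)"
        using Wm[of 0] by (auto simp: W_def Suc_diff_le)
      show ?thesis
      proof (cases "a - m < r")
        case True
        then show ?thesis unfolding e using D(2)[of "a - m"] by (simp add: min_def)
      next
        case False
        then show ?thesis unfolding e by (auto simp: min_def intro!: exI[of _ None])
      qed
    qed
  qed
  let ?N = "m + r"
  have WN: "W a = box h w" if "?N \<le> a" for a
    using that Wm[of r] D(3) by (cases "a = m + r") (auto simp: W_def)
  have W_box: "W a x \<le> box h w x" for a x
    using chain_mono[OF W, of a "max a ?N" x] WN[of "max a ?N"] by simp
  obtain J where J: "\<And>N. triangle N J" "\<And>a. J 0 a = W a"
    "\<And>N i. W N = box h w \<Longrightarrow> i \<le> N \<Longrightarrow> J i N = box_compl h w (W i)"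
    by (rule chain_matrix_triangle[OF W W_box]) blast
  define K where "K t a = J (m - t) (m + a)" for t a
  show ?thesis
  proof (rule that)
    show "K m a = D a" if "a \<le> r" for a using J(2) Wm[OF that] by (simp add: K_def)
    have J_rev: "J i a = J' (m - a) (m - i)" if "i \<le> a" "a \<le> m" for i a
      by (rule triangle_eq_top[OF J(1)[of m] triangle_reverse[OF J'(1)[of m]] order_refl order_refl _ that])
        (simp add: J(2) W_def)
    show "K t 0 = S t" if "t \<le> m" for t
      using J_rev[of "m - t" m] J'(2) that by (simp add: K_def S'_def)
    show "K 0 a = T 0 a" if "a \<le> r" for a
    proof -
      \<comment> \<open>Beyond \<open>m\<close>, the right side of \<open>J\<close> consists of the
        complements of \<open>D\<close>, as that of \<open>T\<close> does, so both triangles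
        agree.\<close>
      have "triangle r (\<lambda>i a. J (m + i) (m + a))"
        using J(1)[of ?N] unfolding triangle_def by auto
      moreover have "J (m + i) (m + r) = T i r" if "i \<le> r" for i
        using J(3)[of ?N "m + i"] WN[of ?N] Wm[OF that] T(2)[OF that] that by simp
      ultimately have "J (m + 0) (m + a) = T 0 a"
        using triangle_eq_right[OF _ T(1), of "\<lambda>i a. J (m + i) (m + a)" 0 a] that by blast
      then show ?thesis by (simp add: K_def)
    qed
    show "is_shape (K t a)" if "t \<le> m" "a \<le> r" for t a
      using J(1)[of ?N] that by (auto simp: K_def triangle_def)
    show "jdt (K t a) (K t (Suc a)) (K (Suc t) a) (K (Suc t) (Suc a))" if "t < m" "a < r" for t a
    proof -
      have "m - t = Suc (m - Suc t)" using that by simp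
      then show ?thesis using J(1)[of ?N] that by (auto simp: K_def triangle_def)
    qed
    show "K t 0 x < K t r x" if t: "t \<le> m" and pos: "0 < K t 0 x" for t x
    proof -
      \<comment> \<open>For comparison, \<open>D 0\<close> is also completed to the smaller box. The
        shape \<open>K t 0\<close> depends on the first \<open>m\<close> steps only, so it is
        contained in the complement of \<open>W i\<close> in the smaller box. In nonempty rows this
        is strictly shorter than the complement in the larger box, which is
        \<open>K t r\<close>.\<close>
      obtain V M where V: "V 0 = D 0" "\<And>a. M \<le> a \<Longrightarrow> V a = box (h - 1) (w - 1)" "\<And>a. is_shape (V a)"
        "\<And>a. a < M \<Longrightarrow> \<exists>k. V (Suc a) = V a \<oplus> Some k"
        using chain_between[OF D(1)[of 0] is_shape_box \<alpha>] by blast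
      define U where "U a = (if a \<le> m then W a else V (a - m))" for a
      have Um: "U (m + a) = V a" for a using V(1) Wm[of 0] by (cases "a = 0") (auto simp: U_def)
      have U: "is_chain U"
        unfolding is_chain_def
      proof (intro conjI allI)
        show "U 0 = (\<lambda>_. 0)" "is_shape (U a)" for a using W V(3) by (auto simp: U_def is_chain_def)
        show "\<exists>p. U (Suc a) = U a \<oplus> p" for a
        proof (cases "a < m")
          case True
          then show ?thesis using W by (auto simp: U_def is_chain_def)
        next
          case False
          then obtain b where b: "a = m + b" by (metis le_Suc_ex not_less)
          have "\<exists>p. V (Suc b) = V b \<oplus> p"
          proof (cases "b < M")
            case True
            then show ?thesis using V(4) by blast
          next
            case False
            then show ?thesis using V(2)[of b] V(2)[of "Suc b"] by (auto intro!: exI[of _ None])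
          qed
          then show ?thesis using Um[of b] Um[of "Suc b"] b by simp
        qed
      qed
      have U_end: "U a = box (h - 1) (w - 1)" if "m + M \<le> a" for a
        using Um[of "a - m"] V(2)[of "a - m"] that by simp
      have U_box: "U a x \<le> box (h - 1) (w - 1) x" for a x
        using chain_mono[OF U, of a "max a (m + M)" x] U_end[of "max a (m + M)"] by simp
      obtain I where I: "\<And>N. triangle N I" "\<And>a. I 0 a = U a"
        "\<And>N i. U N = box (h - 1) (w - 1) \<Longrightarrow> i \<le> N \<Longrightarrow> I i N = box_compl (h - 1) (w - 1) (U i)"
        by (rule chain_matrix_triangle[OF U U_box]) blast
      define i where "i = m - t"
      have i: "i \<le> m" by (simp add: i_def)
      have "J i m = I i m"
        by (rule triangle_eq_top[OF J(1)[of m] I(1)[of m] order_refl order_refl _ i order_refl])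
          (simp add: J(2) I(2) U_def)
      then have "K t 0 x = I i m x" by (simp add: K_def i_def)
      also have "\<dots> \<le> I i (m + M) x"
        by (rule triangle_mono[OF I(1)[of "m + M"]]) (use i in auto)
      also have "I i (m + M) = box_compl (h - 1) (w - 1) (W i)"
        using I(3)[of "m + M" i] U_end[of "m + M"] i by (simp add: U_def)
      finally have le: "K t 0 x \<le> box_compl (h - 1) (w - 1) (W i) x" .
      have x: "x < h - 1"
        using le pos by (cases "x < h - 1") (auto simp: box_compl_def)
      have K: "K t r = box_compl h w (W i)"
        using J(3)[of ?N i] WN[of ?N] i by (simp add: K_def i_def)
      have "is_shape (W i)" using W by (simp add: is_chain_def)
      then have anti: "W i (h - 1 - x) \<le> W i (h - 1 - 1 - x)" by (rule is_shape_antimono) simp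
      have arith: "k < k'" if "k \<le> (w - 1) - a" "k' = w - b" "b \<le> a" "0 < k" for k k' a b
        using that by linarith
      have "K t 0 x \<le> (w - 1) - W i (h - 1 - 1 - x)" using le x by (simp add: box_compl_def)
      moreover have "K t r x = w - W i (h - 1 - x)" unfolding K using x by (simp add: box_compl_def)
      ultimately show ?thesis by (rule arith[OF _ _ anti pos])
    qed
  qed
qed

text \<open>\<open>slide\<close> together with the final position of the hole, which an induction
  over the entries has to know.\<close>

inductive slide_to :: "tableau \<Rightarrow> nat \<times> nat \<Rightarrow> tableau \<Rightarrow> nat \<times> nat \<Rightarrow> bool" where
  stop: "T (i, Suc j) = None \<Longrightarrow> T (Suc i, j) = None \<Longrightarrow> slide_to T (i, j) T (i, j)"
| right: "T (i, Suc j) = Some x \<Longrightarrow> (\<And>y. T (Suc i, j) = Some y \<Longrightarrow> x < y) \<Longrightarrow>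
    slide_to (T((i, j) := Some x, (i, Suc j) := None)) (i, Suc j) U h \<Longrightarrow> slide_to T (i, j) U h"
| below: "T (Suc i, j) = Some y \<Longrightarrow> (\<And>x. T (i, Suc j) = Some x \<Longrightarrow> y < x) \<Longrightarrow>
    slide_to (T((i, j) := Some y, (Suc i, j) := None)) (Suc i, j) U h \<Longrightarrow> slide_to T (i, j) U h"

lemma slide_to_imp_slide: "slide_to T c U h \<Longrightarrow> slide T c U"
proof (induction rule: slide_to.induct)
  case (stop T i j)
  then show ?case by (rule slide.stop)
next
  case (right T i j x U h)
  show ?case by (rule slide.right[OF right(1,2,4)])
next
  case (below T i j y U h)
  show ?case by (rule slide.below[OF below(1,2,4)])
qed

lemma slide_functional: "slide T c U \<Longrightarrow> slide T c U' \<Longrightarrow> U = U'"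
proof (induction arbitrary: U' rule: slide.induct)
  case (stop T i j)
  from stop(3,1,2) show ?case by (cases rule: slide.cases) auto
next
  case r: (right T i j x U)
  from r(5) show ?case
  proof (cases rule: slide.cases)
    case stop
    then show ?thesis using r(1) by simp
  next
    case (right z)
    then have "z = x" using r(1) by simp
    then show ?thesis using r(4) right(3) by blast
  next
    case (below y)
    then show ?thesis using r(2)[OF below(1)] below(2)[OF r(1)] by simp
  qed
next
  case b: (below T i j y U)
  from b(5) show ?case
  proof (cases rule: slide.cases)
    case stop
    then show ?thesis using b(1) by simp
  next
    case (right x)
    then show ?thesis using b(2)[OF right(1)] right(2)[OF b(1)] by simp
  next
    case (below z)
    then have "z = y" using b(1) by simp
    then show ?thesis using b(4) below(3) by blast
  qed
qed

lemma if_imp: "(if b then P else Q) \<Longrightarrow> (P \<Longrightarrow> P') \<Longrightarrow> (Q \<Longrightarrow> Q') \<Longrightarrow> (if b then P' else Q')"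
  by simp

text \<open>A new largest entry loses every comparison, so the hole takes its old way. If it ends
  next to \<open>d\<close>, it finally changes places with the new entry and stops there, because
  \<open>d\<close> has no neighbours to the right or below.\<close>

lemma slide_to_extend:
  assumes "slide_to T c U h" "T d = None" "T (fst d, Suc (snd d)) = None" "T (Suc (fst d), snd d) = None"
    "\<And>e y. T e = Some y \<Longrightarrow> y < x" "c \<notin> {d, (fst d, Suc (snd d)), (Suc (fst d), snd d)}"
  shows "if d = (fst h, Suc (snd h)) \<or> d = (Suc (fst h), snd h)
    then slide_to (T(d := Some x)) c (U(h := Some x)) d else slide_to (T(d := Some x)) c (U(d := Some x)) h"
  using assms
proof (induction rule: slide_to.induct)
  case (stop T i j)
  consider "d = (i, Suc j)" | "d = (Suc i, j)" | "d \<noteq> (i, Suc j)" "d \<noteq> (Suc i, j)" by blast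
  then show ?case
  proof cases
    case 1
    have e: "(T(d := Some x))((i, j) := Some x, (i, Suc j) := None) = T((i, j) := Some x)"
      using stop.prems 1 by (auto simp: fun_eq_iff)
    have "slide_to (T((i, j) := Some x)) (i, Suc j) (T((i, j) := Some x)) (i, Suc j)"
      by (rule slide_to.stop) (use stop.prems 1 in auto)
    then have "slide_to (T(d := Some x)) (i, j) (T((i, j) := Some x)) (i, Suc j)"
      unfolding e[symmetric] by (rule slide_to.right[rotated 2]) (use stop.hyps 1 in auto)
    then show ?thesis using 1 by simp
  next
    case 2
    have e: "(T(d := Some x))((i, j) := Some x, (Suc i, j) := None) = T((i, j) := Some x)"
      using stop.prems 2 by (auto simp: fun_eq_iff)
    have "slide_to (T((i, j) := Some x)) (Suc i, j) (T((i, j) := Some x)) (Suc i, j)"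
      by (rule slide_to.stop) (use stop.prems 2 in auto)
    then have "slide_to (T(d := Some x)) (i, j) (T((i, j) := Some x)) (Suc i, j)"
      unfolding e[symmetric] by (rule slide_to.below[rotated 2]) (use stop.hyps 2 in auto)
    then show ?thesis using 2 by simp
  next
    case 3
    then have "slide_to (T(d := Some x)) (i, j) (T(d := Some x)) (i, j)"
      by (intro slide_to.stop) (use stop in auto)
    then show ?thesis using 3 by simp
  qed
next
  case (right T i j y U h)
  have d: "d \<noteq> (i, Suc j)" "d \<noteq> (i, j)" using right by auto
  have tw: "(T(d := Some x))((i, j) := Some y, (i, Suc j) := None) = (T((i, j) := Some y, (i, Suc j) := None))(d := Some x)"
    using d by (auto simp: fun_eq_iff)
  have R: "slide_to (T(d := Some x)) (i, j) U' h'"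
    if "slide_to ((T((i, j) := Some y, (i, Suc j) := None))(d := Some x)) (i, Suc j) U' h'" for U' h'
  proof (rule slide_to.right)
    show "(T(d := Some x)) (i, Suc j) = Some y" using right.hyps(1) d by simp
    show "y < z" if "(T(d := Some x)) (Suc i, j) = Some z" for z
      using that right.hyps(2)[of z] right.prems(4)[OF right.hyps(1)] by (cases "d = (Suc i, j)") auto
    show "slide_to ((T(d := Some x))((i, j) := Some y, (i, Suc j) := None)) (i, Suc j) U' h'"
      unfolding tw by (rule that)
  qed
  have "if d = (fst h, Suc (snd h)) \<or> d = (Suc (fst h), snd h)
    then slide_to ((T((i, j) := Some y, (i, Suc j) := None))(d := Some x)) (i, Suc j) (U(h := Some x)) d
    else slide_to ((T((i, j) := Some y, (i, Suc j) := None))(d := Some x)) (i, Suc j) (U(d := Some x)) h"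
  proof (rule right.IH)
    show "y' < x" if "(T((i, j) := Some y, (i, Suc j) := None)) e = Some y'" for e y'
      using that right.prems(4)[OF right.hyps(1)] right.prems(4)[of e y'] by (auto simp: fun_upd_def split: if_splits)
  qed (use right.prems(1-3,5) right.hyps(1) d in auto)
  then show ?case by (rule if_imp) (erule R)+
next
  case (below T i j y U h)
  have d: "d \<noteq> (Suc i, j)" "d \<noteq> (i, j)" using below by auto
  have tw: "(T(d := Some x))((i, j) := Some y, (Suc i, j) := None) = (T((i, j) := Some y, (Suc i, j) := None))(d := Some x)"
    using d by (auto simp: fun_eq_iff)
  have R: "slide_to (T(d := Some x)) (i, j) U' h'"
    if "slide_to ((T((i, j) := Some y, (Suc i, j) := None))(d := Some x)) (Suc i, j) U' h'" for U' h'
  proof (rule slide_to.below)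
    show "(T(d := Some x)) (Suc i, j) = Some y" using below.hyps(1) d by simp
    show "y < z" if "(T(d := Some x)) (i, Suc j) = Some z" for z
      using that below.hyps(2)[of z] below.prems(4)[OF below.hyps(1)] by (cases "d = (i, Suc j)") auto
    show "slide_to ((T(d := Some x))((i, j) := Some y, (Suc i, j) := None)) (Suc i, j) U' h'"
      unfolding tw by (rule that)
  qed
  have "if d = (fst h, Suc (snd h)) \<or> d = (Suc (fst h), snd h)
    then slide_to ((T((i, j) := Some y, (Suc i, j) := None))(d := Some x)) (Suc i, j) (U(h := Some x)) d
    else slide_to ((T((i, j) := Some y, (Suc i, j) := None))(d := Some x)) (Suc i, j) (U(d := Some x)) h"
  proof (rule below.IH)
    show "y' < x" if "(T((i, j) := Some y, (Suc i, j) := None)) e = Some y'" for e y'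
      using that below.prems(4)[OF below.hyps(1)] below.prems(4)[of e y'] by (auto simp: fun_upd_def split: if_splits)
  qed (use below.prems(1-3,5) below.hyps(1) d in auto)
  then show ?case by (rule if_imp) (erule R)+
qed

text \<open>A recursive counterpart of \<open>tableau_of_chain\<close>, suited to adding the largest
  entry last; the chain may start with a nonempty shape.\<close>

fun chain_tab :: "(nat \<Rightarrow> shape) \<Rightarrow> nat \<Rightarrow> tableau" where
  "chain_tab D 0 = (\<lambda>_. None)"
| "chain_tab D (Suc r) = (\<lambda>(i, j). if D r i \<le> j \<and> j < D (Suc r) i then Some (Suc r) else chain_tab D r (i, j))"

lemma chain_tab_cong: "(\<And>a. a \<le> r \<Longrightarrow> D a = D' a) \<Longrightarrow> chain_tab D r = chain_tab D' r"
  by (induction r) auto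

lemma chain_tab_entry: "chain_tab D r c = Some y \<Longrightarrow> 1 \<le> y \<and> y \<le> r"
  by (induction r arbitrary: c) (force split: if_splits prod.splits)+

lemma chain_tab_dom:
  assumes "\<And>a i. a < r \<Longrightarrow> D a i \<le> D (Suc a) i"
  shows "dom (chain_tab D r) = {(i, j). D 0 i \<le> j \<and> j < D r i} \<and> (\<forall>i. D 0 i \<le> D r i)"
  using assms
proof (induction r)
  case (Suc r)
  then have IH: "dom (chain_tab D r) = {(i, j). D 0 i \<le> j \<and> j < D r i}" "\<And>i. D 0 i \<le> D r i" by auto
  have "D r i \<le> D (Suc r) i" for i using Suc.prems by simp
  then have le: "D 0 i \<le> D (Suc r) i" "D r i \<le> D (Suc r) i" for i using IH(2) order_trans by blast+
  have "(i, j) \<in> dom (chain_tab D (Suc r)) \<longleftrightarrow> D 0 i \<le> j \<and> j < D (Suc r) i" for i j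
  proof -
    have "(i, j) \<in> dom (chain_tab D (Suc r)) \<longleftrightarrow> D r i \<le> j \<and> j < D (Suc r) i \<or> (i, j) \<in> dom (chain_tab D r)"
      by (auto simp: dom_def)
    also have "\<dots> \<longleftrightarrow> D 0 i \<le> j \<and> j < D (Suc r) i"
      unfolding IH(1) using le[of i] IH(2)[of i] by auto
    finally show ?thesis .
  qed
  then have "dom (chain_tab D (Suc r)) = {(i, j). D 0 i \<le> j \<and> j < D (Suc r) i}"
    by (intro set_eqI) (simp only: split_paired_all mem_Collect_eq case_prod_conv)
  then show ?case using le by blast
qed simp

lemma chain_tab_Suc_add_cell:
  "D (Suc r) = D r \<oplus> Some k \<Longrightarrow> chain_tab D (Suc r) = (chain_tab D r)((k, D r k) := Some (Suc r))"
  by (auto simp: fun_eq_iff)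

lemma chain_tab_Suc_same: "D (Suc r) = D r \<Longrightarrow> chain_tab D (Suc r) = chain_tab D r"
  by (auto simp: fun_eq_iff)

text \<open>Restricted to the entries up to \<open>s\<close>, the slide leaves its hole at the
  single cell by which \<open>D s\<close> exceeds \<open>D' s\<close>. One square of the rule of jeu
  de taquin describes how the entry \<open>Suc s\<close> affects the hole.\<close>

lemma slide_chain_tab:
  assumes shapes: "\<And>a. a \<le> r \<Longrightarrow> is_shape (D a)" "\<And>a. a \<le> r \<Longrightarrow> is_shape (D' a)"
    and grow: "\<And>a. a < r \<Longrightarrow> jdt (D' a) (D' (Suc a)) (D a) (D (Suc a))"
    and start: "D 0 = D' 0 \<oplus> Some k"
  shows "slide (chain_tab D r) (k, D' 0 k) (chain_tab D' r)"
proof -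
  have "\<exists>k'. D s = D' s \<oplus> Some k' \<and> slide_to (chain_tab D s) (k, D' 0 k) (chain_tab D' s) (k', D' s k')" if "s \<le> r" for s
    using that
  proof (induction s)
    case 0
    show ?case using start by (intro exI[of _ k]) (simp add: slide_to.stop del: add_cell.simps)
  next
    case (Suc s)
    have "s \<le> r" using Suc.prems by simp
    then obtain k' where k': "D s = D' s \<oplus> Some k'"
      and sl: "slide_to (chain_tab D s) (k, D' 0 k) (chain_tab D' s) (k', D' s k')" using Suc.IH by blast
    have mono: "D a i \<le> D (Suc a) i" if "a < r" for a i
      using jdt_swap[OF grow[OF that]] unfolding jdt_def by (auto simp: le_add_cell)
    have dom: "dom (chain_tab D s) = {(i, j). D 0 i \<le> j \<and> j < D s i}" and le0: "D 0 i \<le> D s i" for i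
      using chain_tab_dom[of s D] mono Suc.prems by auto
    have shape_s: "is_shape (D s)" "is_shape (D' (Suc s))" "is_shape (D' s)" using shapes Suc.prems by auto
    obtain p v where p: "D' (Suc s) = D' s \<oplus> p" and v: "D (Suc s) = D' s \<oplus> p \<oplus> v" "jdt_label (D' s) p (Some k') v"
      using grow[of s] Suc.prems k' unfolding jdt_def by (metis Suc_le_eq add_cell_eq_iff)
    have c: "(k, D' 0 k) \<notin> {d, (fst d, Suc (snd d)), (Suc (fst d), snd d)}" "chain_tab D s d = None"
      "chain_tab D s (fst d, Suc (snd d)) = None" "chain_tab D s (Suc (fst d), snd d) = None"
      if d: "d = (y, D s y)" for d y
    proof -
      have out: "chain_tab D s (i, j) = None" if "D s i \<le> j" for i j
      proof -
        have "(i, j) \<notin> dom (chain_tab D s)" unfolding dom using that by simp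
        then show ?thesis by (simp only: domIff not_not)
      qed
      have le: "D s (Suc y) \<le> D s y" using is_shape_antimono[OF shape_s(1)] by simp
      show "chain_tab D s d = None" "chain_tab D s (fst d, Suc (snd d)) = None" "chain_tab D s (Suc (fst d), snd d) = None"
        using out le d by auto
      have "D' 0 k < D s k" using le0[of k] start by simp
      then show "(k, D' 0 k) \<notin> {d, (fst d, Suc (snd d)), (Suc (fst d), snd d)}"
        using le d by auto
    qed
    have entries: "y < Suc s" if "chain_tab D s e = Some y" for e y using chain_tab_entry[OF that] by simp
    show ?case
    proof (cases p)
      case None
      then have "v = Some k'" using v(2) by simp
      then have same: "D (Suc s) = D s" "D' (Suc s) = D' s" using v(1) k' p None by simp_all
      show ?thesis unfolding chain_tab_Suc_same[OF same(1)] chain_tab_Suc_same[OF same(2)] unfolding same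
        using k' sl by blast
    next
      case (Some y)
      show ?thesis
      proof (cases "y = k'")
        case False
        then have vk: "v = Some k'" using v(2) Some by simp
        have Dy: "D s y = D' s y" using k' False by simp
        have D1: "D (Suc s) = D s \<oplus> Some y" using v(1) k' vk Some add_cell_commute by metis
        have D2: "D' (Suc s) = D' s \<oplus> Some y" using p Some by simp
        have D3: "D (Suc s) = D' (Suc s) \<oplus> Some k'" using v(1) p vk by simp
        have h: "(k', D' (Suc s) k') = (k', D' s k')" using D2 False by simp
        have "D' s (Suc k') < D' s k'" if "y = Suc k'"
          using is_shape_add_cell_iff[OF shape_s(3), of y] shape_s(2) D2 that by simp
        then have na: "\<not> ((y, D s y) = (fst (k', D' s k'), Suc (snd (k', D' s k'))) \<or> (y, D s y) = (Suc (fst (k', D' s k')), snd (k', D' s k')))"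
          using False Dy by auto
        have "slide_to ((chain_tab D s)((y, D s y) := Some (Suc s))) (k, D' 0 k) ((chain_tab D' s)((y, D s y) := Some (Suc s))) (k', D' s k')"
          using slide_to_extend[OF sl c(2)[where y = y, OF refl] c(3)[OF refl] c(4)[OF refl] entries c(1)[OF refl]]
          unfolding if_not_P[OF na] .
        then show ?thesis
          unfolding chain_tab_Suc_add_cell[of D, OF D1] chain_tab_Suc_add_cell[of D', OF D2]
          using D3 h Dy by metis
      next
        \<comment> \<open>\<open>D'\<close> grows at the hole itself: the entry \<open>Suc s\<close>
          moves into it, from the right for \<open>z = k'\<close> and from below for
          \<open>z = Suc k'\<close>.\<close>
        case True
        then obtain z where z: "v = Some z" "z = k' \<or> z = Suc k' \<and> D' s k' = D' s (Suc k')" using v(2) Some by auto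
        have D2: "D' (Suc s) = D s" using p Some True k' by simp
        have D1: "D (Suc s) = D s \<oplus> Some z" using v(1) z p D2 by simp
        have D4: "D' (Suc s) = D' s \<oplus> Some k'" using p Some True by simp
        have ad: "(z, D s z) = (fst (k', D' s k'), Suc (snd (k', D' s k'))) \<or> (z, D s z) = (Suc (fst (k', D' s k')), snd (k', D' s k'))"
          using z(2) k' by auto
        have "slide_to ((chain_tab D s)((z, D s z) := Some (Suc s))) (k, D' 0 k) ((chain_tab D' s)((k', D' s k') := Some (Suc s))) (z, D s z)"
          using slide_to_extend[OF sl c(2)[where y = z, OF refl] c(3)[OF refl] c(4)[OF refl] entries c(1)[OF refl]]
          unfolding if_P[OF ad] .
        then show ?thesis
          unfolding chain_tab_Suc_add_cell[of D, OF D1] chain_tab_Suc_add_cell[of D', OF D4]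
          using D1 D2 by metis
      qed
    qed
  qed
  then show ?thesis using slide_to_imp_slide by blast
qed

section \<open>Schuetzenberger evacuation\<close>

text \<open>\<open>inner_shape\<close> only sees the cells of the skew diagram. By
  \<open>free\<close> every nonempty row of \<open>\<beta>\<close> is followed by such a cell, so no
  part of \<open>\<beta>\<close> is lost.\<close>

lemma inner_shape_skew:
  assumes \<beta>: "is_shape \<beta>" "is_shape \<gamma>" and free: "\<And>x. 0 < \<beta> x \<Longrightarrow> \<beta> x < \<gamma> x"
  shows "inner_shape {(i, j). \<beta> i \<le> j \<and> j < \<gamma> i} = {(i, j). j < \<beta> i}"
proof (intro set_eqI, clarify)
  fix i j
  have "j < \<beta> i" if "\<not> (\<beta> i \<le> j \<and> j < \<gamma> i)" "l < \<gamma> k" "i \<le> k" "j \<le> l" for k l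
    using is_shape_antimono[OF \<beta>(2) that(3)] that by linarith
  moreover have "\<exists>k l. \<beta> k \<le> l \<and> l < \<gamma> k \<and> i \<le> k \<and> j \<le> l" if "j < \<beta> i"
    using free[of i] that by (intro exI[of _ i] exI[of _ "\<beta> i"]) auto
  ultimately show "(i, j) \<in> inner_shape {(i, j). \<beta> i \<le> j \<and> j < \<gamma> i} \<longleftrightarrow> (i, j) \<in> {(i, j). j < \<beta> i}"
    unfolding inner_shape_def by fastforce
qed

text \<open>Every tableau reachable by slides is a line of some growth rectangle over
  \<open>D\<close>, and all these rectangles share the last line \<open>T 0\<close>. This gives the
  uniqueness that the definite description requires.\<close>

lemma rectify_chain_tab:
  assumes D: "\<And>a. a \<le> r \<Longrightarrow> is_shape (D a)" "\<And>a. a < r \<Longrightarrow> \<exists>p. D (Suc a) = D a \<oplus> p" "D r = box h w"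
    and \<alpha>: "\<And>x. D 0 x \<le> box (h - 1) (w - 1) x"
    and T: "triangle r T" "\<And>i. i \<le> r \<Longrightarrow> T i r = box_compl h w (D i)"
  shows "rectify (chain_tab D r) = chain_tab (T 0) r"
proof -
  define full where "full m K \<longleftrightarrow> (\<forall>a \<le> r. K m a = D a) \<and> (\<forall>a \<le> r. K 0 a = T 0 a) \<and>
    (\<forall>t \<le> m. \<forall>a \<le> r. is_shape (K t a)) \<and>
    (\<forall>t < m. \<forall>a < r. jdt (K t a) (K t (Suc a)) (K (Suc t) a) (K (Suc t) (Suc a))) \<and>
    (\<forall>t < m. \<exists>k. K (Suc t) 0 = K t 0 \<oplus> Some k) \<and>
    (\<forall>t \<le> m. \<forall>x. 0 < K t 0 x \<longrightarrow> K t 0 x < K t r x)" for m and K :: "nat \<Rightarrow> nat \<Rightarrow> shape"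
  have full_D: "K m a = D a" and full_0: "K 0 a = T 0 a" if "full m K" "a \<le> r" for m K a
    using that unfolding full_def by simp_all
  have full_shape: "is_shape (K t a)" if "full m K" "t \<le> m" "a \<le> r" for m K t a
    using that unfolding full_def by simp
  have full_jdt: "jdt (K t a) (K t (Suc a)) (K (Suc t) a) (K (Suc t) (Suc a))" if "full m K" "t < m" "a < r" for m K t a
    using that unfolding full_def by simp
  have full_step: "\<exists>k. K (Suc t) 0 = K t 0 \<oplus> Some k" if "full m K" "t < m" for m K t
    using that unfolding full_def by (simp del: add_cell.simps)
  have full_free: "K t 0 x < K t r x" if "full m K" "t \<le> m" "0 < K t 0 x" for m K t x
    using that unfolding full_def by simp
  have full_ex: "\<exists>K. full m K \<and> (\<forall>t \<le> m. K t 0 = S t)"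
    if S: "S 0 = (\<lambda>_. 0)" "S m = D 0" "\<And>t. t < m \<Longrightarrow> \<exists>k. S (Suc t) = S t \<oplus> Some k"
      "\<And>t. t \<le> m \<Longrightarrow> is_shape (S t)" for S m
  proof -
    obtain K where K: "\<And>a. a \<le> r \<Longrightarrow> K m a = D a" "\<And>t. t \<le> m \<Longrightarrow> K t 0 = S t" "\<And>a. a \<le> r \<Longrightarrow> K 0 a = T 0 a"
      "\<And>t a. t \<le> m \<Longrightarrow> a \<le> r \<Longrightarrow> is_shape (K t a)"
      "\<And>t a. t < m \<Longrightarrow> a < r \<Longrightarrow> jdt (K t a) (K t (Suc a)) (K (Suc t) a) (K (Suc t) (Suc a))"
      "\<And>t x. t \<le> m \<Longrightarrow> 0 < K t 0 x \<Longrightarrow> K t 0 x < K t r x"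
      by (rule growth_rectangle[of r D h w T S m, OF D \<alpha> T S]) blast+
    have E: "\<exists>k. K (Suc t) 0 = K t 0 \<oplus> Some k" if "t < m" for t
      using K(2)[of t] K(2)[of "Suc t"] S(3)[of t] that by (simp del: add_cell.simps)
    show ?thesis unfolding full_def
      by (intro exI[of _ K] conjI allI impI) (assumption | rule K E)+
  qed
  have T0: "T 0 0 = (\<lambda>_. 0)" using T(1) by (simp add: triangle_def)
  have mono: "K t a i \<le> K t (Suc a) i" if h: "full m K" "t \<le> m" "a < r" for m K t a i
  proof (cases "t = m")
    case True
    obtain p where "D (Suc a) = D a \<oplus> p" using D(2) h(3) by blast
    then show ?thesis using h(1,3) True le_add_cell[of "D a" i p] by (simp add: full_def)
  next
    case False
    then obtain p where "K t (Suc a) = K t a \<oplus> p" using full_jdt[OF h(1) _ h(3), of t] h(2) unfolding jdt_def by auto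
    then show ?thesis using le_add_cell[of "K t a" i p] by simp
  qed
  have inner: "inner_shape (dom (chain_tab (K t) r)) = {(i, j). j < K t 0 i}" if "full m K" "t \<le> m" for m K t
  proof -
    have "dom (chain_tab (K t) r) = {(i, j). K t 0 i \<le> j \<and> j < K t r i}"
      using chain_tab_dom[of r "K t"] mono[OF that] by blast
    then show ?thesis using inner_shape_skew[OF full_shape[OF that] full_shape[OF that order_refl] full_free[OF that]] by simp
  qed
  have slide_K: "slide (chain_tab (K (Suc t)) r) (k, K t 0 k) (chain_tab (K t) r)"
    if "full m K" "t < m" "K (Suc t) 0 = K t 0 \<oplus> Some k" for m K t k
    by (rule slide_chain_tab[OF _ _ full_jdt[OF that(1,2)] that(3)]) (use that in \<open>auto intro: full_shape\<close>)
  have path: "jdt_step\<^sup>*\<^sup>* (chain_tab D r) (chain_tab (K t) r)" if h: "full m K" "t \<le> m" for m K t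
    using h(2)
  proof (induction rule: inc_induct)
    case base
    have "chain_tab (K m) r = chain_tab D r" by (rule chain_tab_cong) (rule full_D[OF h(1)])
    then show ?case by simp
  next
    case (step t)
    obtain k where k: "K (Suc t) 0 = K t 0 \<oplus> Some k" using full_step[OF h(1) step(2)] by blast
    have "is_shape (K t 0)" using full_shape[OF h(1), of t 0] step(2) by simp
    then have "K t 0 (Suc k) \<le> K t 0 k" by (rule is_shape_antimono) simp
    then have "inner_corner (dom (chain_tab (K (Suc t)) r)) (k, K t 0 k)"
      unfolding inner_corner_def using inner[OF h(1), of "Suc t"] step(2) k by simp
    then have "jdt_step (chain_tab (K (Suc t)) r) (chain_tab (K t) r)"
      unfolding jdt_step_def using slide_K[OF h(1) step(2) k] by blast
    then show ?case using step.IH by (rule rtranclp.rtrancl_into_rtrancl[rotated])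
  qed
  \<comment> \<open>A slide may start at a corner other than the one that \<open>K\<close> removes
    next. The left side below \<open>t\<close> is then replaced by a chain through
    \<open>\<beta>\<close>; the lines from \<open>t\<close> on stay the same because
    \<open>D\<close> and the left side determine them.\<close>
  have modify: "\<exists>m' K' t'. full m' K' \<and> t' < m' \<and> (\<forall>a \<le> r. K' (Suc t') a = K t a) \<and> K' t' 0 = \<beta>"
    if K: "full m K" "t \<le> m" and \<beta>: "is_shape \<beta>" "K t 0 = \<beta> \<oplus> Some k" for m K t \<beta> k
  proof -
    obtain V M where V: "V 0 = (\<lambda>_. 0)" "\<And>a. M \<le> a \<Longrightarrow> V a = \<beta>" "\<And>a. is_shape (V a)"
      "\<And>a. a < M \<Longrightarrow> \<exists>k. V (Suc a) = V a \<oplus> Some k"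
      using chain_between[OF is_shape_zero \<beta>(1)] by auto
    define S where "S x = (if x \<le> M then V x else K (t + (x - Suc M)) 0)" for x
    define m' where "m' = Suc M + (m - t)"
    have "S 0 = (\<lambda>_. 0)" using V(1) by (simp add: S_def)
    moreover have "S m' = D 0"
    proof -
      have "\<not> m' \<le> M" "t + (m' - Suc M) = m" using K(2) unfolding m'_def by linarith+
      then show ?thesis using full_D[OF K(1), of 0] by (simp add: S_def)
    qed
    moreover have "\<exists>k. S (Suc x) = S x \<oplus> Some k" if x: "x < m'" for x
    proof -
      consider "x < M" | "x = M" | "M < x" by linarith
      then show ?thesis
      proof cases
        case 1
        then show ?thesis using V(4) by (simp add: S_def del: add_cell.simps)
      next
        case 2
        then show ?thesis using V(2)[of M] \<beta>(2) by (auto simp: S_def)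
      next
        case 3
        then have "t + (x - M) = Suc (t + (x - Suc M))" "t + (x - Suc M) < m" using x K(2) unfolding m'_def by linarith+
        then show ?thesis using full_step[OF K(1), of "t + (x - Suc M)"] 3 by (simp add: S_def del: add_cell.simps)
      qed
    qed
    moreover have "is_shape (S x)" if "x \<le> m'" for x
    proof -
      have "t + (x - Suc M) \<le> m" if "\<not> x \<le> M" using \<open>x \<le> m'\<close> K(2) that unfolding m'_def by linarith
      then have "is_shape (K (t + (x - Suc M)) 0)" if "\<not> x \<le> M"
        using full_shape[OF K(1), of "t + (x - Suc M)" 0] that by blast
      then show ?thesis using V(3) unfolding S_def by (cases "x \<le> M") (simp_all only: if_True if_False not_False_eq_True)
    qed
    ultimately obtain K' where K': "full m' K'" "\<And>x. x \<le> m' \<Longrightarrow> K' x 0 = S x"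
      using full_ex[of S m'] by blast
    have eq: "\<forall>a \<le> r. K' (m' - s) a = K (m - s) a" if "s \<le> m - t" for s
      using that
    proof (induction s)
      case 0
      then show ?case using full_D[OF K'(1)] full_D[OF K(1)] by simp
    next
      case (Suc s)
      then have IH: "\<And>a. a \<le> r \<Longrightarrow> K' (m' - s) a = K (m - s) a" by simp
      have e: "m' - s = Suc (m' - Suc s)" "m - s = Suc (m - Suc s)" using Suc.prems unfolding m'_def by linarith+
      have "K' (m' - Suc s) a = K (m - Suc s) a" if "a \<le> r" for a
        using that
      proof (induction a)
        case 0
        have "\<not> m' - Suc s \<le> M" "t + (m' - Suc s - Suc M) = m - Suc s" using Suc.prems K(2) unfolding m'_def by linarith+
        then show ?case using K'(2)[of "m' - Suc s"] by (simp add: S_def)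
      next
        case (Suc a)
        have lt: "m' - Suc s < m'" "m - Suc s < m" using e by linarith+
        have 1: "jdt (K' (m' - Suc s) a) (K' (m' - Suc s) (Suc a)) (K' (m' - s) a) (K' (m' - s) (Suc a))"
          unfolding e(1) using full_jdt[OF K'(1) lt(1), of a] Suc.prems by simp
        have 2: "jdt (K (m - Suc s) a) (K (m - Suc s) (Suc a)) (K (m - s) a) (K (m - s) (Suc a))"
          unfolding e(2) using full_jdt[OF K(1) lt(2), of a] Suc.prems by simp
        show ?case
        proof (rule jdt_functional[OF _ 2])
          show "jdt (K (m - Suc s) a) (K' (m' - Suc s) (Suc a)) (K (m - s) a) (K (m - s) (Suc a))"
            using 1 IH[of a] IH[of "Suc a"] Suc by simp
        qed (use lt Suc.prems in \<open>auto intro: full_shape[OF K(1)] full_shape[OF K'(1)]\<close>)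
      qed
      then show ?case by blast
    qed
    have "m' - (m - t) = Suc M" "m - (m - t) = t" using K(2) unfolding m'_def by linarith+
    then have "\<forall>a \<le> r. K' (Suc M) a = K t a" using eq[of "m - t"] by simp
    moreover have "K' M 0 = \<beta>" using K'(2)[of M] V(2)[of M] by (simp add: S_def m'_def)
    moreover have "M < m'" by (simp add: m'_def)
    ultimately show ?thesis using K'(1) by blast
  qed
  have reach: "\<exists>m K t. full m K \<and> t \<le> m \<and> U = chain_tab (K t) r" if "jdt_step\<^sup>*\<^sup>* (chain_tab D r) U" for U
    using that
  proof (induction rule: rtranclp_induct)
    case base
    obtain V M where V: "V 0 = (\<lambda>_. 0)" "\<And>a. M \<le> a \<Longrightarrow> V a = D 0" "\<And>a. is_shape (V a)"
      "\<And>a. a < M \<Longrightarrow> \<exists>k. V (Suc a) = V a \<oplus> Some k"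
      using chain_between[OF is_shape_zero D(1)[of 0]] by auto
    then obtain K where "full M K" using full_ex[of V M] by blast
    moreover have "chain_tab D r = chain_tab (K M) r"
      by (rule chain_tab_cong) (simp add: full_D[OF \<open>full M K\<close>])
    ultimately show ?case by blast
  next
    case (step U U')
    then obtain m K t where K: "full m K" "t \<le> m" and U: "U = chain_tab (K t) r" by blast
    obtain c where c: "inner_corner (dom U) c" and sl: "slide U c U'" using step(2) unfolding jdt_step_def by blast
    obtain i j where ij: "c = (i, j)" by force
    have corner: "j < K t 0 i" "\<not> Suc j < K t 0 i" "\<not> j < K t 0 (Suc i)"
      using c unfolding U ij inner_corner_def by (simp_all add: inner[OF K])
    have shape: "is_shape (K t 0)" using full_shape[OF K] by simp
    define \<beta> where "\<beta> = (K t 0)(i := j)"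
    have \<beta>: "K t 0 = \<beta> \<oplus> Some i" using corner by (auto simp: \<beta>_def)
    have "is_shape \<beta>"
    proof -
      obtain z where "K t 0 z = 0" using shape by (auto simp: is_shape_def)
      then have "\<beta> z = 0" using corner by (auto simp: \<beta>_def)
      moreover have "\<beta> (Suc x) \<le> \<beta> x" for x
        using is_shape_antimono[OF shape, of x "Suc x"] corner by (auto simp: \<beta>_def)
      ultimately show ?thesis by (intro is_shapeI)
    qed
    from modify[OF K this \<beta>] obtain m' K' t' where K': "full m' K'" "t' < m'"
      "\<forall>a \<le> r. K' (Suc t') a = K t a" "K' t' 0 = \<beta>" by blast
    have "K' (Suc t') 0 = K' t' 0 \<oplus> Some i" using K'(3,4) \<beta> by simp
    from slide_K[OF K'(1,2) this] have "slide (chain_tab (K' (Suc t')) r) c (chain_tab (K' t') r)"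
      using K'(4) ij by (simp add: \<beta>_def)
    moreover have "chain_tab (K' (Suc t')) r = U" unfolding U by (rule chain_tab_cong) (use K'(3) in blast)
    ultimately have "U' = chain_tab (K' t') r" using sl slide_functional by blast
    then show ?case using K'(1) less_imp_le[OF K'(2)] by blast
  qed
  have final: "U = chain_tab (T 0) r" if h: "jdt_step\<^sup>*\<^sup>* (chain_tab D r) U" "inner_shape (dom U) = {}" for U
  proof -
    obtain m K t where K: "full m K" "t \<le> m" and U: "U = chain_tab (K t) r" using reach[OF h(1)] by blast
    have "K t 0 i = 0" for i using inner[OF K] h(2) U by auto
    then have z: "K t 0 = (\<lambda>_. 0)" by auto
    have "t = 0"
    proof (rule ccontr)
      assume "t \<noteq> 0"
      then obtain s where s: "t = Suc s" by (cases t) auto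
      then obtain k where "K t 0 = K s 0 \<oplus> Some k" using full_step[OF K(1), of s] K(2) by auto
      from fun_cong[OF this, of k] z show False by simp
    qed
    then show ?thesis unfolding U by (intro chain_tab_cong) (simp add: full_0[OF K(1)])
  qed
  obtain m K t where K: "full m K" using reach[of "chain_tab D r"] by blast
  have K0: "chain_tab (K 0) r = chain_tab (T 0) r" by (rule chain_tab_cong) (rule full_0[OF K])
  have "jdt_step\<^sup>*\<^sup>* (chain_tab D r) (chain_tab (T 0) r)" using path[OF K, of 0] K0 by simp
  moreover have "inner_shape (dom (chain_tab (T 0) r)) = {}"
    using inner[OF K, of 0] K0 full_0[OF K, of 0] T0 by simp
  ultimately have ex: "jdt_step\<^sup>*\<^sup>* (chain_tab D r) (chain_tab (T 0) r) \<and> inner_shape (dom (chain_tab (T 0) r)) = {}"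
    by blast
  show ?thesis unfolding rectify_def by (rule the_equality, rule ex, elim conjE, rule final)
qed

section \<open>Tableaux of chains and their rotation\<close>

lemma chain_tab_eq_Some:
  assumes "\<And>a i. a < r \<Longrightarrow> D a i \<le> D (Suc a) i"
  shows "chain_tab D r (i, j) = Some a \<longleftrightarrow> a \<in> {1..r} \<and> D (a - 1) i \<le> j \<and> j < D a i"
  using assms
proof (induction r)
  case (Suc r)
  have mono: "D a i \<le> D b i" if "a \<le> b" "b \<le> r" for a b
    using that
  proof (induction rule: dec_induct)
    case (step b)
    then show ?case using Suc.prems[of b i] by simp
  qed simp
  show ?case
  proof (cases "D r i \<le> j \<and> j < D (Suc r) i")
    case True
    have "\<not> j < D a i" if "a \<le> r" for a using mono[OF that] True by simp
    then show ?thesis using True by (auto simp: le_Suc_eq)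
  next
    case False
    then show ?thesis using Suc by (auto simp: le_Suc_eq)
  qed
qed simp

lemma tableau_of_chain_eq_chain_tab:
  assumes "\<And>a. a \<le> r \<Longrightarrow> is_shape (\<Lambda> a)" "\<And>a i. a < r \<Longrightarrow> \<Lambda> a i \<le> \<Lambda> (Suc a) i"
    and L: "\<And>a. a \<le> r \<Longrightarrow> L a = part_of (\<Lambda> a)"
  shows "tableau_of_chain r L = chain_tab \<Lambda> r"
proof
  fix c :: "nat \<times> nat"
  obtain i j where c: "c = (i, j)" by force
  have diag: "(i, j) \<in> diagram (L a) \<longleftrightarrow> j < \<Lambda> a i" if "a \<le> r" for a
  proof -
    have "(i, j) \<in> diagram (L a) \<longleftrightarrow> j < row_fun (L a) i" by (auto simp: diagram_def row_fun_def)
    then show ?thesis using assms(1) L that by simp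
  qed
  define P where "P a \<longleftrightarrow> a \<in> {1..r} \<and> c \<in> diagram (L a) - diagram (L (a - 1))" for a
  have tab: "chain_tab \<Lambda> r (i, j) = Some a \<longleftrightarrow> a \<in> {1..r} \<and> \<Lambda> (a - 1) i \<le> j \<and> j < \<Lambda> a i" for a
    by (rule chain_tab_eq_Some) (rule assms(2))
  have tabP: "chain_tab \<Lambda> r c = Some a \<longleftrightarrow> P a" for a
  proof (cases "a \<in> {1..r}")
    case True
    then have "a \<le> r" "a - 1 \<le> r" by auto
    then show ?thesis unfolding P_def c tab Diff_iff using diag[of a] diag[of "a - 1"] by (simp only: not_less) blast
  next
    case False
    then show ?thesis unfolding P_def c tab by blast
  qed
  show "tableau_of_chain r L c = chain_tab \<Lambda> r c"
  proof (cases "\<exists>a. P a")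
    case True
    then obtain a where a: "P a" ..
    have "b = a" if "P b" for b using tabP[of a] tabP[of b] a that by simp
    then have "(THE a. P a) = a" using a by blast
    moreover have "tableau_of_chain r L c = Some (THE a. P a)"
      using a unfolding tableau_of_chain_def P_def by auto
    ultimately show ?thesis using tabP[of a] a by simp
  next
    case False
    then have "tableau_of_chain r L c = None" unfolding tableau_of_chain_def P_def by auto
    then show ?thesis using False tabP by (cases "chain_tab \<Lambda> r c") auto
  qed
qed

text \<open>After rotation the entries up to \<open>a\<close> come from the entries above
  \<open>r - a\<close>, so they occupy, together with the inner shape, the complement of the cells
  with entries up to \<open>r - a\<close>.\<close>

lemma rotate_complement_chain_tab:
  assumes shapes: "\<And>a. a \<le> r \<Longrightarrow> is_shape (\<Lambda> a)" and mono: "\<And>a i. a < r \<Longrightarrow> \<Lambda> a i \<le> \<Lambda> (Suc a) i"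
    and zero: "\<Lambda> 0 = (\<lambda>_. 0)"
  shows "rotate_complement r (chain_tab \<Lambda> r)
    = chain_tab (\<lambda>a. box_compl (top_row (\<Lambda> r) 0) (\<Lambda> r 0) (\<Lambda> (r - a))) r"
proof -
  define h w where "h = top_row (\<Lambda> r) 0" and "w = \<Lambda> r 0"
  define D where "D a = box_compl h w (\<Lambda> (r - a))" for a
  have dom: "dom (chain_tab \<Lambda> r) = {(i, j). j < \<Lambda> r i}"
    using chain_tab_dom[of r \<Lambda>, OF mono] zero by simp
  have h: "0 < \<Lambda> r i \<longleftrightarrow> i < h" for i
    unfolding h_def using le_top_row_iff[OF shapes[OF order_refl], of 0 i] by auto
  have hw: "card {i. (i, 0) \<in> dom (chain_tab \<Lambda> r)} = h" "card {j. (0, j) \<in> dom (chain_tab \<Lambda> r)} = w"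
  proof -
    have "{i. (i, 0) \<in> dom (chain_tab \<Lambda> r)} = {..<h}" "{j. (0, j) \<in> dom (chain_tab \<Lambda> r)} = {..<w}"
      unfolding dom using h by (auto simp: w_def)
    then show "card {i. (i, 0) \<in> dom (chain_tab \<Lambda> r)} = h" "card {j. (0, j) \<in> dom (chain_tab \<Lambda> r)} = w"
      by simp_all
  qed
  have le_w: "\<Lambda> a i \<le> w" if "a \<le> r" for a i
    using that
  proof (induction rule: inc_induct)
    case base
    show ?case unfolding w_def by (rule is_shape_antimono[OF shapes]) auto
  next
    case (step a)
    then show ?case using mono[of a i] by simp
  qed
  have D_mono: "D a i \<le> D (Suc a) i" if "a < r" for a i
  proof -
    have "\<Lambda> (r - Suc a) x \<le> \<Lambda> (r - a) x" for x using mono[of "r - Suc a" x] that by (simp add: Suc_diff_Suc)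
    then show ?thesis by (simp add: D_def box_compl_def diff_le_mono2)
  qed
  have "rotate_complement r (chain_tab \<Lambda> r) (i, j) = chain_tab D r (i, j)" for i j
  proof -
    have 1: "rotate_complement r (chain_tab \<Lambda> r) (i, j) = (if i < h \<and> j < w
      then map_option (\<lambda>x. r + 1 - x) (chain_tab \<Lambda> r (h - 1 - i, w - 1 - j)) else None)"
      unfolding rotate_complement_def hw by simp
    have D_Some: "chain_tab D r (i, j) = Some b \<longleftrightarrow> b \<in> {1..r} \<and> D (b - 1) i \<le> j \<and> j < D b i" for b
      by (rule chain_tab_eq_Some) (rule D_mono)
    have L_Some: "chain_tab \<Lambda> r (h - 1 - i, w - 1 - j) = Some a \<longleftrightarrow>
        a \<in> {1..r} \<and> \<Lambda> (a - 1) (h - 1 - i) \<le> w - 1 - j \<and> w - 1 - j < \<Lambda> a (h - 1 - i)" for a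
      by (rule chain_tab_eq_Some) (rule mono)
    show ?thesis
    proof (cases "i < h \<and> j < w")
      case False
      have "chain_tab D r (i, j) \<noteq> Some b" for b
        unfolding D_Some using False by (auto simp: D_def box_compl_def)
      then show ?thesis unfolding 1 using False by (cases "chain_tab D r (i, j)") auto
    next
      case True
      have iff: "chain_tab D r (i, j) = Some b \<longleftrightarrow> chain_tab \<Lambda> r (h - 1 - i, w - 1 - j) = Some (r + 1 - b)"
        if b: "1 \<le> b" "b \<le> r" for b
      proof -
        have e: "r - (b - 1) = r + 1 - b" "r - b = r + 1 - b - 1" using b by auto
        define x y where "x = \<Lambda> (r + 1 - b - 1) (h - 1 - i)" and "y = \<Lambda> (r + 1 - b) (h - 1 - i)"
        have xy: "x \<le> w" "y \<le> w" unfolding x_def y_def using le_w b by auto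
        have "D (b - 1) i = w - y" "D b i = w - x"
          using True unfolding D_def box_compl_def e x_def y_def by simp_all
        moreover have "w - y \<le> j \<and> j < w - x \<longleftrightarrow> x \<le> w - 1 - j \<and> w - 1 - j < y"
          using xy True by auto
        ultimately show ?thesis unfolding D_Some L_Some x_def[symmetric] y_def[symmetric] using b by auto
      qed
      have "map_option (\<lambda>x. r + 1 - x) (chain_tab \<Lambda> r (h - 1 - i, w - 1 - j)) = chain_tab D r (i, j)"
      proof (cases "chain_tab D r (i, j)")
        case None
        have "chain_tab \<Lambda> r (h - 1 - i, w - 1 - j) \<noteq> Some a" for a
        proof
          assume a: "chain_tab \<Lambda> r (h - 1 - i, w - 1 - j) = Some a"
          then have "1 \<le> a" "a \<le> r" using L_Some by auto
          then show False using iff[of "r + 1 - a"] a None by simp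
        qed
        then show ?thesis using None by (cases "chain_tab \<Lambda> r (h - 1 - i, w - 1 - j)") auto
      next
        case (Some b)
        then have b: "1 \<le> b" "b \<le> r" using D_Some by auto
        then have "chain_tab \<Lambda> r (h - 1 - i, w - 1 - j) = Some (r + 1 - b)" using iff Some by blast
        then show ?thesis using Some b by simp
      qed
      then show ?thesis unfolding 1 using True by simp
    qed
  qed
  then have "rotate_complement r (chain_tab \<Lambda> r) = chain_tab D r" by (intro ext) (simp add: split_paired_all)
  then show ?thesis unfolding D_def[abs_def] h_def w_def .
qed

text \<open>The chain \<open>D\<close> of the rotated tableau ends in the full box, and the
  complements of \<open>D\<close> are the shapes of the initial segments again. Read backwards,
  these form the right side of the reversed triangle \<open>T\<close>, whose top side consists of
  the shapes of the final segments.\<close>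

theorem schuetzenberger_evac_rsk:
  assumes X: "partial_bij X" "distinct rs"
    and L: "\<And>a. a \<le> r \<Longrightarrow> L a = part_of (rsk X (rev [1..<Suc a]) rs)"
      "\<And>a. a \<le> r \<Longrightarrow> L' a = part_of (rsk X (rev [Suc (r - a)..<Suc r]) rs)"
  shows "tableau_of_chain r L' = schuetzenberger_evac r (tableau_of_chain r L)"
proof -
  define J where "J i a = rsk X (rev [Suc i..<Suc a]) rs" for i a
  define T where "T i a = J (r - a) (r - i)" for i a
  define h w where "h = top_row (J 0 r) 0" and "w = J 0 r 0"
  define D where "D a = box_compl h w (J 0 (r - a))" for a
  have J: "triangle r J" unfolding J_def by (rule triangle_rsk[OF X])
  have T: "triangle r T" unfolding T_def by (rule triangle_reverse[OF J])
  have J_shape: "is_shape (J i a)" if "i \<le> a" "a \<le> r" for i a using J that by (simp add: triangle_def)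
  have J0: "J i i = (\<lambda>_. 0)" for i by (simp add: J_def)
  have Jtop: "J 0 a i \<le> J 0 (Suc a) i" if "a < r" for a i
    by (rule triangle_mono[OF J]) (use that in auto)
  have J_box: "J 0 a x \<le> box h w x" if "a \<le> r" for a x
  proof -
    have le: "J 0 a x \<le> J 0 r x" by (rule triangle_mono[OF J]) (use that in auto)
    have "J 0 r x \<le> J 0 r 0" by (rule is_shape_antimono[OF J_shape]) auto
    moreover have "J 0 r x = 0" if "h \<le> x"
      using le_top_row_iff[OF J_shape[of 0 r], of 0 x] that by (simp add: h_def)
    ultimately show ?thesis using le by (auto simp: box_def w_def)
  qed
  have "tableau_of_chain r L = chain_tab (J 0) r"
  proof (rule tableau_of_chain_eq_chain_tab)
    show "L a = part_of (J 0 a)" if "a \<le> r" for a using L(1)[OF that] by (simp add: J_def del: upt_Suc)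
  qed (simp_all add: J_shape Jtop)
  moreover have "rotate_complement r (chain_tab (J 0) r) = chain_tab D r"
    unfolding D_def[abs_def] h_def w_def by (rule rotate_complement_chain_tab) (auto simp: J_shape Jtop J0)
  moreover have "rectify (chain_tab D r) = chain_tab (T 0) r"
  proof (rule rectify_chain_tab)
    show "is_shape (D a)" if "a \<le> r" for a
      unfolding D_def by (rule is_shape_box_compl) (auto simp: J_shape J_box)
    show "\<exists>p. D (Suc a) = D a \<oplus> p" if "a < r" for a
    proof -
      have s: "r - a = Suc (r - Suc a)" using that by simp
      obtain p where p: "J 0 (Suc (r - Suc a)) = J 0 (r - Suc a) \<oplus> p"
        using triangle_right[OF J, of 0 "r - Suc a"] \<open>a < r\<close> by auto
      show ?thesis unfolding D_def s p
        by (rule box_compl_add_cell) (use J_box[of "Suc (r - Suc a)"] p that in simp)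
    qed
    show "D r = box h w" by (auto simp: D_def J0 box_compl_def box_def)
    \<comment> \<open>The bounding box is tight: the first row has \<open>w\<close> cells, so the
      last row of the complement is empty, and each of the \<open>h\<close> rows has a cell, so the
      complement is narrower than \<open>w\<close>.\<close>
    show "D 0 x \<le> box (h - 1) (w - 1) x" for x
    proof (cases "x < h - 1")
      case True
      then have "\<not> top_row (J 0 r) 0 \<le> h - 1 - x" by (simp add: h_def)
      then have "0 < J 0 r (h - 1 - x)" using le_top_row_iff[OF J_shape[of 0 r]] by simp
      then show ?thesis using True by (auto simp: D_def box_compl_def box_def intro!: diff_le_mono2)
    next
      case False
      then have "h - 1 - x = 0" by simp
      then show ?thesis by (simp add: D_def box_compl_def w_def)
    qed
    show "triangle r T" by (rule T)
    show "T i r = box_compl h w (D i)" if "i \<le> r" for i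
    proof
      fix x
      have "J 0 (r - i) x \<le> box h w x" using J_box by simp
      moreover have "h - 1 - (h - 1 - x) = x" if "x < h" using that by simp
      ultimately show "T i r x = box_compl h w (D i) x"
        by (cases "x < h") (auto simp: T_def D_def box_compl_def box_def)
    qed
  qed
  moreover have "tableau_of_chain r L' = chain_tab (T 0) r"
  proof (rule tableau_of_chain_eq_chain_tab)
    show "is_shape (T 0 a)" if "a \<le> r" for a using T that by (simp add: triangle_def)
    show "T 0 a i \<le> T 0 (Suc a) i" if "a < r" for a i
      by (rule triangle_mono[OF T]) (use that in auto)
    show "L' a = part_of (T 0 a)" if "a \<le> r" for a using L(2)[OF that] by (simp add: T_def J_def del: upt_Suc)
  qed
  ultimately show ?thesis by (simp add: schuetzenberger_evac_def)
qed

section \<open>The theorem\<close>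

lemma row_fun_staircase:
  assumes "staircase n v" "k < n"
  shows "row_fun (pos_part v) k = nat (v ! k)" "row_fun (neg_part v) k = nat (- v ! (n - 1 - k))"
proof -
  let ?p = "row_fun (pos_part v)" and ?m = "row_fun (neg_part v)"
  have v: "v ! k = int (?p k) - int (?m (n - 1 - k))" if "k < n" for k
    using arg_cong[OF staircase_eq_stair(1)[OF assms(1)], of "\<lambda>v. v ! k"] that by (simp add: vec_def)
  note fits = staircase_eq_stair(2)[OF assms(1)]
  have "?p k = 0 \<or> ?m (n - 1 - k) = 0" using fits_pos(2)[OF fits, of k] by (cases "?p k = 0") simp_all
  then show "?p k = nat (v ! k)" using v[OF assms(2)] by auto
  have "?m k = 0 \<or> ?p (n - 1 - k) = 0" using fits_pos(2)[OF fits_commute[OF fits], of k] by (cases "?m k = 0") simp_all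
  moreover have "n - 1 - (n - 1 - k) = k" using assms(2) by simp
  ultimately show "?m k = nat (- v ! (n - 1 - k))" using v[of "n - 1 - k"] assms(2) by auto
qed

lemma row_fun_staircase_outside:
  assumes "staircase n v" "n \<le> k"
  shows "row_fun (pos_part v) k = 0" "row_fun (neg_part v) k = 0"
  using fits_pos(1)[OF staircase_eq_stair(2)[OF assms(1)], of k]
    fits_pos(1)[OF fits_commute[OF staircase_eq_stair(2)[OF assms(1)]], of k] assms(2) by (meson not_le)+

text \<open>The sign of the entry decides which part changes. Subtractions are covered by reading
  the step backwards.\<close>

lemma staircase_increment:
  assumes v: "staircase n v" "staircase n v'" and x: "x < n" "v' = v[x := v ! x + 1]"
  shows "\<exists>a b. row_fun (pos_part v') = row_fun (pos_part v) \<oplus> a \<and>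
    row_fun (neg_part v) = row_fun (neg_part v') \<oplus> b \<and> (a = None \<or> b = None)"
proof -
  have len: "length v = n" using v(1) by (simp add: staircase_def)
  define a where "a = (if 0 \<le> v ! x then Some x else None)"
  define b where "b = (if 0 \<le> v ! x then None else Some (n - 1 - x))"
  have v': "v' ! k = (if k = x then v ! x + 1 else v ! k)" if "k < n" for k
    using that x len by (simp add: nth_list_update)
  have "row_fun (pos_part v') k = (row_fun (pos_part v) \<oplus> a) k" for k
  proof (cases "k < n")
    case True
    then show ?thesis using row_fun_staircase(1)[OF v(1) True] row_fun_staircase(1)[OF v(2) True] v'[OF True]
      by (auto simp: add_cell_apply a_def nat_add_distrib)
  next
    case False
    then show ?thesis using row_fun_staircase_outside(1)[OF v(1), of k] row_fun_staircase_outside(1)[OF v(2), of k] x(1)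
      by (auto simp: add_cell_apply a_def)
  qed
  moreover have "row_fun (neg_part v) k = (row_fun (neg_part v') \<oplus> b) k" for k
  proof (cases "k < n")
    case True
    then have k': "n - 1 - k < n" "n - 1 - k = x \<longleftrightarrow> k = n - 1 - x" using x(1) by auto
    show ?thesis using row_fun_staircase(2)[OF v(1) True] row_fun_staircase(2)[OF v(2) True] v'[OF k'(1)] k'(2)
      by (auto simp: add_cell_apply b_def)
  next
    case False
    then show ?thesis using row_fun_staircase_outside(2)[OF v(1), of k] row_fun_staircase_outside(2)[OF v(2), of k] x(1)
      by (auto simp: add_cell_apply b_def)
  qed
  ultimately have "row_fun (pos_part v') = row_fun (pos_part v) \<oplus> a" "row_fun (neg_part v) = row_fun (neg_part v') \<oplus> b"
    by auto
  then show ?thesis by (auto simp: a_def b_def split: if_splits)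
qed

lemma descending_chain:
  assumes "is_part xs"
  obtains q M where "q 0 = xs" "\<And>s. M \<le> s \<Longrightarrow> q s = []" "\<And>s. is_part (q s)"
    "\<And>s. \<exists>a. row_fun (q s) = row_fun (q (Suc s)) \<oplus> a"
proof -
  obtain V M where V: "V 0 = (\<lambda>_. 0)" "\<And>a. M \<le> a \<Longrightarrow> V a = row_fun xs" "\<And>a. is_shape (V a)"
    "\<And>a. a < M \<Longrightarrow> \<exists>k. V (Suc a) = V a \<oplus> Some k"
    using chain_between[OF is_shape_zero is_shape_row_fun[OF assms]] by auto
  show ?thesis
  proof (rule that)
    show "part_of (V (M - 0)) = xs" using V(2)[of M] assms by simp
    show "part_of (V (M - s)) = []" if "M \<le> s" for s using V(1) that part_of_row_fun[of "[]"] by simp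
    show "is_part (part_of (V (M - s)))" for s using V(3) by (rule is_part_part_of)
    show "\<exists>a. row_fun (part_of (V (M - s))) = row_fun (part_of (V (M - Suc s))) \<oplus> a" for s
    proof (cases "s < M")
      case True
      then have s: "M - s = Suc (M - Suc s)" by simp
      show ?thesis unfolding s using V(4)[of "M - Suc s"] V(3) True by (auto simp del: add_cell.simps)
    next
      case False
      then show ?thesis by (intro exI[of _ None]) simp
    qed
  qed
qed

text \<open>The tableau is continued until its positive and its negative part have become empty. This makes
  all the labels Robinson-Schensted shapes of submatrices of one partial permutation matrix.\<close>

lemma staircase_path_extension:
  assumes "alternating_tableau n r \<mu> A"
  obtains p m E where "staircase_path p m E" "r \<le> E" "\<And>j. j \<le> 2 * r \<Longrightarrow> p j = pos_part (A ! j)"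
    "\<And>j. j \<le> 2 * r \<Longrightarrow> m j = neg_part (A ! j)"
proof -
  have st: "staircase n (A ! j)" if "j \<le> 2 * r" for j
    using assms that by (auto simp: alternating_tableau_def)
  note parts = staircase_eq_stair(3,4)[OF st]
  obtain q M where q: "q 0 = pos_part (A ! (2 * r))" "\<And>s. M \<le> s \<Longrightarrow> q s = []" "\<And>s. is_part (q s)"
    "\<And>s. \<exists>a. row_fun (q s) = row_fun (q (Suc s)) \<oplus> a"
    by (rule descending_chain[OF parts(1)[OF order_refl]]) blast
  obtain q' M' where q': "q' 0 = neg_part (A ! (2 * r))" "\<And>s. M' \<le> s \<Longrightarrow> q' s = []" "\<And>s. is_part (q' s)"
    "\<And>s. \<exists>a. row_fun (q' s) = row_fun (q' (Suc s)) \<oplus> a"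
    by (rule descending_chain[OF parts(2)[OF order_refl]]) blast
  \<comment> \<open>Beyond \<open>2 * r\<close> the positive part may lose cells only in subtracting
    steps and the negative part only in adding steps. So \<open>p\<close> advances on reaching an
    even index and \<open>m\<close> on reaching an odd one.\<close>
  define p where "p k = (if k \<le> 2 * r then pos_part (A ! k) else q (k div 2 - r))" for k
  define m where "m k = (if k \<le> 2 * r then neg_part (A ! k) else q' (Suc k div 2 - r))" for k
  define E where "E = Suc (r + M + M')"
  have "staircase_path p m E"
  proof
    have "A ! 0 = replicate n 0" using assms by (simp add: alternating_tableau_def)
    then show "p 0 = []" "m 0 = []" by (simp_all add: p_def m_def pos_part_def neg_part_def filter_replicate)
    show "is_part (p k)" "is_part (m k)" for k using parts[of k] q(3) q'(3) by (auto simp: p_def m_def)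
    show "p k = []" "m k = []" if "2 * E \<le> k" for k
    proof -
      have "E \<le> k div 2" using that by (simp add: less_eq_div_iff_mult_less_eq)
      moreover have "k div 2 \<le> Suc k div 2" by (simp add: div_le_mono)
      ultimately have "M \<le> k div 2 - r" "M' \<le> Suc k div 2 - r" "\<not> k \<le> 2 * r"
        using that unfolding E_def by simp_all
      then show "p k = []" "m k = []" using q(2) q'(2) by (simp_all add: p_def m_def)
    qed
    show "0 < E" by (simp add: E_def)
    have q_later: "p k = q (k div 2 - r)" "m k = q' (Suc k div 2 - r)" if "2 * r \<le> k" for k
      using that q(1) q'(1) by (auto simp: p_def m_def le_less)
    have step: "\<exists>x<n. A ! Suc i = (A ! i)[x := (A ! i) ! x + (if even i then 1 else - 1)]" if "i < 2 * r" for i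
      using assms that by (simp add: alternating_tableau_def)
    fix k
    show "\<exists>a b. row_fun (p (Suc (2 * k))) = row_fun (p (2 * k)) \<oplus> a \<and>
      row_fun (m (2 * k)) = row_fun (m (Suc (2 * k))) \<oplus> b \<and> (a = None \<or> b = None)"
    proof (cases "k < r")
      case True
      then obtain x where "x < n" "A ! Suc (2 * k) = (A ! (2 * k))[x := (A ! (2 * k)) ! x + 1]" using step[of "2 * k"] by auto
      from staircase_increment[OF st st this] True show ?thesis by (simp add: p_def m_def)
    next
      case False
      then have "p (Suc (2 * k)) = q (k - r)" "p (2 * k) = q (k - r)" "m (2 * k) = q' (k - r)"
        "m (Suc (2 * k)) = q' (Suc (k - r))"
        using q_later[of "2 * k"] q_later[of "Suc (2 * k)"] by (simp_all add: Suc_diff_le)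
      moreover obtain b where "row_fun (q' (k - r)) = row_fun (q' (Suc (k - r))) \<oplus> b" using q'(4) by blast
      ultimately show ?thesis by (intro exI[of _ None] exI[of _ b]) (simp del: add_cell.simps(2))
    qed
    show "\<exists>a b. row_fun (p (Suc (2 * k))) = row_fun (p (Suc (Suc (2 * k)))) \<oplus> a \<and>
      row_fun (m (Suc (Suc (2 * k)))) = row_fun (m (Suc (2 * k))) \<oplus> b \<and> (a = None \<or> b = None)"
    proof (cases "k < r")
      case True
      then obtain x where x: "x < n" "A ! Suc (Suc (2 * k)) = (A ! Suc (2 * k))[x := (A ! Suc (2 * k)) ! x - 1]"
        using step[of "Suc (2 * k)"] by auto
      have "length (A ! Suc (2 * k)) = n" using st[of "Suc (2 * k)"] True by (simp add: staircase_def)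
      then have "A ! Suc (2 * k) = (A ! Suc (Suc (2 * k)))[x := (A ! Suc (Suc (2 * k))) ! x + 1]"
        unfolding x(2) using x(1) by simp
      from staircase_increment[OF st st x(1) this] True show ?thesis by (simp add: p_def m_def)
    next
      case False
      then have "p (Suc (2 * k)) = q (k - r)" "p (Suc (Suc (2 * k))) = q (Suc (k - r))"
        "m (Suc (2 * k)) = q' (Suc (k - r))" "m (Suc (Suc (2 * k))) = q' (Suc (k - r))"
        using q_later[of "Suc (Suc (2 * k))"] q_later[of "Suc (2 * k)"] by (simp_all add: Suc_diff_le)
      moreover obtain a where "row_fun (q (k - r)) = row_fun (q (Suc (k - r))) \<oplus> a" using q(4) by blast
      ultimately show ?thesis by (intro exI[of _ a] exI[of _ None]) (simp del: add_cell.simps(2))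
    qed
  qed
  then show ?thesis by (rule that) (auto simp: p_def m_def E_def)
qed

theorem theorem3p6:
  fixes n r :: nat and \<mu> :: "int list" and A :: "int list list"
  assumes "alternating_tableau n r \<mu> A"
    and "r \<le> (n + 1) div 2"
  shows "partial_perm r (evac n r A) = reverse_complement r (partial_perm r A) \<and>
    (tableau_P r (evac n r A), tableau_Q r (evac n r A)) =
      (schuetzenberger_evac r (tableau_P r A), schuetzenberger_evac r (tableau_Q r A))"
proof -
  obtain p m E where path: "staircase_path p m E" and E: "r \<le> E"
    and pm: "\<And>j. j \<le> 2 * r \<Longrightarrow> p j = pos_part (A ! j)" "\<And>j. j \<le> 2 * r \<Longrightarrow> m j = neg_part (A ! j)"
    by (rule staircase_path_extension[OF assms(1)]) blast
  interpret staircase_path p m E by (rule path)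
  have st: "staircase n (A ! j)" if "j \<le> 2 * r" for j
    using assms(1) that by (auto simp: alternating_tableau_def)
  have n: "2 * r \<le> Suc n" using assms(2) by linarith
  note facts = st pm E n
  let ?rs = "[Suc r..<Suc E]"
  \<comment> \<open>For \<open>Q\<close> the roles of rows and columns are exchanged. The rotation
    is needed because the initial segments of rows are listed from top to bottom, whereas those of
    columns are listed from right to left.\<close>
  have swap: "rsk X (rev cs) rs = rsk (\<lambda>r c. X c r) (rev rs) cs" if "distinct cs" "distinct rs" for cs rs
    using rsk_rotate[OF partial_bij_X, of "rev cs" rs] rsk_transpose[of X "rev rs" cs] that by simp
  have "tableau_P r (evac n r A) = schuetzenberger_evac r (tableau_P r A)"
    unfolding tableau_P_def
    by (rule schuetzenberger_evac_rsk[OF partial_bij_X, of ?rs])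
      (simp_all add: pos_label_A[OF facts] pos_label_evac[OF facts] del: upt_Suc)
  moreover have "tableau_Q r (evac n r A) = schuetzenberger_evac r (tableau_Q r A)"
    unfolding tableau_Q_def
    by (rule schuetzenberger_evac_rsk[OF partial_bij_transpose[OF partial_bij_X], of ?rs])
      (simp_all add: neg_label_A[OF facts] neg_label_evac[OF facts] swap del: upt_Suc)
  ultimately show ?thesis using partial_perm_evac[OF facts] by simp
qed

end
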